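(* Let $p,q$ satisfy \[ p(q-1)>2+\frac{1}{pq},\qquad 1<q<2,\qquad 2<p<3 . \] Consider the system \[ \partial_t^2u-\Delta u=|v|^q,\qquad \partial_t^2v-\Delta v=|\partial_t u|^p,\qquad (t,x)\in[0,\infty)\times\mathbb{R}^3, \] \[ (u,\partial_tu)|_{t=0}=\varepsilon\big(f(x),g(x)\big),\qquad (v,\partial_tv)|_{t=0}=\varepsilon\big(\tilde f(x),\tilde g(x)\big), \] where $\varepsilon>0$. Suppose $f,\tilde f\in C^2(\mathbb{R}^3)$, $g,\tilde g\in C^1(\mathbb{R}^3)$ are spherically symmetric and supported in the unit ball $B_1(0)$. Then there exists $\varepsilon_0>0$ such that for every $0<\varepsilon<\varepsilon_0$ there exists a global solution $(u,v)$ of this system satisfying $u,v,\partial_tu\in C(\mathbb{R}^+\times\mathbb{R}^3)$. *)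

theory Defs
  imports "HOL-Analysis.Analysis"
begin

definition C1_fun :: "('a::real_normed_vector \<Rightarrow> real) \<Rightarrow> bool" where
  "C1_fun f \<longleftrightarrow> (\<exists>f'. (\<forall>x. (f has_derivative f' x) (at x)) \<and>
                        (\<forall>w. continuous_on UNIV (\<lambda>x. f' x w)))"

definition C2_fun :: "('a::real_normed_vector \<Rightarrow> real) \<Rightarrow> bool" where
  "C2_fun f \<longleftrightarrow> (\<exists>f'. (\<forall>x. (f has_derivative f' x) (at x)) \<and>
                        (\<forall>w. C1_fun (\<lambda>x. f' x w)))"

definition dd :: "('a::real_normed_vector \<Rightarrow> real) \<Rightarrow> 'a \<Rightarrow> 'a \<Rightarrow> real" where
  "dd \<phi> w z = deriv (\<lambda>s. \<phi> (z + s *\<^sub>R w)) 0"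

definition e_t :: "real \<times> (real^3)" where "e_t = (1, 0)"
definition e_x :: "3 \<Rightarrow> real \<times> (real^3)" where "e_x i = (0, axis i 1)"

definition dtt :: "(real \<times> (real^3) \<Rightarrow> real) \<Rightarrow> real \<times> (real^3) \<Rightarrow> real" where
  "dtt \<phi> = dd (dd \<phi> e_t) e_t"
definition lap :: "(real \<times> (real^3) \<Rightarrow> real) \<Rightarrow> real \<times> (real^3) \<Rightarrow> real" where
  "lap \<phi> z = (\<Sum>i\<in>UNIV. dd (dd \<phi> (e_x i)) (e_x i) z)"

text \<open>Test functions: C^2 with compact support (restricted to t >= 0 they give
  C_c^2([0,oo) x R^3)).\<close>
definition test_fun :: "(real \<times> (real^3) \<Rightarrow> real) \<Rightarrow> bool" where
  "test_fun \<phi> \<longleftrightarrow> C2_fun \<phi> \<and> compact (closure {z. \<phi> z \<noteq> 0})"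

text \<open>Weak (distributional) solution on [0,oo) x R^3 of
  w_tt - Laplace w = F, w(0) = w0, w_t(0) = w1.\<close>
definition weak_wave_sol ::
  "(real \<Rightarrow> real^3 \<Rightarrow> real) \<Rightarrow> (real \<Rightarrow> real^3 \<Rightarrow> real) \<Rightarrow>
   (real^3 \<Rightarrow> real) \<Rightarrow> (real^3 \<Rightarrow> real) \<Rightarrow> bool" where
  "weak_wave_sol w F w0 w1 \<longleftrightarrow>
     (\<forall>\<phi>. test_fun \<phi> \<longrightarrow>
        integral ({0..} \<times> UNIV) (\<lambda>(t,x). w t x * (dtt \<phi> (t,x) - lap \<phi> (t,x)))
        = integral ({0..} \<times> UNIV) (\<lambda>(t,x). F t x * \<phi> (t,x))
          + integral UNIV (\<lambda>x. w1 x * \<phi> (0,x))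
          - integral UNIV (\<lambda>x. w0 x * dd \<phi> e_t (0,x)))"

definition radial :: "(real^3 \<Rightarrow> real) \<Rightarrow> bool" where
  "radial f \<longleftrightarrow> (\<forall>x y. norm x = norm y \<longrightarrow> f x = f y)"

definition supp_in_unit_ball :: "(real^3 \<Rightarrow> real) \<Rightarrow> bool" where
  "supp_in_unit_ball f \<longleftrightarrow> closure {x. f x \<noteq> 0} \<subseteq> ball 0 1"

end

theory Submission
  imports Defs
begin

text \<open>
  In terms of \<open>W = r u\<^sub>t\<close> and \<open>V = r v\<close>, extended oddly in \<open>r\<close>, the system is a pair of
  one-dimensional wave equations with sources \<open>H = r |V/r|^q\<close> and \<open>K = r |W/r|^p\<close>, solved by
  d'Alembert's and Duhamel's formulas. Put \<open>A = 2 + t + r\<close>, \<open>B = 2 + |t - r|\<close> and fix \<open>\<kappa>\<close> with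
  \<open>1/(pq) < \<kappa> < min (p(q-1) - 2) (1/q)\<close>, which is possible by the hypothesis on \<open>p, q\<close>.
  If \<open>|W| \<le> M r A^(1-q) B^(-\<kappa>q)\<close>, then \<open>|K| \<le> M^p A^(-1-\<kappa>) B^(-\<kappa>pq)\<close>. As \<open>\<kappa>pq > 1\<close>, the integral of \<open>K\<close>
  along an incoming ray, which is \<open>(\<partial>\<^sub>t + \<partial>\<^sub>r) V\<close>, is of size \<open>A^(-1-\<kappa>)\<close>, and integrating along the
  outgoing ray gives \<open>V = O(r A^(-1) B^(-\<kappa>))\<close>. Integrating \<open>H\<close> along rays returns the weight assumed
  for \<open>W\<close>; this uses \<open>q < 2\<close>, \<open>\<kappa>q < 1\<close> and, near the axis, the bound for \<open>(\<partial>\<^sub>t + \<partial>\<^sub>r) V\<close>.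

  Since \<open>q < 2\<close>, the derivative of \<open>|y|^q\<close> is only Hoelder continuous, and the solution map for \<open>W\<close> does
  not contract in the norm just described. It does contract for the weaker weight
  \<open>A^(2-q) B^(-\<kappa>q)\<close>, and balls of the stronger norm are closed for the weaker one. Continuity of
  \<open>u\<^sub>t\<close> on the axis follows afterwards, because \<open>V\<close> is continuously differentiable.

  The weak equations are obtained by Cartesian integration by parts against test functions that
  vanish near the axis, after mollifying the source. A cutoff then removes the axis: its second
  derivatives of size \<open>\<delta>^(-2)\<close> live on a set of measure \<open>\<delta>^3\<close> while \<open>u\<close> and \<open>v\<close> are bounded.
\<close>

section \<open>Signed integrals and the Duhamel formula\<close>

text \<open>The bound 1/(pq) < \<kappa> makes B^(-\<kappa>pq) integrable across the light cone, and
  \<kappa> < p(q-1) - 2 is the decay in A that remains once r <= A has been spent in r |W/r|^p. As p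
  > 1 gives 1/(pq) < 1/q, the hypothesis on p and q says exactly that the interval for \<kappa> is
  not empty. The delicate point is the factor r in the bound for W. Near the axis it comes from a
  cancellation of two ray integrals of H, and to quantify it costs one derivative of H in the
  outgoing direction. For one iterate this is available, because that derivative involves V only
  through V/r and (\<partial>t + \<partial>r) V. For the difference of two iterates it would involve
  increments of |y|^(q-1), which is not Lipschitz. With A in place of r in the weight no such
  derivative is asked for, and the exponents in the estimate of K stay the same. Smallness comes
  from one source: M is proportional to \<epsilon>, the size N of r v is at most a constant times M,
  and r |v|^q then gains the factor M^(q-1).\<close>

abbreviation cont2 :: "(real \<Rightarrow> 'b::topological_space \<Rightarrow> real) \<Rightarrow> bool" where
  "cont2 g \<equiv> continuous_on UNIV (\<lambda>(s, y). g s y)"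

lemma cont2_comp:
  assumes "cont2 g" "continuous_on S f" "continuous_on S h"
  shows "continuous_on S (\<lambda>z. g (f z) (h z))"
proof -
  have "continuous_on S (\<lambda>z. (\<lambda>(s, y). g s y) (f z, h z))"
    by (rule continuous_on_compose2[OF assms(1)]) (auto intro!: continuous_intros assms)
  then show ?thesis by simp
qed

lemma compact_abs_bound:
  fixes f :: "'a::topological_space \<Rightarrow> real"
  assumes "compact S" "continuous_on S f"
  shows "\<exists>c>0. \<forall>x\<in>S. \<bar>f x\<bar> \<le> c"
  using compact_imp_bounded[OF compact_continuous_image[OF assms(2,1)]] unfolding bounded_pos by auto

lemma deriv_continuous_on:
  fixes f :: "real \<Rightarrow> real"
  shows "(\<And>y. y \<in> S \<Longrightarrow> (f has_real_derivative f' y) (at y)) \<Longrightarrow> continuous_on S f"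
  by (rule DERIV_continuous_on) (rule has_field_derivative_at_within)

text \<open>The integral from \<open>0\<close> to \<open>a\<close> for \<open>a\<close> of either sign, so that no one-sided derivatives at time \<open>0\<close> arise.\<close>

definition sint :: "(real \<Rightarrow> real) \<Rightarrow> real \<Rightarrow> real" where
  "sint g a = a * integral {0..1} (\<lambda>\<theta>. g (a * \<theta>))"

text \<open>A primitive on one symmetric interval suffices, with one-sided derivatives at its ends:
  \<open>sint_deriv\<close> applies this to \<open>integral {-n..x} g\<close>, which is known to be
  a primitive only there.\<close>

lemma sint_eq_on:
  assumes "\<And>y. \<bar>y\<bar> \<le> n \<Longrightarrow> (F has_real_derivative g y) (at y within {-n..n})" "\<bar>x\<bar> \<le> n"
  shows "sint g x = F x - F 0"
proof -
  have "((\<lambda>\<theta>. x * g (x * \<theta>)) has_integral (F (x * 1) - F (x * 0))) {0..1}"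
  proof (rule fundamental_theorem_of_calculus)
    fix \<theta> :: real assume \<theta>: "\<theta> \<in> {0..1}"
    have sub: "(\<lambda>\<theta>. x * \<theta>) ` {0..1} \<subseteq> {-n..n}"
    proof
      fix y assume "y \<in> (\<lambda>\<theta>. x * \<theta>) ` {0..1}"
      then obtain s where s: "0 \<le> s" "s \<le> 1" "y = x * s" by auto
      have "\<bar>y\<bar> \<le> \<bar>x\<bar> * 1" unfolding s abs_mult using s by (intro mult_left_mono) auto
      then show "y \<in> {-n..n}" using assms(2) by auto
    qed
    then have "\<bar>x * \<theta>\<bar> \<le> n" using \<theta> by (force simp: image_subset_iff abs_le_iff)
    then have "(F has_real_derivative g (x * \<theta>)) (at (x * \<theta>) within (\<lambda>\<theta>. x * \<theta>) ` {0..1})"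
      using assms(1) sub by (blast intro: DERIV_subset)
    then have "((F \<circ> (\<lambda>\<theta>. x * \<theta>)) has_real_derivative g (x * \<theta>) * x) (at \<theta> within {0..1})"
      by (rule DERIV_image_chain) (auto intro!: derivative_eq_intros)
    then show "((\<lambda>\<theta>. F (x * \<theta>)) has_vector_derivative x * g (x * \<theta>)) (at \<theta> within {0..1})"
      by (simp add: has_real_derivative_iff_has_vector_derivative o_def mult.commute)
  qed simp
  then have "integral {0..1} (\<lambda>\<theta>. x * g (x * \<theta>)) = F (x * 1) - F (x * 0)"
    by (rule integral_unique)
  then show ?thesis by (simp add: sint_def)
qed

lemma sint_eq:
  assumes "\<And>y. (F has_real_derivative g y) (at y)"
  shows "sint g x = F x - F 0"
  by (rule sint_eq_on[of "\<bar>x\<bar>"]) (auto intro: assms has_field_derivative_at_within)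

lemma sint_deriv:
  assumes "continuous_on UNIV g"
  shows "(sint g has_real_derivative g a) (at a)"
proof -
  \<comment> \<open>The extra 1 puts \<open>a\<close> in the interior, where the derivative within
    the interval is the full derivative.\<close>
  define n where "n = \<bar>a\<bar> + 1"
  define F where "F x = integral {-n..x} g" for x
  have F: "(F has_real_derivative g y) (at y within {-n..n})" if "\<bar>y\<bar> \<le> n" for y
    unfolding F_def using that
    by (intro integral_has_real_derivative continuous_on_subset[OF assms]) auto
  have eq: "sint g y = F y - F 0" if "\<bar>y\<bar> \<le> n" for y
    by (rule sint_eq_on[of n]) (use F that in auto)
  have "((\<lambda>y. F y - F 0) has_real_derivative g a) (at a within {-n..n})"
    using F[of a] by (auto simp: n_def intro!: derivative_eq_intros)
  then have "((\<lambda>y. F y - F 0) has_real_derivative g a) (at a)"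
    by (simp add: at_within_Icc_at n_def)
  moreover have "\<forall>\<^sub>F y in nhds a. sint g y = F y - F 0"
  proof -
    have "\<forall>\<^sub>F y in nhds a. y \<in> {-n<..<n}"
      by (rule eventually_nhds_in_open) (auto simp: n_def)
    then show ?thesis by eventually_elim (use eq in auto)
  qed
  ultimately show ?thesis by (simp add: DERIV_cong_ev)
qed

lemma sint_0 [simp]: "sint g 0 = 0"
  by (simp add: sint_def)

lemma integral_eq_sint:
  assumes "continuous_on UNIV g" "a \<le> b"
  shows "integral {a..b} g = sint g b - sint g a"
proof -
  have "(g has_integral (sint g b - sint g a)) {a..b}"
    by (rule fundamental_theorem_of_calculus)
      (use assms sint_deriv in \<open>auto simp: has_real_derivative_iff_has_vector_derivative[symmetric]
        intro: has_field_derivative_at_within\<close>)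
  then show ?thesis by (rule integral_unique)
qed

lemma sint_shift:
  assumes "continuous_on UNIV g"
  shows "sint (\<lambda>s. g (s + c)) a = sint g (a + c) - sint g c"
proof -
  have "sint (\<lambda>s. g (s + c)) a = sint g (a + c) - sint g (0 + c)"
    by (rule sint_eq[where F = "\<lambda>s. sint g (s + c)"])
      (use DERIV_shift sint_deriv[OF assms] in blast)
  then show ?thesis by simp
qed

lemma sint_odd: "(\<And>x. g (-x) = - g x) \<Longrightarrow> sint g (-a) = sint g a"
  by (simp add: sint_def)

lemma sint_diff:
  assumes "continuous_on UNIV g" "continuous_on UNIV h"
  shows "sint (\<lambda>s. g s - h s) a = sint g a - sint h a"
  using sint_eq[where F = "\<lambda>s. sint g s - sint h s" and g = "\<lambda>s. g s - h s" and x = a]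
  by (auto intro!: derivative_eq_intros sint_deriv assms)

lemma sint_add:
  assumes "continuous_on UNIV g" "continuous_on UNIV h"
  shows "sint (\<lambda>s. g s + h s) a = sint g a + sint h a"
  using sint_eq[where F = "\<lambda>s. sint g s + sint h s" and g = "\<lambda>s. g s + h s" and x = a]
  by (auto intro!: derivative_eq_intros sint_deriv assms)

lemma sint_bound:
  assumes "continuous_on UNIV g" "continuous_on UNIV k" "0 \<le> a"
    and "\<And>s. \<lbrakk>0 \<le> s; s \<le> a\<rbrakk> \<Longrightarrow> \<bar>g s\<bar> \<le> k s"
  shows "\<bar>sint g a\<bar> \<le> sint k a"
proof -
  have "norm (integral {0..a} g) \<le> integral {0..a} k"
    by (rule integral_norm_bound_integral)
      (use assms in \<open>auto intro!: integrable_continuous_interval intro: continuous_on_subset\<close>)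
  then show ?thesis using assms by (simp add: integral_eq_sint)
qed

text \<open>The fixed domain \<open>{0..1}\<close> in \<open>sint\<close> turns a moving limit of
  integration into a parameter of the integrand.\<close>

lemma sint_continuous:
  assumes "cont2 g" "continuous_on UNIV (h :: 'b::topological_space \<Rightarrow> real)"
  shows "continuous_on UNIV (\<lambda>y. sint (\<lambda>s. g s y) (h y))"
proof -
  have "continuous_on (UNIV \<times> cbox 0 1) (\<lambda>(y, \<theta>::real). g (h y * \<theta>) y)"
    unfolding case_prod_beta
    by (rule cont2_comp[OF assms(1)])
      (auto intro!: continuous_intros continuous_on_compose2[OF assms(2)])
  from integral_continuous_on_param[OF this]
  show ?thesis unfolding sint_def by (auto intro!: continuous_intros assms(2))
qed

lemma sint_continuous':
  assumes "continuous_on UNIV (\<lambda>(s, y). g s y)" "continuous_on S (h :: 'b::topological_space \<Rightarrow> real)"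
     "continuous_on S (k :: 'b::topological_space \<Rightarrow> 'c::topological_space)"
  shows "continuous_on S (\<lambda>y. sint (\<lambda>s. g s (k y)) (h y))"
proof -
  have "cont2 (\<lambda>s (z::real\<times>'c). g s (snd z))"
    unfolding case_prod_beta by (intro cont2_comp[OF assms(1)] continuous_intros)
  from sint_continuous[OF this, of fst]
  have "continuous_on UNIV (\<lambda>z. sint (\<lambda>s. g s (snd z)) (fst z))"
    by (simp add: continuous_on_fst continuous_on_id)
  from continuous_on_compose2[OF this, of S "\<lambda>y. (h y, k y)"] show ?thesis
    using assms by (auto intro!: continuous_intros)
qed

lemma sint_deriv_param:
  assumes g: "cont2 g" and g': "cont2 g'"
    and d: "\<And>s y. ((g s) has_real_derivative g' s y) (at (y::real))"
  shows "((\<lambda>y. sint (\<lambda>s. g s y) a) has_real_derivative sint (\<lambda>s. g' s y) a) (at y)"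
proof -
  have "((\<lambda>y. integral (cbox 0 1) (\<lambda>\<theta>. g (a * \<theta>) y)) has_real_derivative
      integral (cbox 0 1) (\<lambda>\<theta>. g' (a * \<theta>) y)) (at y within UNIV)"
  proof (rule leibniz_rule_field_derivative)
    show "(\<lambda>\<theta>. g (a * \<theta>) x) integrable_on cbox 0 1" for x
      by (intro integrable_continuous cont2_comp[OF g] continuous_intros)
    show "continuous_on (UNIV \<times> cbox 0 1) (\<lambda>(x, t). g' (a * t) x)"
      unfolding case_prod_beta by (intro cont2_comp[OF g'] continuous_intros)
  qed (use d in auto)
  then show ?thesis unfolding sint_def by (auto intro!: derivative_eq_intros)
qed

text \<open>Leibniz' rule with a moving upper limit, as the chain rule on the diagonal of a function
  of (upper limit, parameter). Its total differentiability follows from the two partial derivatives,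
  the one in the parameter being jointly continuous.\<close>

lemma sint_deriv_diag:
  assumes g: "cont2 g" and g': "cont2 g'"
    and d: "\<And>s y. ((g s) has_real_derivative g' s y) (at (y::real))"
  shows "((\<lambda>y. sint (\<lambda>s. g s y) y) has_real_derivative g y y + sint (\<lambda>s. g' s y) y) (at y)"
proof -
  have c1: "continuous_on UNIV (\<lambda>s. g s y)" for y
    by (intro cont2_comp[OF g] continuous_intros)
  have "((\<lambda>(a, y). sint (\<lambda>s. g s y) a) has_derivative
      (\<lambda>(ta, ty). g y y * ta + blinfun_apply (blinfun_scaleR_left (sint (\<lambda>s. g' s y) y)) ty))
      (at (y, y) within UNIV \<times> UNIV)"
  proof (rule has_derivative_partialsI[where fy = "\<lambda>a z. blinfun_scaleR_left (sint (\<lambda>s. g' s z) a)"])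
    show "((\<lambda>x. sint (\<lambda>s. g s y) x) has_derivative (*) (g y y)) (at y)"
      using sint_deriv[OF c1] by (simp add: has_field_derivative_def)
    fix a z :: real
    show "((\<lambda>z. sint (\<lambda>s. g s z) a) has_derivative
        blinfun_apply (blinfun_scaleR_left (sint (\<lambda>s. g' s z) a))) (at z within UNIV)"
      by (rule has_derivative_eq_rhs[OF sint_deriv_param[OF assms, of a z, unfolded has_field_derivative_def]]) auto
  next
    have "continuous_on UNIV (\<lambda>z. sint (\<lambda>s. g' s (snd z)) (fst z))"
      by (intro sint_continuous'[OF g'] continuous_intros)
    then have "continuous_on UNIV (\<lambda>z::real\<times>real. blinfun_scaleR_left (sint (\<lambda>s. g' s (snd z)) (fst z)) :: real \<Rightarrow>\<^sub>L real)"
      by (intro bounded_linear.continuous_on[OF bounded_linear_blinfun_scaleR_left])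
    then show "continuous (at (y, y) within UNIV \<times> UNIV)
        (\<lambda>(x, y). blinfun_scaleR_left (sint (\<lambda>s. g' s y) x) :: real \<Rightarrow>\<^sub>L real)"
      unfolding case_prod_beta by (simp add: continuous_on_eq_continuous_within del: split_paired_All)
  qed auto
  note * = this[unfolded UNIV_Times_UNIV]
  have d2: "((\<lambda>y::real. (y, y)) has_derivative (\<lambda>h. (h, h))) (at y)"
    by (intro has_derivative_Pair has_derivative_ident)
  show ?thesis
    unfolding has_field_derivative_def
    by (rule has_derivative_eq_rhs[OF has_derivative_compose[OF d2 *, unfolded prod.case]])
      (auto simp: fun_eq_iff algebra_simps)
qed

section \<open>Duhamel's integral in one space dimension and its derivatives\<close>

text \<open>Half the integral of \<open>K\<close> over the backward characteristic triangle with
  apex (t, r); the inner difference is the integral over the slice from r - t + s to r + t - s. The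
  next two definitions combine the integrals over the two slanted sides.\<close>

definition duhamel :: "(real \<Rightarrow> real \<Rightarrow> real) \<Rightarrow> real \<Rightarrow> real \<Rightarrow> real" where
  "duhamel K t r = sint (\<lambda>s. sint (K s) (r + t - s) - sint (K s) (r - t + s)) t / 2"

definition duhamel_t :: "(real \<Rightarrow> real \<Rightarrow> real) \<Rightarrow> real \<Rightarrow> real \<Rightarrow> real" where
  "duhamel_t K t r = sint (\<lambda>s. K s (r + t - s) + K s (r - t + s)) t / 2"

definition duhamel_r :: "(real \<Rightarrow> real \<Rightarrow> real) \<Rightarrow> real \<Rightarrow> real \<Rightarrow> real" where
  "duhamel_r K t r = sint (\<lambda>s. K s (r + t - s) - K s (r - t + s)) t / 2"

lemma cont2_flat: "cont2 K \<Longrightarrow> continuous_on UNIV (K s)"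
  using cont2_comp[of K UNIV "\<lambda>_. s" "\<lambda>x. x"] by (simp add: continuous_on_id)

lemma cont2_sint: "cont2 K \<Longrightarrow> cont2 (\<lambda>s. sint (K s))"
  unfolding case_prod_beta
  by (rule sint_continuous'[where g = "\<lambda>x s. K s x"])
    (auto intro!: continuous_intros cont2_comp[of K] simp: case_prod_beta)

context
  fixes K :: "real \<Rightarrow> real \<Rightarrow> real"
  assumes K: "cont2 K"
begin

lemma duhamel_cont: "cont2 (duhamel K)"
  unfolding duhamel_def case_prod_beta
  by (intro continuous_intros sint_continuous'[where g = "\<lambda>s z. sint (K s) (snd z + fst z - s) - sint (K s) (snd z - fst z + s)"
     and k = "\<lambda>z. z"])
    (auto intro!: continuous_intros cont2_comp[OF cont2_sint[OF K]] simp: case_prod_beta)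

lemma duhamel_t_cont: "cont2 (duhamel_t K)"
  unfolding duhamel_t_def case_prod_beta
  by (intro continuous_intros sint_continuous'[where g = "\<lambda>s z. K s (snd z + fst z - s) + K s (snd z - fst z + s)"
     and k = "\<lambda>z. z"])
    (auto intro!: continuous_intros cont2_comp[OF K] simp: case_prod_beta)

lemma duhamel_r_cont: "cont2 (duhamel_r K)"
  unfolding duhamel_r_def case_prod_beta
  by (intro continuous_intros sint_continuous'[where g = "\<lambda>s z. K s (snd z + fst z - s) - K s (snd z - fst z + s)"
     and k = "\<lambda>z. z"])
    (auto intro!: continuous_intros cont2_comp[OF K] simp: case_prod_beta)

lemma sint_K_chain:
  "(f has_real_derivative f') (at y) \<Longrightarrow> ((\<lambda>y. sint (K s) (f y)) has_real_derivative K s (f y) * f') (at y)"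
  by (rule DERIV_chain2[OF sint_deriv[OF cont2_flat[OF K]]])

lemma duhamel_deriv_r: "(duhamel K t has_real_derivative duhamel_r K t r) (at r)"
proof -
  have "((\<lambda>r. sint (\<lambda>s. sint (K s) (r + t - s) - sint (K s) (r - t + s)) t) has_real_derivative
      sint (\<lambda>s. K s (r + t - s) - K s (r - t + s)) t) (at r)"
    by (rule sint_deriv_param)
      (auto intro!: continuous_intros cont2_comp[OF cont2_sint[OF K]] cont2_comp[OF K]
        derivative_eq_intros sint_K_chain simp: case_prod_beta)
  then show ?thesis
    unfolding duhamel_def[abs_def] duhamel_r_def by (auto intro!: derivative_eq_intros)
qed

text \<open>The boundary term vanishes, since at s = t the slice shrinks to a point.\<close>

lemma duhamel_deriv_t: "((\<lambda>t. duhamel K t r) has_real_derivative duhamel_t K t r) (at t)"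
proof -
  have "((\<lambda>t. sint (\<lambda>s. sint (K s) (r + t - s) - sint (K s) (r - t + s)) t) has_real_derivative
      (sint (K t) (r + t - t) - sint (K t) (r - t + t)) + sint (\<lambda>s. K s (r + t - s) + K s (r - t + s)) t) (at t)"
    by (rule sint_deriv_diag)
      (auto intro!: continuous_intros cont2_comp[OF cont2_sint[OF K]] cont2_comp[OF K]
        derivative_eq_intros sint_K_chain simp: case_prod_beta)
  then show ?thesis
    unfolding duhamel_def[abs_def] duhamel_t_def by (auto intro!: derivative_eq_intros)
qed

text \<open>The derivative along the outgoing characteristic sees only the incoming ray.\<close>

lemma duhamel_deriv_char:
  "((\<lambda>s. duhamel K s (c + s)) has_real_derivative sint (\<lambda>s'. K s' (c + 2 * s - s')) s) (at s)"
proof -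
  have "((\<lambda>s. sint (\<lambda>s'. sint (K s') (c + s + s - s') - sint (K s') (c + s - s + s')) s) has_real_derivative
      (sint (K s) (c + s + s - s) - sint (K s) (c + s - s + s)) + sint (\<lambda>s'. 2 * K s' (c + s + s - s')) s) (at s)"
    by (rule sint_deriv_diag)
      (auto intro!: continuous_intros cont2_comp[OF cont2_sint[OF K]] cont2_comp[OF K]
        derivative_eq_intros sint_K_chain simp: case_prod_beta)
  then have "((\<lambda>s. duhamel K s (c + s)) has_real_derivative
      ((sint (K s) (c + s + s - s) - sint (K s) (c + s - s + s)) + sint (\<lambda>s'. 2 * K s' (c + s + s - s')) s) / 2) (at s)"
    unfolding duhamel_def[abs_def] by (rule DERIV_cdivide)
  moreover have "((sint (K s) (c + s + s - s) - sint (K s) (c + s - s + s)) + sint (\<lambda>s'. 2 * K s' (c + s + s - s')) s) / 2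
     = sint (\<lambda>s'. K s' (c + 2 * s - s')) s"
  proof -
    have e: "c + s + s - s' = c + 2 * s - s'" for s' by simp
    have x: "c + s + s - s = c + s" "c + s - s + s = c + s" by auto
    have "sint (\<lambda>s'. 2 * K s' (c + 2 * s - s')) s = 2 * sint (\<lambda>s'. K s' (c + 2 * s - s')) s"
      by (simp add: sint_def)
    then show ?thesis unfolding x e by (simp add: add.commute)
  qed
  ultimately show ?thesis by (simp only:)
qed

lemma duhamel_0 [simp]: "duhamel K 0 r = 0" "duhamel_t K 0 r = 0"
  by (simp_all add: duhamel_def duhamel_t_def)

context
  fixes K' :: "real \<Rightarrow> real \<Rightarrow> real"
  assumes K': "cont2 K'" and d: "\<And>s x. (K s has_real_derivative K' s x) (at x)"
begin

lemma K_chain: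
  "(f has_real_derivative f') (at y) \<Longrightarrow> ((\<lambda>y. K s (f y)) has_real_derivative K' s (f y) * f') (at y)"
  by (rule DERIV_chain2[OF d])

lemma duhamel_r_deriv_r: "(duhamel_r K t has_real_derivative duhamel_r K' t r) (at r)"
proof -
  have "((\<lambda>r. sint (\<lambda>s. K s (r + t - s) - K s (r - t + s)) t) has_real_derivative
      sint (\<lambda>s. K' s (r + t - s) - K' s (r - t + s)) t) (at r)"
    by (rule sint_deriv_param)
      (auto intro!: continuous_intros cont2_comp[OF K'] cont2_comp[OF K]
        derivative_eq_intros K_chain simp: case_prod_beta)
  then show ?thesis
    unfolding duhamel_r_def[abs_def] by (auto intro!: derivative_eq_intros)
qed

lemma duhamel_t_deriv_r: "(duhamel_t K t has_real_derivative duhamel_t K' t r) (at r)"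
proof -
  have "((\<lambda>r. sint (\<lambda>s. K s (r + t - s) + K s (r - t + s)) t) has_real_derivative
      sint (\<lambda>s. K' s (r + t - s) + K' s (r - t + s)) t) (at r)"
    by (rule sint_deriv_param)
      (auto intro!: continuous_intros cont2_comp[OF K'] cont2_comp[OF K]
        derivative_eq_intros K_chain simp: case_prod_beta)
  then show ?thesis
    unfolding duhamel_t_def[abs_def] by (auto intro!: derivative_eq_intros)
qed

text \<open>The inhomogeneous wave equation: by \<open>duhamel_r_deriv_r\<close> the second summand
  is the second derivative in \<open>r\<close>. Only a space derivative of \<open>K\<close> enters,
  so mollifying in space is enough later.\<close>

lemma duhamel_t_deriv_t: "((\<lambda>t. duhamel_t K t r) has_real_derivative K t r + duhamel_r K' t r) (at t)"
proof -
  have "((\<lambda>t. sint (\<lambda>s. K s (r + t - s) + K s (r - t + s)) t) has_real_derivative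
      (K t (r + t - t) + K t (r - t + t)) + sint (\<lambda>s. K' s (r + t - s) - K' s (r - t + s)) t) (at t)"
    by (rule sint_deriv_diag)
      (auto intro!: continuous_intros cont2_comp[OF K'] cont2_comp[OF K]
        derivative_eq_intros K_chain simp: case_prod_beta)
  then show ?thesis
    unfolding duhamel_t_def[abs_def] duhamel_r_def by (auto intro!: derivative_eq_intros)
qed

lemma duhamel_r_deriv_t: "((\<lambda>t. duhamel_r K t r) has_real_derivative duhamel_t K' t r) (at t)"
proof -
  have "((\<lambda>t. sint (\<lambda>s. K s (r + t - s) - K s (r - t + s)) t) has_real_derivative
      (K t (r + t - t) - K t (r - t + t)) + sint (\<lambda>s. K' s (r + t - s) + K' s (r - t + s)) t) (at t)"
    by (rule sint_deriv_diag)
      (auto intro!: continuous_intros cont2_comp[OF K'] cont2_comp[OF K]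
        derivative_eq_intros K_chain simp: case_prod_beta)
  then show ?thesis
    unfolding duhamel_r_def[abs_def] duhamel_t_def by (auto intro!: derivative_eq_intros)
qed

end

end

lemma sint_neg: "sint (\<lambda>s. - g s) a = - sint g a"
  by (simp add: sint_def)

lemma duhamel_odd:
  assumes "\<And>s x. K s (-x) = - K s x"
  shows "duhamel K t (-r) = - duhamel K t r" "duhamel_t K t (-r) = - duhamel_t K t r" "duhamel_r K t (-r) = duhamel_r K t r"
proof -
  have e: "sint (K s) (-x) = sint (K s) x" for s x by (rule sint_odd) (rule assms)
  have 1: "-r + t - s = -(r - t + s)" "-r - t + s = - (r + t - s)" for s by auto
  have 2: "x - y = - (y - x)" "- x + - y = - (y + x)" "- x - - y = y - x" for x y :: real by auto
  show "duhamel K t (-r) = - duhamel K t r"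
    using sint_neg[of "\<lambda>s. sint (K s) (r + t - s) - sint (K s) (r - t + s)" t]
    unfolding duhamel_def 1 e by simp
  show "duhamel_t K t (-r) = - duhamel_t K t r" 
    unfolding duhamel_t_def 1 assms 2(2) sint_neg by simp
  show "duhamel_r K t (-r) = duhamel_r K t r"
    unfolding duhamel_r_def 1 assms 2(3) by simp
qed

section \<open>Weighted estimates along characteristics\<close>

lemma sint_mono_diff:
  assumes "continuous_on UNIV g" "continuous_on UNIV k" "a \<le> b"
    and "\<And>s. \<lbrakk>a \<le> s; s \<le> b\<rbrakk> \<Longrightarrow> \<bar>g s\<bar> \<le> k s"
  shows "\<bar>sint g b - sint g a\<bar> \<le> sint k b - sint k a"
proof -
  have "norm (integral {a..b} g) \<le> integral {a..b} k"
    by (rule integral_norm_bound_integral)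
      (use assms in \<open>auto intro!: integrable_continuous_interval intro: continuous_on_subset\<close>)
  then show ?thesis using assms by (simp add: integral_eq_sint)
qed

lemma sint_const: "sint (\<lambda>s. c) a = c * a"
  by (simp add: sint_def)

lemma sint_cmult: "sint (\<lambda>s. c * g s) a = c * sint g a"
  by (simp add: sint_def)

lemma sint_nonneg: "continuous_on UNIV g \<Longrightarrow> (\<And>s. 0 \<le> g s) \<Longrightarrow> 0 \<le> a \<Longrightarrow> 0 \<le> sint g a"
  by (rule order.trans[OF abs_ge_zero sint_bound]) auto

section \<open>Powers of 2 + |x| and their integrals along rays\<close>

text \<open>For t, r >= 0, \<open>wt e (t + r)\<close> is A^e and \<open>wt e (t - r)\<close> is
  B^e. The shift by 2 keeps the base above 1, so that the weight is also monotone in the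
  exponent.\<close>

definition wt :: "real \<Rightarrow> real \<Rightarrow> real" where "wt e x = (2 + \<bar>x\<bar>) powr e"

lemma wt_pos [simp]: "0 < wt e x" "0 \<le> wt e x" "wt e x \<noteq> 0"
  unfolding wt_def by (auto simp: add_nonneg_eq_0_iff)

lemma wt_cont: "continuous_on S f \<Longrightarrow> continuous_on S (\<lambda>x. wt e (f x))"
  unfolding wt_def by (auto intro!: continuous_intros simp: add_nonneg_eq_0_iff)

lemma wt_add: "wt (e + f) x = wt e x * wt f x"
  by (simp add: wt_def powr_add)

lemma wt_minus [simp]: "wt e (-x) = wt e x" "wt e (x - y) = wt e (y - x)"
  by (simp_all add: wt_def abs_minus_commute)

lemma wt_anti: "e \<le> 0 \<Longrightarrow> \<bar>x\<bar> \<le> \<bar>y\<bar> \<Longrightarrow> wt e y \<le> wt e x"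
  unfolding wt_def by (rule powr_mono2') auto

lemma wt_mono: "0 \<le> e \<Longrightarrow> \<bar>x\<bar> \<le> \<bar>y\<bar> \<Longrightarrow> wt e x \<le> wt e y"
  unfolding wt_def by (rule powr_mono2) auto

lemma powr_affine_deriv:
  assumes "0 < c + k * y"
  shows "((\<lambda>x. (c + k * x) powr e) has_real_derivative e * (c + k * y) powr (e - 1) * k) (at (y::real))"
  by (rule DERIV_chain2[where f = "\<lambda>z. z powr e" and g = "\<lambda>x. c + k * x", OF has_real_derivative_powr[OF assms]]) (auto intro!: derivative_eq_intros)

lemma sint_wt:
  assumes "e \<noteq> 0" "0 \<le> x"
  shows "sint (wt (e - 1)) x = (wt e x - 2 powr e) / e"
proof -
  have "(wt (e - 1) has_integral ((2 + x) powr e / e - (2 + 0) powr e / e)) {0..x}"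
  proof (rule fundamental_theorem_of_calculus)
    fix y assume y: "y \<in> {0..x}"
    have "((\<lambda>x. (2 + x) powr e / e) has_real_derivative wt (e - 1) y) (at y)"
      using DERIV_cdivide[OF powr_affine_deriv[of 2 1 y e], of e] y assms by (simp add: wt_def)
    then show "((\<lambda>x. (2 + x) powr e / e) has_vector_derivative wt (e - 1) y) (at y within {0..x})"
      by (simp add: has_real_derivative_iff_has_vector_derivative[symmetric] has_field_derivative_at_within)
  qed (use assms in auto)
  then have "integral {0..x} (wt (e - 1)) = ((2 + x) powr e / e - (2 + 0) powr e / e)"
    by (rule integral_unique)
  moreover have "continuous_on UNIV (wt (e - 1))" using wt_cont[OF continuous_on_id] by simp
  ultimately show ?thesis using assms by (simp add: integral_eq_sint wt_def diff_divide_distrib)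
qed

lemma sint_wt_odd: "sint (wt e) (-x) = - sint (wt e) x"
  by (simp add: sint_def)

text \<open>On a ray one of t + r and t - r is constant and the other moves at speed 2, hence the
  argument 2s - x. Oddness of the primitive turns the lower limit -x into the plus sign.\<close>

lemma sint_wt_ray:
  "sint (\<lambda>s. wt e (2 * s - x)) t = (sint (wt e) (2 * t - x) + sint (wt e) x) / 2"
proof -
  have c: "continuous_on UNIV (wt e)" using wt_cont[OF continuous_on_id] by simp
  have "sint (\<lambda>s. wt e (2 * s - x)) t = sint (wt e) (2 * t - x) / 2 - sint (wt e) (2 * 0 - x) / 2"
    by (rule sint_eq[where F = "\<lambda>t. sint (wt e) (2 * t - x) / 2"])
      (auto intro!: derivative_eq_intros DERIV_chain2[OF sint_deriv[OF c]])
  then show ?thesis using sint_wt_odd[of e x] by (simp add: add_divide_distrib)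
qed

text \<open>The integrable regime, exponent below -1: a bound uniform in \<open>x\<close>. In
  \<open>sint_wt_pos\<close> the exponent is above -1 and the integral grows like its
  primitive.\<close>

lemma sint_wt_neg:
  assumes "e < 0"
  shows "\<bar>sint (wt (e - 1)) x\<bar> \<le> 1 / (-e)"
proof -
  have *: "\<bar>sint (wt (e - 1)) x\<bar> \<le> 1 / (-e)" if "0 \<le> x" for x
  proof -
    have "wt e x \<le> 2 powr e" using wt_anti[of e 0 x] assms that by (simp add: wt_def)
    moreover have "2 powr e \<le> (1::real)" using assms powr_mono[of e 0 "2::real"] by simp
    moreover have "0 < wt e x" by simp
    ultimately have "\<bar>wt e x - 2 powr e\<bar> \<le> 1" by linarith
    then have "\<bar>wt e x - 2 powr e\<bar> / \<bar>e\<bar> \<le> 1 / \<bar>e\<bar>" by (rule divide_right_mono) simp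
    then show ?thesis using assms that by (simp add: sint_wt abs_divide)
  qed
  show ?thesis
  proof (cases "0 \<le> x")
    case False
    then show ?thesis using *[of "-x"] by (simp add: sint_wt_odd)
  qed (rule *)
qed

lemma sint_wt_pos:
  assumes "0 < e"
  shows "\<bar>sint (wt (e - 1)) x\<bar> \<le> wt e x / e"
proof -
  have *: "\<bar>sint (wt (e - 1)) x\<bar> \<le> wt e x / e" if "0 \<le> x" for x
  proof -
    have "2 powr e \<le> wt e x" using wt_mono[of e 0 x] assms that by (simp add: wt_def)
    moreover have "0 \<le> (2::real) powr e" by simp
    ultimately have "\<bar>wt e x - 2 powr e\<bar> \<le> wt e x" by linarith
    then have "\<bar>wt e x - 2 powr e\<bar> / e \<le> wt e x / e" using assms by (intro divide_right_mono) auto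
    then show ?thesis using assms that by (simp add: sint_wt abs_divide)
  qed
  show ?thesis
  proof (cases "0 \<le> x")
    case False
    then show ?thesis using *[of "-x"] by (simp add: sint_wt_odd)
  qed (rule *)
qed

lemma half_sum_le: "\<bar>a\<bar> \<le> u \<Longrightarrow> \<bar>b\<bar> \<le> u \<Longrightarrow> (a + b) / 2 \<le> u" for a b u :: real
  unfolding abs_le_iff by auto

lemma ray_wt_neg: "e < 0 \<Longrightarrow> sint (\<lambda>s. wt (e - 1) (2 * s - x)) t \<le> 1 / (-e)"
  unfolding sint_wt_ray by (intro half_sum_le sint_wt_neg)

lemma ray_wt_pos:
  assumes "0 < e" "\<bar>2 * t - x\<bar> \<le> \<bar>X\<bar>" "\<bar>x\<bar> \<le> \<bar>X\<bar>"
  shows "sint (\<lambda>s. wt (e - 1) (2 * s - x)) t \<le> wt e X / e"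
proof -
  have "wt e (2 * t - x) / e \<le> wt e X / e" "wt e x / e \<le> wt e X / e"
    using assms by (auto intro!: divide_right_mono wt_mono)
  then show ?thesis
    unfolding sint_wt_ray
    using sint_wt_pos[OF assms(1), of "2 * t - x"] sint_wt_pos[OF assms(1), of x]
    by (intro half_sum_le) auto
qed

text \<open>On an incoming ray t + r is constant, so its weight comes out of the integral, and m > 1
  makes the weight in s - x integrable uniformly. In the application m is \<kappa>pq.\<close>

lemma incoming_ray_bound:
  assumes K: "cont2 K" and m: "1 < m" and t: "0 \<le> t" "0 \<le> r"
    and b: "\<And>s x. \<lbrakk>0 \<le> s; 0 \<le> x\<rbrakk> \<Longrightarrow> \<bar>K s x\<bar> \<le> c * wt (- 1 - \<kappa>) (s + x) * wt (- m) (s - x)"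
    and c: "0 \<le> c"
  shows "\<bar>sint (\<lambda>s. K s (r + t - s)) t\<bar> \<le> c / (m - 1) * wt (- 1 - \<kappa>) (t + r)"
proof -
  define k where "k = c * wt (- 1 - \<kappa>) (t + r)"
  have "\<bar>sint (\<lambda>s. K s (r + t - s)) t\<bar> \<le> sint (\<lambda>s. k * wt ((1 - m) - 1) (2 * s - (t + r))) t"
  proof (rule sint_bound)
    show "continuous_on UNIV (\<lambda>s. K s (r + t - s))"
      by (intro cont2_comp[OF K] continuous_intros)
    show "continuous_on UNIV (\<lambda>s. k * wt ((1 - m) - 1) (2 * s - (t + r)))"
      by (intro continuous_intros wt_cont)
    fix s assume s: "0 \<le> s" "s \<le> t"
    have e: "s + (r + t - s) = t + r" "s - (r + t - s) = 2 * s - (t + r)" by auto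
    show "\<bar>K s (r + t - s)\<bar> \<le> k * wt ((1 - m) - 1) (2 * s - (t + r))"
      using b[of s "r + t - s"] s t unfolding e k_def by simp
  qed fact
  also have "\<dots> = k * sint (\<lambda>s. wt ((1 - m) - 1) (2 * s - (t + r))) t" by (rule sint_cmult)
  also have "\<dots> \<le> k * (1 / (- (1 - m)))"
    by (intro mult_left_mono ray_wt_neg) (use m c in \<open>auto simp: k_def\<close>)
  finally show ?thesis by (simp add: k_def)
qed

text \<open>From B/A <= (B/A)^\<kappa> for 0 < B <= A and \<kappa> <= 1. The gain is the factor |x|
  - |y|, at most 2r in the application, which makes V vanish linearly on the axis.\<close>

lemma wt_diff_le:
  assumes "0 < \<kappa>" "\<kappa> \<le> 1" "\<bar>y\<bar> \<le> \<bar>x\<bar>"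
  shows "wt (- \<kappa>) y - wt (- \<kappa>) x \<le> wt (- \<kappa>) y * (\<bar>x\<bar> - \<bar>y\<bar>) * wt (-1) x"
proof -
  define A B where "A = 2 + \<bar>x\<bar>" and "B = 2 + \<bar>y\<bar>"
  have AB: "0 < B" "B \<le> A" using assms by (auto simp: A_def B_def)
  have "B / A \<le> (B / A) powr \<kappa>"
    using powr_mono'[of \<kappa> 1 "B / A"] AB assms by simp
  also have "\<dots> = A powr - \<kappa> / B powr - \<kappa>"
    using AB by (simp add: powr_divide powr_minus field_simps)
  finally have 1: "B / A * B powr - \<kappa> \<le> A powr - \<kappa>" using AB by (simp add: field_simps)
  have 2: "B powr - \<kappa> * (A - B) * (1 / A) = B powr - \<kappa> - B / A * B powr - \<kappa>"
    using AB by (simp add: field_simps)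
  have 3: "wt (-1) x = 1 / A" using AB by (simp add: wt_def A_def powr_minus_divide)
  have 4: "\<bar>x\<bar> - \<bar>y\<bar> = A - B" by (simp add: A_def B_def)
  have 5: "wt (- \<kappa>) y = B powr - \<kappa>" "wt (- \<kappa>) x = A powr - \<kappa>" by (simp_all add: wt_def A_def B_def)
  show ?thesis unfolding 3 4 5 2 using 1 by simp
qed

lemma characteristic_bound:
  fixes V P :: "real \<Rightarrow> real \<Rightarrow> real"
  assumes d: "\<And>c s. ((\<lambda>s. V s (c + s)) has_real_derivative P s (c + s)) (at s)"
    and P: "\<And>t r. \<lbrakk>0 \<le> t; 0 \<le> r\<rbrakk> \<Longrightarrow> \<bar>P t r\<bar> \<le> c * wt (- 1 - \<kappa>) (t + r)"
    and V0: "\<And>t. V t 0 = 0" "\<And>r. 0 \<le> r \<Longrightarrow> \<bar>V 0 r\<bar> \<le> c * r * wt (- 1 - \<kappa>) r"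
    and \<kappa>: "0 < \<kappa>" "\<kappa> \<le> 1" and c: "0 \<le> c" and t: "0 \<le> t" "0 \<le> r"
  shows "\<bar>V t r\<bar> \<le> c * (1 / \<kappa> + 2) * (r * wt (- 1) (t + r) * wt (- \<kappa>) (t - r))"
proof -
  \<comment> \<open>The time at which the outgoing ray through (t, r) starts, on the axis if r <= t
    and on the initial line otherwise.\<close>
  define s0 where "s0 = max 0 (t - r)"
  have s0: "0 \<le> s0" "s0 \<le> t" "0 \<le> r - t + s0" "r - t + 2 * s0 = \<bar>t - r\<bar>" using t by (auto simp: s0_def max_def abs_if)
  \<comment> \<open>A primitive of the bound on \<open>P\<close> along the ray. Monotonicity of Z +
    V and Z - V replaces the integration of \<open>P\<close>, of which nothing is assumed but that
    it is a derivative and bounded.\<close>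
  define Z where "Z s = c * ((2 + (r - t) + 2 * s) powr (- \<kappa>) / (- 2 * \<kappa>))" for s
  define Q where "Q = r * wt (- 1) (t + r) * wt (- \<kappa>) (t - r)"
  have Q: "0 \<le> Q" using t by (simp add: Q_def)
  have dZ: "(Z has_real_derivative c * wt (-1 - \<kappa>) (s + (r - t + s))) (at s)" if "s0 \<le> s" for s
  proof -
    have *: "\<bar>s + (r - t + s)\<bar> = r - t + 2 * s" "0 < 2 + (r - t) + 2 * s" using that s0 by auto
    show ?thesis unfolding Z_def wt_def *(1) 
      using DERIV_cmult[OF DERIV_cdivide[OF powr_affine_deriv[OF *(2), of "- \<kappa>"], of "- 2 * \<kappa>"], of c] \<kappa>
      by (simp add: add.assoc[symmetric] minus_diff_commute)
  qed
  have mono: "Z s0 + \<sigma> * V s0 (r - t + s0) \<le> Z t + \<sigma> * V t (r - t + t)" if "\<sigma> = 1 \<or> \<sigma> = -1" for \<sigma>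
  proof (rule DERIV_nonneg_imp_nondecreasing[OF s0(2)])
    fix s assume s: "s0 \<le> s" "s \<le> t"
    have "((\<lambda>s. Z s + \<sigma> * V s (r - t + s)) has_real_derivative
       c * wt (-1 - \<kappa>) (s + (r - t + s)) + \<sigma> * P s (r - t + s)) (at s)"
      by (intro DERIV_add dZ s DERIV_cmult d)
    moreover have "\<bar>P s (r - t + s)\<bar> \<le> c * wt (-1 - \<kappa>) (s + (r - t + s))"
      using P[of s "r - t + s"] s s0 by simp
    ultimately show "\<exists>y. ((\<lambda>s. Z s + \<sigma> * V s (r - t + s)) has_real_derivative y) (at s) \<and> 0 \<le> y"
      using that by (intro exI conjI) auto
  qed
  have "\<bar>V t r - V s0 (r - t + s0)\<bar> \<le> Z t - Z s0"
    using mono[of 1] mono[of "-1"] by (auto simp: abs_le_iff)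
  also have "\<dots> = c / (2 * \<kappa>) * (wt (- \<kappa>) (t - r) - wt (- \<kappa>) (t + r))"
  proof -
    have "2 + (r - t) + 2 * s0 = 2 + \<bar>t - r\<bar>" "2 + (r - t) + 2 * t = 2 + \<bar>t + r\<bar>" using s0 t by auto
    then show ?thesis unfolding Z_def wt_def by (simp only:) (use \<kappa> in \<open>simp add: field_simps\<close>)
  qed
  also have "\<dots> \<le> c / (2 * \<kappa>) * (wt (- \<kappa>) (t - r) * (\<bar>t + r\<bar> - \<bar>t - r\<bar>) * wt (-1) (t + r))"
    using \<kappa> c t by (intro mult_left_mono wt_diff_le) auto
  also have "\<dots> \<le> c / (2 * \<kappa>) * (wt (- \<kappa>) (t - r) * (2 * r) * wt (-1) (t + r))"
    using \<kappa> c t by (intro mult_left_mono mult_right_mono) auto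
  also have "\<dots> = c * (1 / \<kappa>) * Q" using \<kappa> by (simp add: Q_def)
  finally have 1: "\<bar>V t r - V s0 (r - t + s0)\<bar> \<le> c * (1 / \<kappa>) * Q" .
  have 2: "\<bar>V s0 (r - t + s0)\<bar> \<le> c * 2 * Q"
  proof (cases "r \<le> t")
    case True
    then have "r - t + s0 = 0" by (simp add: s0_def)
    then show ?thesis using V0(1) c Q by simp
  next
    case False
    then have s00: "s0 = 0" by (simp add: s0_def)
    have rt: "0 < r - t" using False by simp
    have "\<bar>V 0 (r - t)\<bar> \<le> c * ((r - t) * wt (- 1 - \<kappa>) (r - t))" using V0(2)[of "r - t"] rt by simp
    also have "\<dots> \<le> c * (2 * Q)"
    proof (rule mult_left_mono[OF _ c])
      \<comment> \<open>The weight at the foot of the ray is traded for the weight at (t, r). The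
        initial values thus contribute the summand 2 of the constant, the integral having
        contributed 1/\<kappa>.\<close>
      have "(r - t) * wt (-1) (r - t) \<le> 2 * r * wt (-1) (t + r)"
      proof -
        have "(r - t) * (2 + (t + r)) \<le> 2 * r * (2 + (r - t))"
        proof -
          have "2 * r * (2 + (r - t)) - (r - t) * (2 + (t + r)) = 2 * r + 2 * t + (r - t)\<^sup>2"
            by (simp add: power2_eq_square algebra_simps)
          moreover have "0 \<le> \<dots>" using t by auto
          ultimately show ?thesis by linarith
        qed
        then show ?thesis using t rt by (simp add: wt_def powr_minus_divide field_simps)
      qed
      then have "(r - t) * wt (-1) (r - t) * wt (- \<kappa>) (r - t) \<le> 2 * r * wt (-1) (t + r) * wt (- \<kappa>) (r - t)"
        by (rule mult_right_mono) simp
      then show "(r - t) * wt (- 1 - \<kappa>) (r - t) \<le> 2 * Q"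
        using wt_add[of "-1" "-\<kappa>" "r - t"] wt_minus(2)[of "-\<kappa>" r t] by (simp add: Q_def del: wt_minus)
    qed
    finally show ?thesis using s00 by simp
  qed
  have "\<bar>V t r\<bar> \<le> c * (1 / \<kappa>) * Q + c * 2 * Q" using 1 2 by linarith
  then show ?thesis by (simp add: Q_def algebra_simps)
qed


section \<open>The time derivative of the Duhamel integral for an odd source\<close>

context
  fixes H :: "real \<Rightarrow> real \<Rightarrow> real" and a q c :: real
  assumes H: "cont2 H" and q: "1 < q" "q < 2" and a: "0 < a" "a < 1" and c: "0 \<le> c"
    and H_odd: "\<And>s x. H s (- x) = - H s x"
    and H_le: "\<And>s x. \<lbrakk>0 \<le> s; 0 \<le> x\<rbrakk> \<Longrightarrow> \<bar>H s x\<bar> \<le> c * (x * wt (- q) (s + x) * wt (- a) (s - x))"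
begin

text \<open>The factor \<open>x\<close> is absorbed by A, which raises the exponent -q to 1 - q and
  gives up the smallness on the axis.\<close>

lemma H_le': "\<lbrakk>0 \<le> s; 0 \<le> x\<rbrakk> \<Longrightarrow> \<bar>H s x\<bar> \<le> c * (wt (1 - q) (s + x) * wt (- a) (s - x))"
proof -
  assume s: "0 \<le> s" "0 \<le> x"
  have "x * wt (- q) (s + x) \<le> (2 + \<bar>s + x\<bar>) * wt (- q) (s + x)"
    using s by (intro mult_right_mono) auto
  also have "\<dots> = wt (1 - q) (s + x)"
    using s wt_add[of 1 "- q" "s + x"] by (simp add: wt_def)
  finally have "c * (x * wt (- q) (s + x) * wt (- a) (s - x)) \<le> c * (wt (1 - q) (s + x) * wt (- a) (s - x))"
    by (intro mult_left_mono mult_right_mono) (use c in auto)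
  with H_le[OF s] show ?thesis by linarith
qed

lemma flat_ray_cont: "continuous_on UNIV (\<lambda>s. H s (x - s))" "continuous_on UNIV (\<lambda>s. H s (s - x))"
  by (intro cont2_comp[OF H] continuous_intros)+

text \<open>Here A is constant and B varies; as a < 1, the integral of B^(-a) is in the growing
  regime and yields A^(1-a).\<close>

lemma incoming_le:
  assumes "0 \<le> T" "T \<le> x"
  shows "\<bar>sint (\<lambda>s. H s (x - s)) T\<bar> \<le> c / (1 - a) * (wt (1 - q) x * wt (1 - a) x)"
proof -
  have "\<bar>sint (\<lambda>s. H s (x - s)) T\<bar> \<le> sint (\<lambda>s. c * wt (1 - q) x * wt ((1 - a) - 1) (2 * s - x)) T"
  proof (rule sint_bound)
    show "continuous_on UNIV (\<lambda>s. c * wt (1 - q) x * wt ((1 - a) - 1) (2 * s - x))"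
      by (intro continuous_intros wt_cont)
    fix s assume s: "0 \<le> s" "s \<le> T"
    have e: "s + (x - s) = x" "s - (x - s) = 2 * s - x" by auto
    show "\<bar>H s (x - s)\<bar> \<le> c * wt (1 - q) x * wt ((1 - a) - 1) (2 * s - x)"
      using H_le'[of s "x - s"] s assms unfolding e by (simp add: mult.assoc)
  qed (use assms flat_ray_cont in auto)
  also have "\<dots> = c * wt (1 - q) x * sint (\<lambda>s. wt ((1 - a) - 1) (2 * s - x)) T" by (rule sint_cmult)
  also have "\<dots> \<le> c * wt (1 - q) x * (wt (1 - a) x / (1 - a))"
    by (intro mult_left_mono ray_wt_pos) (use a c assms in auto)
  finally show ?thesis by simp
qed

text \<open>Here B is constant and A varies; as q < 2, the integral of A^(1-q) grows like A^(2-q).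
  The ray is counted from \<open>max 0 x\<close>, since before time \<open>x\<close> it runs at
  negative radius.\<close>

lemma outgoing_le:
  assumes "0 \<le> t" "x \<le> t"
  shows "\<bar>sint (\<lambda>s. H s (s - x)) t - sint (\<lambda>s. H s (s - x)) (max 0 x)\<bar>
    \<le> c / (2 - q) * (wt (2 - q) (2 * t - x) * wt (- a) x)"
proof -
  define k where "k = c * wt (- a) x"
  have k: "0 \<le> k" using c by (simp add: k_def)
  have cont: "continuous_on UNIV (\<lambda>s. k * wt ((2 - q) - 1) (2 * s - x))"
    by (intro continuous_intros wt_cont)
  have "\<bar>sint (\<lambda>s. H s (s - x)) t - sint (\<lambda>s. H s (s - x)) (max 0 x)\<bar>
     \<le> sint (\<lambda>s. k * wt ((2 - q) - 1) (2 * s - x)) t - sint (\<lambda>s. k * wt ((2 - q) - 1) (2 * s - x)) (max 0 x)"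
  proof (rule sint_mono_diff)
    fix s assume s: "max 0 x \<le> s" "s \<le> t"
    have e: "s + (s - x) = 2 * s - x" "s - (s - x) = x" by auto
    show "\<bar>H s (s - x)\<bar> \<le> k * wt ((2 - q) - 1) (2 * s - x)"
      using H_le'[of s "s - x"] s assms unfolding e k_def by (simp add: mult_ac)
  qed (use assms flat_ray_cont cont in auto)
  also have "\<dots> \<le> sint (\<lambda>s. k * wt ((2 - q) - 1) (2 * s - x)) t"
    using sint_nonneg[OF cont, of "max 0 x"] k by simp
  also have "\<dots> = k * sint (\<lambda>s. wt ((2 - q) - 1) (2 * s - x)) t" by (rule sint_cmult)
  also have "\<dots> \<le> k * (wt (2 - q) (2 * t - x) / (2 - q))"
    by (intro mult_left_mono ray_wt_pos) (use q k assms in auto)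
  finally show ?thesis by (simp add: k_def mult_ac)
qed

lemma duhamel_t_split:
  "2 * duhamel_t H t r = (sint (\<lambda>s. H s ((t + r) - s)) t + sint (\<lambda>s. H s (s - (t - r))) t)"
proof -
  have e: "r + t - s = (t + r) - s" "r - t + s = s - (t - r)" for s by auto
  show ?thesis unfolding duhamel_t_def e by (simp add: sint_add flat_ray_cont)
qed

text \<open>Oddness folds the part of a ray at negative radius onto the incoming ray that reaches
  the axis at the same time, with the opposite sign.\<close>

lemma reflected_ray: "sint (\<lambda>s. H s (s - x)) y = - sint (\<lambda>s. H s (x - s)) y"
proof -
  have "H s (s - x) = - H s (x - s)" for s using H_odd[of s "x - s"] by simp
  then show ?thesis by (simp add: sint_neg)
qed

lemma wt_pair_le:
  assumes "0 \<le> t" "0 \<le> r"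
  shows "wt (1 - q) (t + r) * wt (1 - a) (t + r) \<le> wt (2 - q) (t + r) * wt (- a) (t - r)"
    "wt (1 - q) (t - r) * wt (1 - a) (t - r) \<le> wt (2 - q) (t + r) * wt (- a) (t - r)"
proof -
  have e: "wt (1 - q) x * wt (1 - a) x = wt (2 - q) x * wt (- a) x" for x
    using wt_add[of "1 - q" "1 - a" x] wt_add[of "2 - q" "- a" x] by (simp add: algebra_simps)
  show "wt (1 - q) (t + r) * wt (1 - a) (t + r) \<le> wt (2 - q) (t + r) * wt (- a) (t - r)"
    "wt (1 - q) (t - r) * wt (1 - a) (t - r) \<le> wt (2 - q) (t + r) * wt (- a) (t - r)"
    unfolding e
    by (intro mult_mono wt_anti wt_mono order_refl wt_pos; use assms a q in force)+
qed

text \<open>Three pieces are bounded separately: the incoming ray through (t, r), the outgoing ray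
  after it left the axis, and its folded beginning. Only the size of \<open>H\<close> enters and no
  cancellation, so the bound does not vanish on the axis, but it applies to differences of
  sources.\<close>

lemma duhamel_t_weak_bound:
  assumes t: "0 \<le> t" "0 \<le> r"
  shows "\<bar>duhamel_t H t r\<bar> \<le> c * (1 / (1 - a) + 1 / (2 - q)) * (wt (2 - q) (t + r) * wt (- a) (t - r))"
proof -
  define Q where "Q = wt (2 - q) (t + r) * wt (- a) (t - r)"
  have Q: "0 \<le> Q" by (simp add: Q_def)
  have le: "c / (1 - a) * X \<le> c / (1 - a) * Q" if "X \<le> Q" for X
    using that a c by (intro mult_left_mono) auto
  have 1: "\<bar>sint (\<lambda>s. H s ((t + r) - s)) t\<bar> \<le> c / (1 - a) * Q"
    by (rule order.trans[OF incoming_le le]) (use wt_pair_le[OF t] t in \<open>auto simp: Q_def\<close>)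
  have 2: "\<bar>sint (\<lambda>s. H s (s - (t - r))) t - sint (\<lambda>s. H s (s - (t - r))) (max 0 (t - r))\<bar> \<le> c / (2 - q) * Q"
    using outgoing_le[of t "t - r"] t by (simp add: Q_def)
  have 3: "\<bar>sint (\<lambda>s. H s (s - (t - r))) (max 0 (t - r))\<bar> \<le> c / (1 - a) * Q"
  proof (cases "0 \<le> t - r")
    case True
    then show ?thesis unfolding reflected_ray
      using order.trans[OF incoming_le le, of "t - r" "t - r"] wt_pair_le[OF t] by (simp add: Q_def)
  qed (use a c Q in auto)
  have "\<bar>d\<bar> \<le> X + Y" if "\<bar>x\<bar> \<le> X" "\<bar>y - z\<bar> \<le> Y" "\<bar>z\<bar> \<le> X" "2 * d = x + y" for x y z d X Y :: real
    using that by linarith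
  from this[OF 1 2 3 duhamel_t_split]
  have "\<bar>duhamel_t H t r\<bar> \<le> c / (1 - a) * Q + c / (2 - q) * Q" .
  then show ?thesis by (simp add: Q_def algebra_simps)
qed

text \<open>Near the axis the incoming rays through \<open>(t, r)\<close> and \<open>(t, -r)\<close> nearly cancel; they are matched
  by the shift \<open>(r, r)\<close>, which is why \<open>H\<close> is compared along the outgoing direction.\<close>

lemma duhamel_t_near_bound:
  assumes t: "0 \<le> t" "0 \<le> r" and near: "r \<le> 2 + \<bar>t - r\<bar>"
    and H_diff: "\<And>s x d. \<lbrakk>0 \<le> s; 0 \<le> x; 0 \<le> d\<rbrakk> \<Longrightarrow>
      \<bar>H (s + d) (x + d) - H s x\<bar> \<le> c * d * (wt (- q) (s + x) * wt (- a) (s - x))"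
  shows "\<bar>duhamel_t H t r\<bar> \<le> c * (3 / (1 - a) + 4) * (r * wt (1 - q) (t + r) * wt (- a) (t - r))"
proof -
  define Q where "Q = wt (1 - q) (t + r) * wt (- a) (t - r)"
  have Q: "0 \<le> Q" by (simp add: Q_def)
  \<comment> \<open>The assumption \<open>near\<close> gives A <= 3B, so the two weights may be
    exchanged at the cost of 3^(q-1) <= 3.\<close>
  have "(2 + \<bar>t - r\<bar>) powr (1 - q) \<le> ((2 + (t + r)) / 3) powr (1 - q)"
    using near t q by (intro powr_mono2') (auto simp: abs_if split: if_splits)
  also have "\<dots> = (2 + (t + r)) powr (1 - q) * 3 powr (q - 1)"
    using t by (simp add: powr_divide powr_minus_divide[of 3 "q - 1", simplified])
  also have "\<dots> \<le> (2 + (t + r)) powr (1 - q) * 3 powr 1"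
    using q by (intro mult_left_mono powr_mono) auto
  finally have B3: "wt (1 - q) (t - r) \<le> 3 * wt (1 - q) (t + r)" using t by (simp add: wt_def)
  then have BQ: "wt (1 - q) (t - r) * wt (- a) (t - r) \<le> 3 * Q"
    unfolding Q_def by (metis mult.assoc mult_right_mono wt_pos(2))
  have out: "\<bar>sint (\<lambda>s. H s (s - (t - r))) t - sint (\<lambda>s. H s (s - (t - r))) (max 0 (t - r))\<bar> \<le> c * (3 * Q) * r"
  proof -
    have "\<bar>sint (\<lambda>s. H s (s - (t - r))) t - sint (\<lambda>s. H s (s - (t - r))) (max 0 (t - r))\<bar>
      \<le> sint (\<lambda>s. c * (3 * Q)) t - sint (\<lambda>s. c * (3 * Q)) (max 0 (t - r))"
    proof (rule sint_mono_diff)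
      fix s assume s: "max 0 (t - r) \<le> s" "s \<le> t"
      have e: "s + (s - (t - r)) = 2 * s - (t - r)" "s - (s - (t - r)) = t - r" by auto
      have "\<bar>H s (s - (t - r))\<bar> \<le> c * (wt (1 - q) (2 * s - (t - r)) * wt (- a) (t - r))"
        using H_le'[of s "s - (t - r)"] s t unfolding e by simp
      also have "\<dots> \<le> c * (wt (1 - q) (t - r) * wt (- a) (t - r))"
        using s q by (intro mult_left_mono mult_right_mono wt_anti c) auto
      also have "\<dots> \<le> c * (3 * Q)" by (intro mult_left_mono BQ c)
      finally show "\<bar>H s (s - (t - r))\<bar> \<le> c * (3 * Q)" .
    qed (use t flat_ray_cont in auto)
    also have "\<dots> = c * (3 * Q) * (t - max 0 (t - r))" by (simp add: sint_const algebra_simps)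
    also have "\<dots> \<le> c * (3 * Q) * r" using c Q by (intro mult_left_mono) auto
    finally show ?thesis .
  qed
  \<comment> \<open>A piece of the incoming ray of duration at most \<open>r\<close>: what the shift
    by (r, r) leaves unmatched. As s <= min(t, r), |2s - (t + r)| is at least |t - r|.\<close>
  have tail: "\<bar>sint (\<lambda>s. H s ((t + r) - s)) T\<bar> \<le> c * Q * r" if T: "0 \<le> T" "T \<le> t" "T \<le> r" for T
  proof -
    have "\<bar>sint (\<lambda>s. H s ((t + r) - s)) T\<bar> \<le> sint (\<lambda>s. c * Q) T"
    proof (rule sint_bound)
      fix s assume s: "0 \<le> s" "s \<le> T"
      have e: "s + ((t + r) - s) = t + r" "s - ((t + r) - s) = 2 * s - (t + r)" by auto
      have "\<bar>H s ((t + r) - s)\<bar> \<le> c * (wt (1 - q) (t + r) * wt (- a) (2 * s - (t + r)))"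
        using H_le'[of s "(t + r) - s"] s t T unfolding e by simp
      also have "\<dots> \<le> c * Q" unfolding Q_def
        using s a T by (intro mult_left_mono wt_anti c) auto
      finally show "\<bar>H s ((t + r) - s)\<bar> \<le> c * Q" .
    qed (use T flat_ray_cont in auto)
    also have "\<dots> = c * Q * T" by (simp add: sint_const)
    also have "\<dots> \<le> c * Q * r" using c Q T by (intro mult_left_mono) auto
    finally show ?thesis .
  qed
  have main: "\<bar>sint (\<lambda>s. H s ((t + r) - s)) t + sint (\<lambda>s. H s (s - (t - r))) (max 0 (t - r))\<bar>
     \<le> c * (3 * Q) * r / (1 - a) + c * Q * r"
  proof (cases "r \<le> t")
    case False
    then have "max 0 (t - r) = 0" by simp
    moreover have "0 \<le> c * (3 * Q) * r / (1 - a)" using c Q t a by auto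
    ultimately show ?thesis using tail[of t] False t by simp
  next
    case True
    define \<eta> where "\<eta> = t - r"
    have \<eta>: "0 \<le> \<eta>" "max 0 (t - r) = \<eta>" using True by (auto simp: \<eta>_def)
    have cc: "continuous_on UNIV (\<lambda>s. H (s + r) (t - s))" "continuous_on UNIV (\<lambda>s. H s (\<eta> - s))"
      by (intro cont2_comp[OF H] continuous_intros)+
    have "sint (\<lambda>s. H (s + r) ((t + r) - (s + r))) \<eta> = sint (\<lambda>s. H s ((t + r) - s)) t - sint (\<lambda>s. H s ((t + r) - s)) r"
      using sint_shift[OF flat_ray_cont(1)[of "t + r"], of r \<eta>] by (simp add: \<eta>_def)
    then have split: "sint (\<lambda>s. H s ((t + r) - s)) t + sint (\<lambda>s. H s (s - (t - r))) (max 0 (t - r))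
        = sint (\<lambda>s. H s ((t + r) - s)) r + sint (\<lambda>s. H (s + r) (t - s) - H s (\<eta> - s)) \<eta>"
      unfolding reflected_ray \<eta>(2) by (simp add: sint_diff[OF cc] flip: \<eta>_def)
    have near0: "\<bar>sint (\<lambda>s. H s ((t + r) - s)) r\<bar> \<le> c * Q * r" using tail[of r] t True by simp
    \<comment> \<open>The factor \<open>r\<close> comes from \<open>H_diff\<close> with
      \<open>d = r\<close>, and the exponents -q and 1 - a regroup into 1 - q and -a.\<close>
    have shifted: "\<bar>sint (\<lambda>s. H (s + r) (t - s) - H s (\<eta> - s)) \<eta>\<bar> \<le> c * (3 * Q) * r / (1 - a)"
    proof -
      define k where "k = c * r * wt (- q) \<eta>"
      have k: "0 \<le> k" using c t by (simp add: k_def)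
      have "\<bar>sint (\<lambda>s. H (s + r) (t - s) - H s (\<eta> - s)) \<eta>\<bar> \<le> sint (\<lambda>s. k * wt ((1 - a) - 1) (2 * s - \<eta>)) \<eta>"
      proof (rule sint_bound)
        show "continuous_on UNIV (\<lambda>s. k * wt ((1 - a) - 1) (2 * s - \<eta>))"
          by (intro continuous_intros wt_cont)
        fix s assume s: "0 \<le> s" "s \<le> \<eta>"
        have e: "s + (\<eta> - s) = \<eta>" "s - (\<eta> - s) = 2 * s - \<eta>" "\<eta> - s + r = t - s" by (auto simp: \<eta>_def)
        show "\<bar>H (s + r) (t - s) - H s (\<eta> - s)\<bar> \<le> k * wt ((1 - a) - 1) (2 * s - \<eta>)"
          using H_diff[of s "\<eta> - s" r] s t unfolding e k_def by (simp add: mult_ac)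
      qed (use cc \<eta> in \<open>auto intro!: continuous_intros\<close>)
      also have "\<dots> = k * sint (\<lambda>s. wt ((1 - a) - 1) (2 * s - \<eta>)) \<eta>" by (rule sint_cmult)
      also have "\<dots> \<le> k * (wt (1 - a) \<eta> / (1 - a))"
        by (intro mult_left_mono ray_wt_pos k) (use a in auto)
      also have "\<dots> = c * (wt (1 - q) \<eta> * wt (- a) \<eta>) * r / (1 - a)"
      proof -
        have "wt (- q) \<eta> * wt (1 - a) \<eta> = wt (1 - q) \<eta> * wt (- a) \<eta>"
          using wt_add[of "- q" "1 - a" \<eta>] wt_add[of "1 - q" "- a" \<eta>] by (simp add: algebra_simps)
        then show ?thesis by (simp add: k_def mult_ac)
      qed
      also have "\<dots> \<le> c * (3 * Q) * r / (1 - a)"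
        using BQ a c t unfolding \<eta>_def by (intro divide_right_mono mult_right_mono mult_left_mono) auto
      finally show ?thesis .
    qed
    have "\<bar>x + y\<bar> \<le> Y + X" if "\<bar>x\<bar> \<le> X" "\<bar>y\<bar> \<le> Y" for x y X Y :: real using that by linarith
    from this[OF near0 shifted] show ?thesis unfolding split .
  qed
  have "\<bar>d\<bar> \<le> X + (Y + Z)" if "\<bar>x + z\<bar> \<le> X + Y" "\<bar>y - z\<bar> \<le> Z" "2 * d = x + y" for x y z d X Y Z :: real
    using that by linarith
  from this[OF main out duhamel_t_split]
  have "\<bar>duhamel_t H t r\<bar> \<le> c * (3 * Q) * r / (1 - a) + (c * Q * r + c * (3 * Q) * r)" .
  also have "\<dots> = c * (3 / (1 - a) + 4) * (r * Q)" by (simp add: algebra_simps)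
  finally show ?thesis by (simp add: Q_def mult.assoc)
qed

text \<open>Away from the axis, r > 2 + |t - r| gives A <= 3r, so one power of A in the bound
  without cancellation already is the wanted factor \<open>r\<close>.\<close>

lemma duhamel_t_strong_bound:
  assumes t: "0 \<le> t" "0 \<le> r"
    and H_diff: "\<And>s x d. \<lbrakk>0 \<le> s; 0 \<le> x; 0 \<le> d\<rbrakk> \<Longrightarrow>
      \<bar>H (s + d) (x + d) - H s x\<bar> \<le> c * d * (wt (- q) (s + x) * wt (- a) (s - x))"
  shows "\<bar>duhamel_t H t r\<bar> \<le> c * (3 * (1 / (1 - a) + 1 / (2 - q)) + 4) * (r * wt (1 - q) (t + r) * wt (- a) (t - r))"
proof -
  define Q where "Q = r * wt (1 - q) (t + r) * wt (- a) (t - r)"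
  have Q: "0 \<le> c * Q" using t c by (simp add: Q_def)
  have a': "0 \<le> 1 / (1 - a)" "0 \<le> 1 / (2 - q)" using a q by auto
  show ?thesis
  proof (cases "r \<le> 2 + \<bar>t - r\<bar>")
    case True
    have "\<bar>duhamel_t H t r\<bar> \<le> (3 * (1 / (1 - a)) + 4) * (c * Q)"
      using duhamel_t_near_bound[OF t True H_diff] by (simp add: Q_def mult_ac)
    also have "\<dots> \<le> (3 * (1 / (1 - a) + 1 / (2 - q)) + 4) * (c * Q)"
      using a' by (intro mult_right_mono Q) auto
    finally show ?thesis by (simp add: Q_def mult_ac)
  next
    case False
    have "wt (2 - q) (t + r) = (2 + (t + r)) * wt (1 - q) (t + r)"
      using wt_add[of 1 "1 - q" "t + r"] t by (simp add: wt_def)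
    also have "\<dots> \<le> (3 * r) * wt (1 - q) (t + r)"
      using False t by (intro mult_right_mono) auto
    finally have "wt (2 - q) (t + r) * wt (- a) (t - r) \<le> 3 * Q"
      unfolding Q_def by (metis (no_types, opaque_lifting) mult.assoc mult_right_mono wt_pos(2))
    then have "c * (1 / (1 - a) + 1 / (2 - q)) * (wt (2 - q) (t + r) * wt (- a) (t - r)) \<le>
       c * (1 / (1 - a) + 1 / (2 - q)) * (3 * Q)"
      using a' c by (intro mult_left_mono) auto
    also have "\<dots> = 3 * (1 / (1 - a) + 1 / (2 - q)) * (c * Q)" by simp
    also have "\<dots> \<le> (3 * (1 / (1 - a) + 1 / (2 - q)) + 4) * (c * Q)" by (intro mult_right_mono Q) auto
    finally show ?thesis using duhamel_t_weak_bound[OF t] by (simp add: Q_def mult_ac)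
  qed
qed

end

section \<open>Integration by parts away from the axis\<close>

type_synonym E = "real^3"

lemma norm_axis_add_deriv:
  fixes x :: E
  assumes "x \<noteq> 0"
  shows "((\<lambda>s. norm (x + s *\<^sub>R axis i 1)) has_real_derivative x $ i / norm x) (at 0)"
proof -
  have e: "(x + s *\<^sub>R axis i 1) \<bullet> (x + s *\<^sub>R axis i 1) = x \<bullet> x + 2 * s * x $ i + s * s" for s :: real
    by (simp add: inner_add_left inner_add_right inner_axis inner_axis' algebra_simps)
  have p: "0 < x \<bullet> x" using assms by simp
  have "((\<lambda>s. sqrt (x \<bullet> x + 2 * s * x $ i + s * s)) has_real_derivative (2 * x $ i) * (inverse (sqrt (x \<bullet> x)) / 2)) (at 0)"
    using p by (auto intro!: derivative_eq_intros simp del: inner_gt_zero_iff)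
  then show ?thesis
    unfolding norm_eq_sqrt_inner e by (simp add: field_simps)
qed

lemma sum_sq_norm: "(\<Sum>i\<in>UNIV. (x $ i)\<^sup>2) = (norm (x :: E))\<^sup>2"
  unfolding power2_norm_eq_inner inner_vec_def by (simp add: power2_eq_square)

text \<open>Passes from a profile r u back to u on space. On the axis the value is 0 by the
  convention for division; it is only used against factors that vanish near the axis.\<close>

definition lift :: "(real \<Rightarrow> real \<Rightarrow> real) \<Rightarrow> real \<times> E \<Rightarrow> real" where
  "lift F z = F (fst z) (norm (snd z)) / norm (snd z)"

lemma integral_outside:
  fixes f :: "'a::euclidean_space \<Rightarrow> real"
  assumes "\<And>x. x \<notin> S \<Longrightarrow> x \<in> T \<Longrightarrow> f x = 0" "S \<subseteq> T"
  shows "integral T f = integral S f"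
proof -
  have "integral S f = integral UNIV (\<lambda>x. if x \<in> S then f x else 0)" by (rule integral_restrict_UNIV[symmetric])
  also have "\<dots> = integral UNIV (\<lambda>x. if x \<in> T then f x else 0)"
    by (rule arg_cong[where f = "integral UNIV"]) (use assms in \<open>auto simp: fun_eq_iff\<close>)
  finally show ?thesis by (simp add: integral_restrict_UNIV)
qed

definition cube :: "real \<Rightarrow> E set" where "cube R = cbox (vec (- R)) (vec R)"

lemma not_in_cube: "x \<notin> cube R \<Longrightarrow> R \<le> norm x"
proof -
  assume "x \<notin> cube R"
  then obtain i where "x $ i < - R \<or> R < x $ i"
    by (auto simp: cube_def mem_box_cart not_le)
  then have "R < \<bar>x $ i\<bar>" by auto
  then show ?thesis using component_le_norm_cart[of x i] by linarith
qed

lemma cube_mono: "R \<le> R' \<Longrightarrow> cube R \<subseteq> cube R'"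
  by (auto simp: cube_def mem_box_cart) (smt (verit))+

text \<open>Translation invariance in place of integrating over faces: the integral of the translate
  over a cube with margin 1 is constant for |s| <= 1, and it can be differentiated under the
  integral sign.\<close>

lemma integral_directional_deriv_zero:
  fixes \<psi> \<psi>' :: "E \<Rightarrow> real"
  assumes c: "continuous_on UNIV \<psi>" "continuous_on UNIV \<psi>'"
    and d: "\<And>x. ((\<lambda>s. \<psi> (x + s *\<^sub>R e)) has_real_derivative \<psi>' x) (at 0)"
    and z: "\<And>x. R \<le> norm x \<Longrightarrow> \<psi> x = 0" "\<And>x. R \<le> norm x \<Longrightarrow> \<psi>' x = 0"
    and e: "norm e \<le> 1"
  shows "integral (cube R) \<psi>' = 0"
proof -
  define R' where "R' = R + 1"
  define F where "F s = integral (cube R') (\<lambda>x. \<psi> (x + s *\<^sub>R e))" for s :: real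
  have "F s = integral UNIV \<psi>" if s: "\<bar>s\<bar> \<le> 1" for s
  proof -
    have n: "norm (s *\<^sub>R e) \<le> 1" using s e mult_mono[of "\<bar>s\<bar>" 1 "norm e" 1] by simp
    have "F s = integral (cbox (vec (- R') + s *\<^sub>R e) (vec R' + s *\<^sub>R e)) \<psi>"
      using integral_shift_cbox_plus[of "vec (- R')" "vec R'" \<psi> "s *\<^sub>R e"]
      by (simp add: F_def o_def add.commute cube_def)
    also have "\<dots> = integral UNIV \<psi>"
    proof (rule integral_outside[symmetric])
      fix x assume "x \<notin> cbox (vec (- R') + s *\<^sub>R e) (vec R' + s *\<^sub>R e)"
      then have "x - s *\<^sub>R e \<notin> cube R'"
        by (auto simp: cube_def mem_box_cart algebra_simps)
      then have "R' \<le> norm (x - s *\<^sub>R e)" by (rule not_in_cube)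
      then have "R \<le> norm x" using n norm_triangle_ineq4[of x "s *\<^sub>R e"] by (simp add: R'_def)
      then show "\<psi> x = 0" by (rule z)
    qed auto
    finally show ?thesis .
  qed
  then have "\<forall>\<^sub>F s in nhds 0. F s = integral UNIV \<psi>"
    by (intro eventually_mono[OF eventually_nhds_in_open[of "{-1<..<1::real}" 0]]) auto
  then have "(F has_real_derivative 0) (at 0)"
    using DERIV_cong_ev[of 0 0 F "\<lambda>s. integral UNIV \<psi>" 0 0] by simp
  moreover have "(F has_real_derivative integral (cube R') (\<lambda>x. \<psi>' (x + 0 *\<^sub>R e))) (at 0 within UNIV)"
    unfolding F_def cube_def
  proof (rule leibniz_rule_field_derivative)
    fix s x
    have "((\<lambda>h. \<psi> (x + s *\<^sub>R e + h *\<^sub>R e)) has_real_derivative \<psi>' (x + s *\<^sub>R e)) (at 0)" by (rule d)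
    moreover have "(\<lambda>h. \<psi> (x + s *\<^sub>R e + h *\<^sub>R e)) = (\<lambda>h. \<psi> (x + (h + s) *\<^sub>R e))"
      by (simp add: algebra_simps)
    ultimately show "((\<lambda>s. \<psi> (x + s *\<^sub>R e)) has_real_derivative \<psi>' (x + s *\<^sub>R e)) (at s within UNIV)"
      using DERIV_shift[of "\<lambda>s. \<psi> (x + s *\<^sub>R e)" "\<psi>' (x + s *\<^sub>R e)" 0 s] by simp
  next
    show "(\<lambda>x. \<psi> (x + s *\<^sub>R e)) integrable_on cbox (vec (- R')) (vec R')" for s
      by (intro integrable_continuous continuous_on_compose2[OF c(1)] continuous_intros) auto
    show "continuous_on (UNIV \<times> cbox (vec (- R')) (vec R')) (\<lambda>(s, x). \<psi>' (x + s *\<^sub>R e))"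
      unfolding case_prod_beta
      by (intro continuous_on_compose2[OF c(2)] continuous_intros) auto
  qed auto
  ultimately have "integral (cube R') \<psi>' = 0" using DERIV_unique by fastforce
  moreover have "integral (cube R') \<psi>' = integral (cube R) \<psi>'"
    by (rule integral_outside) (use z not_in_cube cube_mono[of R R'] in \<open>auto simp: R'_def\<close>)
  ultimately show ?thesis by simp
qed

lemma continuous_on_mult_vanishing:
  fixes G \<Phi> :: "real \<times> E \<Rightarrow> real"
  assumes "continuous_on {z. snd z \<noteq> 0} G" "continuous_on UNIV \<Phi>" "0 < \<delta>"
    and z: "\<And>z. norm (snd z) < \<delta> \<Longrightarrow> \<Phi> z = 0"
  shows "continuous_on UNIV (\<lambda>z. G z * \<Phi> z)"
proof -
  have "{z :: real \<times> E. snd z \<noteq> 0} = UNIV \<times> (- {0})" by auto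
  then have o1: "open {z :: real \<times> E. snd z \<noteq> 0}" by (simp add: open_Times open_Compl)
  have "{z :: real \<times> E. norm (snd z) < \<delta>} = UNIV \<times> ball 0 \<delta>" by auto
  then have o2: "open {z :: real \<times> E. norm (snd z) < \<delta>}" by (simp add: open_Times open_Compl)
  have "continuous_on ({z. snd z \<noteq> 0} \<union> {z. norm (snd z) < \<delta>}) (\<lambda>z. G z * \<Phi> z)"
  proof (rule continuous_on_open_Un[OF o1 o2])
    show "continuous_on {z. snd z \<noteq> 0} (\<lambda>z. G z * \<Phi> z)"
      by (intro continuous_intros assms continuous_on_subset[OF assms(2)]) auto
    have "continuous_on {z :: real \<times> E. norm (snd z) < \<delta>} (\<lambda>z. 0 :: real)" by simp
    then show "continuous_on {z. norm (snd z) < \<delta>} (\<lambda>z. G z * \<Phi> z)"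
      by (rule continuous_on_eq) (simp add: z)
  qed
  moreover have "{z. snd z \<noteq> 0} \<union> {z :: real \<times> E. norm (snd z) < \<delta>} = UNIV" using assms(3) by auto
  ultimately show ?thesis by simp
qed

section \<open>Test functions as explicit data, and integration by parts against them\<close>

text \<open>The derivatives are parameters tied by their defining relations instead of iterated
  \<open>dd\<close>, so that the product with a cutoff is again an instance, its derivatives being
  given by the product rule.\<close>

locale test_data =
  fixes \<phi> \<phi>t \<phi>tt :: "real \<times> E \<Rightarrow> real" and \<phi>x \<phi>xx :: "3 \<Rightarrow> real \<times> E \<Rightarrow> real" and R :: real
  assumes cont: "continuous_on UNIV \<phi>" "continuous_on UNIV \<phi>t" "continuous_on UNIV \<phi>tt"
      "continuous_on UNIV (\<phi>x i)" "continuous_on UNIV (\<phi>xx i)"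
    and dt: "((\<lambda>t. \<phi> (t, x)) has_real_derivative \<phi>t (t, x)) (at t)"
    and dtt: "((\<lambda>t. \<phi>t (t, x)) has_real_derivative \<phi>tt (t, x)) (at t)"
    and dx: "((\<lambda>s. \<phi> (t, x + s *\<^sub>R axis i 1)) has_real_derivative \<phi>x i (t, x)) (at 0)"
    and dxx: "((\<lambda>s. \<phi>x i (t, x + s *\<^sub>R axis i 1)) has_real_derivative \<phi>xx i (t, x)) (at 0)"
    and R: "0 < R"
    and supp: "R \<le> \<bar>t\<bar> \<or> R \<le> norm x \<Longrightarrow> \<phi> (t, x) = 0 \<and> \<phi>t (t, x) = 0 \<and> \<phi>tt (t, x) = 0 \<and> \<phi>x i (t, x) = 0 \<and> \<phi>xx i (t, x) = 0"
begin

definition slab :: "(real \<times> E) set" where "slab = {0..R} \<times> cube R"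

lemma slab_cbox: "slab = cbox (0, vec (- R)) (R, vec R)"
  by (simp add: slab_def cube_def cbox_Pair_eq)

definition wave_op :: "real \<times> E \<Rightarrow> real" where
  "wave_op z = \<phi>tt z - (\<Sum>i\<in>UNIV. \<phi>xx i z)"

lemma wave_op_cont: "continuous_on UNIV wave_op"
  unfolding wave_op_def by (intro continuous_intros cont)

lemma integral_slab:
  fixes f :: "real \<times> E \<Rightarrow> real"
  assumes "continuous_on slab f"
  shows "integral slab f = integral {0..R} (\<lambda>t. integral (cube R) (\<lambda>x. f (t, x)))"
  using assms integral_prod_continuous[of 0 "vec (- R)" R "vec R" f] unfolding slab_cbox cube_def by simp

end

locale test_data_off_axis = test_data +
  fixes \<delta> :: real
  assumes \<delta>: "0 < \<delta>"
    and off_axis: "norm x < \<delta> \<Longrightarrow> \<phi> (t, x) = 0 \<and> \<phi>t (t, x) = 0 \<and> \<phi>tt (t, x) = 0 \<and> \<phi>x i (t, x) = 0 \<and> \<phi>xx i (t, x) = 0"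
begin

lemma cont_mult:
  assumes "continuous_on {z :: real \<times> E. snd z \<noteq> 0} G"
  shows "continuous_on UNIV (\<lambda>z. G z * \<phi> z)" "continuous_on UNIV (\<lambda>z. G z * \<phi>t z)" "continuous_on UNIV (\<lambda>z. G z * \<phi>tt z)"
    "continuous_on UNIV (\<lambda>z. G z * \<phi>x i z)" "continuous_on UNIV (\<lambda>z. G z * \<phi>xx i z)" "continuous_on UNIV (\<lambda>z. G z * wave_op z)"
  by (rule continuous_on_mult_vanishing[OF assms _ \<delta>]; use cont wave_op_cont off_axis in \<open>auto simp: wave_op_def\<close>)+

lemma cont_quot: "cont2 F \<Longrightarrow> continuous_on {z :: real \<times> E. snd z \<noteq> 0} (lift F)"
  unfolding lift_def[abs_def] by (intro continuous_intros cont2_comp[of F]) auto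

text \<open>Green's identity, one coordinate at a time: the i-th derivative of h \<phi>_i - h_i
  \<phi> is h \<phi>_ii - h_ii \<phi>, because the mixed terms cancel. Summed over i, h_ii gives h''
  + 2h'/r, the radial Laplacian in dimension three.\<close>

lemma space_ibp:
  fixes h h1 h2 :: "real \<Rightarrow> real"
  assumes h: "\<And>r. 0 < r \<Longrightarrow> (h has_real_derivative h1 r) (at r)"
    and h1: "\<And>r. 0 < r \<Longrightarrow> (h1 has_real_derivative h2 r) (at r)"
    and h2: "continuous_on {0<..} h2"
  shows "integral (cube R) (\<lambda>x. h (norm x) * (\<Sum>i\<in>UNIV. \<phi>xx i (t, x)))
    = integral (cube R) (\<lambda>x. (h2 (norm x) + 2 * h1 (norm x) / norm x) * \<phi> (t, x))"
proof -
  define gi where "gi i x = h1 (norm x) * (x $ i / norm x)" for i :: 3 and x :: E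
  define gii where "gii i x = h2 (norm x) * (x $ i)\<^sup>2 / (norm x)\<^sup>2 + h1 (norm x) * (1 / norm x - (x $ i)\<^sup>2 / (norm x)^3)" for i :: 3 and x :: E
  have hc: "continuous_on {0<..} h" "continuous_on {0<..} h1"
    by (rule deriv_continuous_on, rule h h1, simp)+
  have nc: "continuous_on {z :: real \<times> E. snd z \<noteq> 0} (\<lambda>z. f (norm (snd z)))" if "continuous_on {0<..} f" for f :: "real \<Rightarrow> real"
    by (rule continuous_on_compose2[OF that]) (auto intro!: continuous_intros)
  have cg: "continuous_on {z :: real \<times> E. snd z \<noteq> 0} (\<lambda>z. h (norm (snd z)))"
    "continuous_on {z :: real \<times> E. snd z \<noteq> 0} (\<lambda>z. gi i (snd z))"
    "continuous_on {z :: real \<times> E. snd z \<noteq> 0} (\<lambda>z. gii i (snd z))" for i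
    unfolding gi_def gii_def by (intro continuous_intros nc hc h2; auto)+
  have slice: "continuous_on UNIV (\<lambda>x. f (t, x))" if "continuous_on UNIV f" for f :: "real \<times> E \<Rightarrow> real"
    by (rule continuous_on_compose2[OF that]) (auto intro!: continuous_intros)
  have int: "f integrable_on cube R" if "continuous_on UNIV f" for f :: "E \<Rightarrow> real"
    unfolding cube_def by (rule integrable_continuous) (rule continuous_on_subset[OF that], simp)
  note sc = cont_mult(1)[OF cg(3), THEN slice, simplified] cont_mult(5)[OF cg(1), THEN slice, simplified]
    cont_mult(4)[OF cg(1), THEN slice, simplified] cont_mult(1)[OF cg(2), THEN slice, simplified]
  have "integral (cube R) (\<lambda>x. h (norm x) * \<phi>xx i (t, x) - gii i x * \<phi> (t, x)) = 0" for i
  proof (rule integral_directional_deriv_zero[where \<psi> = "\<lambda>x. h (norm x) * \<phi>x i (t, x) - gi i x * \<phi> (t, x)" and e = "axis i 1"])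
    fix x
    show "((\<lambda>s. h (norm (x + s *\<^sub>R axis i 1)) * \<phi>x i (t, x + s *\<^sub>R axis i 1) - gi i (x + s *\<^sub>R axis i 1) * \<phi> (t, x + s *\<^sub>R axis i 1))
        has_real_derivative h (norm x) * \<phi>xx i (t, x) - gii i x * \<phi> (t, x)) (at 0)"
    \<comment> \<open>Where the norm may fail to be differentiable, the product is locally
      zero.\<close>
    proof (cases "norm x < \<delta>")
      case True
      have "continuous_on UNIV (\<lambda>s. norm (x + s *\<^sub>R axis i 1))" by (intro continuous_intros)
      then have "open {s. norm (x + s *\<^sub>R axis i 1) < \<delta>}"
        by (intro open_Collect_less) (auto intro!: continuous_intros)
      then have "\<forall>\<^sub>F s in nhds 0. norm (x + s *\<^sub>R axis i 1) < \<delta>"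
        using eventually_nhds_in_open[of "{s. norm (x + s *\<^sub>R axis i 1) < \<delta>}" 0] True by simp
      then have ev: "\<forall>\<^sub>F s in nhds 0. h (norm (x + s *\<^sub>R axis i 1)) * \<phi>x i (t, x + s *\<^sub>R axis i 1) - gi i (x + s *\<^sub>R axis i 1) * \<phi> (t, x + s *\<^sub>R axis i 1) = 0"
        by eventually_elim (simp add: off_axis)
      have "h (norm x) * \<phi>xx i (t, x) - gii i x * \<phi> (t, x) = 0" using True by (simp add: off_axis)
      then show ?thesis by (simp only:) (rule iffD2[OF DERIV_cong_ev[OF refl ev refl] DERIV_const])
    next
      case False
      then have x: "x \<noteq> 0" "0 < norm x" using \<delta> by auto
      have n: "((\<lambda>s. norm (x + s *\<^sub>R axis i 1)) has_real_derivative x $ i / norm x) (at 0)"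
        by (rule norm_axis_add_deriv[OF x(1)])
      have c: "((\<lambda>s. f (norm (x + s *\<^sub>R axis i 1))) has_real_derivative f' * (x $ i / norm x)) (at 0)"
        if "(f has_real_derivative f') (at (norm x))" for f f'
        by (rule DERIV_chain2[OF _ n]) (use that in simp)
      have xi: "((\<lambda>s. (x + s *\<^sub>R axis i 1) $ i) has_real_derivative 1) (at 0)"
        by (auto intro!: derivative_eq_intros simp: axis_def)
      have g: "((\<lambda>s. gi i (x + s *\<^sub>R axis i 1)) has_real_derivative gii i x) (at 0)"
        unfolding gi_def
        by (rule DERIV_cong[OF DERIV_mult[OF c[OF h1[OF x(2)]] DERIV_divide[OF xi n]]])
          (use x in \<open>simp_all add: gii_def field_simps power2_eq_square power3_eq_cube\<close>)
      show ?thesis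
        by (rule DERIV_cong[OF DERIV_diff[OF DERIV_mult[OF c[OF h[OF x(2)]] dxx] DERIV_mult[OF g dx]]])
          (simp add: gi_def algebra_simps)
    qed
  qed (use supp in \<open>auto intro!: continuous_intros sc\<close>)
  then have i: "integral (cube R) (\<lambda>x. h (norm x) * \<phi>xx i (t, x)) = integral (cube R) (\<lambda>x. gii i x * \<phi> (t, x))" for i
    using integral_diff[OF int int, OF sc(2) sc(1), of i i] by simp
  have "integral (cube R) (\<lambda>x. h (norm x) * (\<Sum>i\<in>UNIV. \<phi>xx i (t, x)))
     = (\<Sum>i\<in>UNIV. integral (cube R) (\<lambda>x. h (norm x) * \<phi>xx i (t, x)))"
    unfolding sum_distrib_left by (rule integral_sum) (auto intro!: int sc)
  also have "\<dots> = (\<Sum>i\<in>UNIV. integral (cube R) (\<lambda>x. gii i x * \<phi> (t, x)))" by (simp only: i)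
  also have "\<dots> = integral (cube R) (\<lambda>x. \<Sum>i\<in>UNIV. gii i x * \<phi> (t, x))"
    by (rule integral_sum[symmetric]) (auto intro!: int sc)
  also have "\<dots> = integral (cube R) (\<lambda>x. (h2 (norm x) + 2 * h1 (norm x) / norm x) * \<phi> (t, x))"
  proof (rule integral_cong)
    fix x
    show "(\<Sum>i\<in>UNIV. gii i x * \<phi> (t, x)) = (h2 (norm x) + 2 * h1 (norm x) / norm x) * \<phi> (t, x)"
    proof (cases "x = 0")
      case False
      have "(\<Sum>i\<in>UNIV. gii i x) = h2 (norm x) * (\<Sum>i\<in>UNIV. (x $ i)\<^sup>2) / (norm x)\<^sup>2
          + h1 (norm x) * (3 / norm x - (\<Sum>i\<in>UNIV. (x $ i)\<^sup>2) / (norm x)^3)"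
        unfolding gii_def by (simp add: sum.distrib sum_subtractf sum_distrib_left[symmetric] sum_divide_distrib[symmetric])
      also have "\<dots> = h2 (norm x) + 2 * h1 (norm x) / norm x"
        unfolding sum_sq_norm using False by (simp add: field_simps power2_eq_square power3_eq_cube)
      finally show ?thesis by (simp add: sum_distrib_right[symmetric])
    qed (use off_axis \<delta> in simp)
  qed
  finally show ?thesis .
qed

text \<open>For u = U/r the radial Laplacian is U_rr/r. In time, the integral of u \<phi>_t - u_t
  \<phi> over space is differentiated: it vanishes at time R, and at time 0 it carries the initial
  data.\<close>

lemma classical_weak:
  fixes U Ut Utt Ur Urr :: "real \<Rightarrow> real \<Rightarrow> real"
  assumes c: "cont2 U" "cont2 Ut" "cont2 Utt" "cont2 Urr"
    and t: "\<And>t r. ((\<lambda>t. U t r) has_real_derivative Ut t r) (at t)" "\<And>t r. ((\<lambda>t. Ut t r) has_real_derivative Utt t r) (at t)"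
    and r: "\<And>t r. (U t has_real_derivative Ur t r) (at r)" "\<And>t r. (Ur t has_real_derivative Urr t r) (at r)"
  shows "integral slab (\<lambda>z. lift U z * wave_op z)
    = integral slab (\<lambda>z. lift (\<lambda>t r. Utt t r - Urr t r) z * \<phi> z)
      + integral (cube R) (\<lambda>x. Ut 0 (norm x) / norm x * \<phi> (0, x))
      - integral (cube R) (\<lambda>x. U 0 (norm x) / norm x * \<phi>t (0, x))"
proof -
  define I where "I t = integral (cube R) (\<lambda>x. lift U (t, x) * \<phi>t (t, x) - lift Ut (t, x) * \<phi> (t, x))" for t
  define I' where "I' t = integral (cube R) (\<lambda>x. lift U (t, x) * \<phi>tt (t, x) - lift Utt (t, x) * \<phi> (t, x))" for t
  have slice: "continuous_on A (\<lambda>x. f (t, x))" if "continuous_on UNIV f" for f :: "real \<times> E \<Rightarrow> real" and t A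
    by (rule continuous_on_compose2[OF that]) (auto intro!: continuous_intros)
  have int: "(\<lambda>x. f (t, x)) integrable_on cube R" if "continuous_on UNIV f" for f :: "real \<times> E \<Rightarrow> real" and t
    unfolding cube_def by (rule integrable_continuous) (rule slice[OF that])
  note cm = cont_mult[OF cont_quot[OF c(1)]] cont_mult[OF cont_quot[OF c(2)]] cont_mult[OF cont_quot[OF c(3)]] cont_mult[OF cont_quot[OF c(4)]]
  have cP: "continuous_on UNIV (\<lambda>z. lift U z * \<phi>t z - lift Ut z * \<phi> z)"
    "continuous_on UNIV (\<lambda>z. lift U z * \<phi>tt z - lift Utt z * \<phi> z)"
    by (intro continuous_intros cm)+
  have dI: "(I has_real_derivative I' t) (at t within UNIV)" for t
    unfolding I_def I'_def cube_def
  proof (rule leibniz_rule_field_derivative)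
    fix t x
    have gd: "((\<lambda>t. lift U (t, x)) has_real_derivative lift Ut (t, x)) (at t)" "((\<lambda>t. lift Ut (t, x)) has_real_derivative lift Utt (t, x)) (at t)"
      unfolding lift_def by (auto intro!: DERIV_cdivide t)
    show "((\<lambda>t. lift U (t, x) * \<phi>t (t, x) - lift Ut (t, x) * \<phi> (t, x)) has_real_derivative
        lift U (t, x) * \<phi>tt (t, x) - lift Utt (t, x) * \<phi> (t, x)) (at t within UNIV)"
      by (rule DERIV_cong[OF DERIV_diff[OF DERIV_mult[OF gd(1) dtt] DERIV_mult[OF gd(2) dt]]]) simp
    show "(\<lambda>x. lift U (t, x) * \<phi>t (t, x) - lift Ut (t, x) * \<phi> (t, x)) integrable_on cbox (vec (- R)) (vec R)"
      using int[OF cP(1)] by (simp add: cube_def)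
    show "continuous_on (UNIV \<times> cbox (vec (- R)) (vec R)) (\<lambda>(t, x). lift U (t, x) * \<phi>tt (t, x) - lift Utt (t, x) * \<phi> (t, x))"
      using continuous_on_subset[OF cP(2)] by (simp add: case_prod_beta)
  qed auto
  have "(I' has_integral (I R - I 0)) {0..R}"
    by (rule fundamental_theorem_of_calculus)
      (use R dI in \<open>auto simp: has_real_derivative_iff_has_vector_derivative[symmetric] intro: has_field_derivative_at_within\<close>)
  moreover have "I R = 0" using supp[of R] R by (simp add: I_def)
  ultimately have hI: "(I' has_integral - I 0) {0..R}" by simp
  have hI0: "- I 0 = integral (cube R) (\<lambda>x. Ut 0 (norm x) / norm x * \<phi> (0, x)) - integral (cube R) (\<lambda>x. U 0 (norm x) / norm x * \<phi>t (0, x))"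
    unfolding I_def using integral_diff[OF int[OF cm(2)] int[OF cm(7)], of 0] by (simp add: lift_def)
  have box: "integral slab f = integral {0..R} (\<lambda>t. integral (cube R) (\<lambda>x. f (t, x)))" if "continuous_on UNIV f" for f :: "real \<times> E \<Rightarrow> real"
    by (rule integral_slab[OF continuous_on_subset[OF that]]) simp
  have ci: "continuous_on UNIV (\<lambda>t. integral (cube R) (\<lambda>x. f (t, x)))" if "continuous_on UNIV f" for f :: "real \<times> E \<Rightarrow> real"
    unfolding cube_def
    by (rule integral_continuous_on_param) (use continuous_on_subset[OF that] in \<open>simp add: case_prod_beta\<close>)
  define S where "S t = integral (cube R) (\<lambda>x. (lift Utt (t, x) - lift Urr (t, x)) * \<phi> (t, x))" for t
  have cS: "continuous_on UNIV (\<lambda>z. (lift Utt z - lift Urr z) * \<phi> z)"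
    unfolding left_diff_distrib by (intro continuous_intros cm)
  have inner: "integral (cube R) (\<lambda>x. lift U (t, x) * wave_op (t, x)) = I' t + S t" for t
  proof -
    have "integral (cube R) (\<lambda>x. U t (norm x) / norm x * (\<Sum>i\<in>UNIV. \<phi>xx i (t, x))) =
       integral (cube R) (\<lambda>x. ((Urr t (norm x) / norm x - 2 * Ur t (norm x) / (norm x)\<^sup>2 + 2 * U t (norm x) / (norm x)^3)
          + 2 * (Ur t (norm x) / norm x - U t (norm x) / (norm x)\<^sup>2) / norm x) * \<phi> (t, x))"
    proof (rule space_ibp)
      fix r :: real assume r0: "0 < r"
      show "((\<lambda>r. U t r / r) has_real_derivative (Ur t r / r - U t r / r\<^sup>2)) (at r)"
        using r0 by (auto intro!: derivative_eq_intros r simp: field_simps power2_eq_square)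
      show "((\<lambda>r. Ur t r / r - U t r / r\<^sup>2) has_real_derivative (Urr t r / r - 2 * Ur t r / r\<^sup>2 + 2 * U t r / r^3)) (at r)"
        using r0 by (auto intro!: derivative_eq_intros r simp: field_simps power2_eq_square power3_eq_cube power4_eq_xxxx)
    next
      have "continuous_on {0<..} (Ur t)" "continuous_on {0<..} (U t)"
        by (rule deriv_continuous_on, rule r)+
      moreover have "continuous_on {0<..} (Urr t)" using cont2_flat[OF c(4)] by (rule continuous_on_subset) simp
      ultimately show "continuous_on {0<..} (\<lambda>r. Urr t r / r - 2 * Ur t r / r\<^sup>2 + 2 * U t r / r ^ 3)"
        by (intro continuous_intros) auto
    qed
    also have "\<dots> = integral (cube R) (\<lambda>x. lift Urr (t, x) * \<phi> (t, x))"
    proof (rule integral_cong)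
      fix x :: E
      show "((Urr t (norm x) / norm x - 2 * Ur t (norm x) / (norm x)\<^sup>2 + 2 * U t (norm x) / (norm x)^3)
          + 2 * (Ur t (norm x) / norm x - U t (norm x) / (norm x)\<^sup>2) / norm x) * \<phi> (t, x) = lift Urr (t, x) * \<phi> (t, x)"
        by (cases "x = 0") (simp_all add: lift_def field_simps power2_eq_square power3_eq_cube)
    qed
    finally have lap: "integral (cube R) (\<lambda>x. lift U (t, x) * (\<Sum>i\<in>UNIV. \<phi>xx i (t, x))) = integral (cube R) (\<lambda>x. lift Urr (t, x) * \<phi> (t, x))"
      by (simp add: lift_def)
    have cl: "continuous_on UNIV (\<lambda>z. lift U z * (\<Sum>i\<in>UNIV. \<phi>xx i z))"
      unfolding sum_distrib_left by (intro continuous_on_sum cm)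
    have "integral (cube R) (\<lambda>x. lift U (t, x) * wave_op (t, x)) = integral (cube R) (\<lambda>x. lift U (t, x) * \<phi>tt (t, x))
        - integral (cube R) (\<lambda>x. lift U (t, x) * (\<Sum>i\<in>UNIV. \<phi>xx i (t, x)))"
      unfolding wave_op_def right_diff_distrib by (rule integral_diff[OF int[OF cm(3)] int[OF cl]])
    also have "\<dots> = integral (cube R) (\<lambda>x. lift U (t, x) * \<phi>tt (t, x)) - integral (cube R) (\<lambda>x. lift Urr (t, x) * \<phi> (t, x))"
      by (simp only: lap)
    also have "\<dots> = I' t + S t"
      unfolding I'_def S_def left_diff_distrib
      by (simp add: integral_diff[OF int[OF cm(3)] int[OF cm(13)]] integral_diff[OF int[OF cm(13)] int[OF cm(19)]])
    finally show ?thesis .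
  qed
  have "integral slab (\<lambda>z. lift U z * wave_op z) = integral {0..R} (\<lambda>t. I' t + S t)"
    using box[OF cm(6)] by (simp only: inner)
  also have "\<dots> = integral {0..R} I' + integral {0..R} S"
  proof (rule integral_add)
    show "I' integrable_on {0..R}" using hI by blast
    show "S integrable_on {0..R}" unfolding S_def
      by (intro integrable_continuous_interval continuous_on_subset[OF ci[OF cS]]) simp
  qed
  also have "\<dots> = - I 0 + integral slab (\<lambda>z. (lift Utt z - lift Urr z) * \<phi> z)"
    using integral_unique[OF hI] box[OF cS] by (simp add: S_def[abs_def])
  finally show ?thesis unfolding hI0 by (simp add: lift_def diff_divide_distrib)
qed

end

text \<open>The single function \<open>Dtt\<close> is the second derivative in both variables, which is the wave equation.\<close>

definition free_wave :: "(real \<Rightarrow> real \<Rightarrow> real) \<Rightarrow> (real \<Rightarrow> real \<Rightarrow> real) \<Rightarrow> (real \<Rightarrow> real \<Rightarrow> real) \<Rightarrow> (real \<Rightarrow> real \<Rightarrow> real) \<Rightarrow> bool" where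
  "free_wave D Dt Dr Dtt \<longleftrightarrow> cont2 D \<and> cont2 Dt \<and> cont2 Dr \<and> cont2 Dtt \<and>
    (\<forall>t r. ((\<lambda>t. D t r) has_real_derivative Dt t r) (at t)) \<and> (\<forall>t r. ((\<lambda>t. Dt t r) has_real_derivative Dtt t r) (at t)) \<and>
    (\<forall>t r. (D t has_real_derivative Dr t r) (at r)) \<and> (\<forall>t r. (Dr t has_real_derivative Dtt t r) (at r))"

section \<open>Sources that are merely continuous\<close>

text \<open>Steklov means in space: difference quotients of the primitive, with an explicit
  derivative and, by the mean value theorem, equal to a value of \<open>K s\<close> in the window.
  The window has half-width at most 1, hence the margin 1 in the compact set.\<close>

lemma smooth_approx:
  assumes K: "cont2 K" and e: "0 < e"
  shows "\<exists>L L'. cont2 L \<and> cont2 L' \<and> (\<forall>s x. (L s has_real_derivative L' s x) (at x)) \<and>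
    (\<forall>s x. 0 \<le> s \<longrightarrow> s \<le> M \<longrightarrow> \<bar>x\<bar> \<le> M \<longrightarrow> \<bar>L s x - K s x\<bar> \<le> e)"
proof -
  let ?S = "{0..M} \<times> {- M - 1..M + 1}"
  have "uniformly_continuous_on ?S (\<lambda>(s, x). K s x)"
    by (intro compact_uniformly_continuous continuous_on_subset[OF K] compact_Times) auto
  then obtain d where d: "0 < d" "\<And>z z'. z \<in> ?S \<Longrightarrow> z' \<in> ?S \<Longrightarrow> dist z' z < d \<Longrightarrow> dist (case z' of (s, x) \<Rightarrow> K s x) (case z of (s, x) \<Rightarrow> K s x) < e"
    using e unfolding uniformly_continuous_on_def by meson
  define h where "h = min 1 (d / 2)"
  have h: "0 < h" "h \<le> 1" "h < d" using d by (auto simp: h_def)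
  define L where "L s x = (sint (K s) (x + h) - sint (K s) (x - h)) / (2 * h)" for s x
  define L' where "L' s x = (K s (x + h) - K s (x - h)) / (2 * h)" for s x
  have "cont2 L" unfolding L_def case_prod_beta using h
    by (intro continuous_intros cont2_comp[OF cont2_sint[OF K]]) auto
  moreover have "cont2 L'" unfolding L'_def case_prod_beta using h
    by (intro continuous_intros cont2_comp[OF K]) auto
  moreover have "(L s has_real_derivative L' s x) (at x)" for s x
    unfolding L_def[abs_def] L'_def
    by (rule DERIV_cdivide) (auto intro!: derivative_eq_intros sint_K_chain[OF K])
  moreover have "\<bar>L s x - K s x\<bar> \<le> e" if "0 \<le> s" "s \<le> M" "\<bar>x\<bar> \<le> M" for s x
  proof -
    obtain y where y: "x - h < y" "y < x + h" "sint (K s) (x + h) - sint (K s) (x - h) = ((x + h) - (x - h)) * K s y"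
      using MVT2[of "x - h" "x + h" "sint (K s)" "K s"] sint_deriv[OF cont2_flat[OF K]] h by auto
    then have "L s x = K s y" using h by (simp add: L_def)
    moreover have "dist (case (s, y) of (s, x) \<Rightarrow> K s x) (case (s, x) of (s, x) \<Rightarrow> K s x) < e"
      by (rule d(2)) (use that y h in \<open>auto simp: dist_Pair_Pair dist_real_def\<close>)
    ultimately show ?thesis by (simp add: dist_real_def)
  qed
  ultimately show ?thesis by blast
qed

text \<open>The condition t + |r| <= M keeps the backward triangle inside the region where the
  sources are close; \<open>t\<^sup>2\<close> is a crude bound for its area.\<close>

lemma duhamel_diff_le:
  assumes K: "cont2 K" and L: "cont2 L" and t: "0 \<le> t" "t + \<bar>r\<bar> \<le> M" and e: "0 \<le> e"
    and le: "\<And>s x. \<lbrakk>0 \<le> s; s \<le> M; \<bar>x\<bar> \<le> M\<rbrakk> \<Longrightarrow> \<bar>L s x - K s x\<bar> \<le> e"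
  shows "\<bar>duhamel L t r - duhamel K t r\<bar> \<le> e * t\<^sup>2"
proof -
  define G where "G F s = sint (F s) (r + t - s) - sint (F s) (r - t + s)" for F :: "real \<Rightarrow> real \<Rightarrow> real" and s
  have cG: "continuous_on UNIV (G F)" if "cont2 F" for F
    unfolding G_def by (intro continuous_intros cont2_comp[OF cont2_sint[OF that]])
  have "\<bar>sint (\<lambda>s. G L s - G K s) t\<bar> \<le> sint (\<lambda>s. 2 * e * t) t"
  proof (rule sint_bound)
    fix s assume s: "0 \<le> s" "s \<le> t"
    have "G L s - G K s = sint (\<lambda>x. L s x - K s x) (r + t - s) - sint (\<lambda>x. L s x - K s x) (r - t + s)"
      by (simp add: G_def sint_diff cont2_flat K L)
    also have "\<bar>\<dots>\<bar> \<le> sint (\<lambda>x. e) (r + t - s) - sint (\<lambda>x. e) (r - t + s)"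
      by (rule sint_mono_diff) (use s t le in \<open>auto intro!: continuous_on_diff cont2_flat[OF K] cont2_flat[OF L]\<close>)
    also have "\<dots> = e * (2 * (t - s))" by (simp add: sint_const algebra_simps)
    also have "\<dots> \<le> e * (2 * t)" using s e by (intro mult_left_mono) auto
    finally show "\<bar>G L s - G K s\<bar> \<le> 2 * e * t" by simp
  qed (use t cG[OF K] cG[OF L] in \<open>auto intro!: continuous_on_diff\<close>)
  also have "sint (\<lambda>s. G L s - G K s) t = sint (G L) t - sint (G K) t"
    by (rule sint_diff) (use cG K L in auto)
  finally have "\<bar>sint (G L) t - sint (G K) t\<bar> \<le> 2 * (e * t\<^sup>2)" by (simp add: sint_const power2_eq_square)
  then show ?thesis by (simp add: duhamel_def G_def[abs_def] flip: diff_divide_distrib)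
qed

lemma cube_content: "0 \<le> R \<Longrightarrow> measure lborel (cube R) = (2 * R) ^ 3"
proof -
  assume "0 \<le> R"
  then have "0 \<in> cube R" by (simp add: cube_def mem_box_cart)
  then have "cube R \<noteq> {}" by blast
  then show ?thesis by (simp add: cube_def content_cbox_cart)
qed

lemma integral_abs_le:
  fixes f :: "'a::euclidean_space \<Rightarrow> real"
  assumes "continuous_on (cbox a b) f" "\<And>x. x \<in> cbox a b \<Longrightarrow> \<bar>f x\<bar> \<le> c" "0 \<le> c"
  shows "\<bar>integral (cbox a b) f\<bar> \<le> c * measure lborel (cbox a b)"
  using has_integral_bound[OF assms(3) integrable_integral[OF integrable_continuous[OF assms(1)]]] assms(2)
  by simp

lemma cube_small_integral:
  assumes "continuous_on (cube R) f" "0 \<le> r" "r \<le> R" "0 \<le> c"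
    and "\<And>x. x \<in> cube R \<Longrightarrow> \<bar>f x\<bar> \<le> c" "\<And>x. r \<le> norm x \<Longrightarrow> f x = 0"
  shows "\<bar>integral (cube R) f\<bar> \<le> c * (2 * r) ^ 3"
proof -
  have sub: "cube r \<subseteq> cube R" by (rule cube_mono) fact
  have "integral (cube R) f = integral (cube r) f"
    by (rule integral_outside[OF _ sub]) (use assms not_in_cube in auto)
  moreover have "\<bar>integral (cube r) f\<bar> \<le> c * measure lborel (cube r)"
    unfolding cube_def
    by (rule integral_abs_le) (use assms sub in \<open>auto simp: cube_def intro: continuous_on_subset\<close>)
  ultimately show ?thesis using assms(2) by (simp add: cube_content)
qed

context test_data
begin

lemma slab_abs_le:
  assumes "continuous_on slab f" "\<And>x. x \<in> slab \<Longrightarrow> \<bar>f x\<bar> \<le> c" "0 \<le> c"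
  shows "\<bar>integral slab f\<bar> \<le> c * measure lborel slab"
  using integral_abs_le[of "(0, vec (- R))" "(R, vec R)" f c] assms by (simp only: slab_cbox)

lemma slab_small_integral:
  assumes "continuous_on slab f" "0 \<le> r" "r \<le> R" "0 \<le> c"
    and "\<And>z. z \<in> slab \<Longrightarrow> \<bar>f z\<bar> \<le> c" "\<And>z. r \<le> norm (snd z) \<Longrightarrow> f z = 0"
  shows "\<bar>integral slab f\<bar> \<le> c * (R * (2 * r) ^ 3)"
proof -
  define b where "b = cbox (0 :: real, vec (- r) :: E) (R, vec r)"
  have b: "b = {0..R} \<times> cube r" by (simp add: b_def cube_def cbox_Pair_eq)
  have sub: "b \<subseteq> slab" unfolding b slab_def using cube_mono[OF assms(3)] by auto
  have "integral slab f = integral b f"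
  proof (rule integral_outside[OF _ sub])
    fix z assume "z \<notin> b" "z \<in> slab"
    then have "snd z \<notin> cube r" by (auto simp: b slab_def)
    then show "f z = 0" using assms(6) not_in_cube by blast
  qed
  moreover have "\<bar>integral b f\<bar> \<le> c * measure lborel b"
    unfolding b_def
    by (rule integral_abs_le) (use assms sub in \<open>auto simp: b_def intro: continuous_on_subset\<close>)
  moreover have "measure lborel b = R * (2 * r) ^ 3"
    unfolding b_def content_Pair using cube_content[OF assms(2)] R by (simp add: cube_def)
  ultimately show ?thesis by simp
qed

lemma slab_bounded:
  assumes "continuous_on slab f"
  obtains c :: real where "0 < c" "\<And>z. z \<in> slab \<Longrightarrow> \<bar>f z\<bar> \<le> c"
  using compact_abs_bound[OF _ assms] by (auto simp: slab_cbox)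

end

context test_data_off_axis
begin

lemma lift_cont: "cont2 F \<Longrightarrow> continuous_on UNIV \<Phi> \<Longrightarrow> (\<And>z. norm (snd z) < \<delta> \<Longrightarrow> \<Phi> z = 0)
    \<Longrightarrow> continuous_on slab (\<lambda>z. lift F z * \<Phi> z)"
  by (rule continuous_on_subset[OF continuous_on_mult_vanishing[OF cont_quot _ \<delta>]]) auto

lemma slab_lift_diff_le:
  assumes F: "cont2 F1" "cont2 F2" and \<Phi>: "continuous_on UNIV \<Phi>" "\<And>z. norm (snd z) < \<delta> \<Longrightarrow> \<Phi> z = 0"
    "\<And>z. R \<le> norm (snd z) \<Longrightarrow> \<Phi> z = 0" "\<And>z. z \<in> slab \<Longrightarrow> \<bar>\<Phi> z\<bar> \<le> c" and c: "0 \<le> c" "0 \<le> e"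
    and le: "\<And>t r. \<lbrakk>0 \<le> t; t \<le> R; 0 < r; r < R\<rbrakk> \<Longrightarrow> \<bar>F1 t r - F2 t r\<bar> \<le> e"
  shows "\<bar>integral slab (\<lambda>z. lift F1 z * \<Phi> z) - integral slab (\<lambda>z. lift F2 z * \<Phi> z)\<bar> \<le> e / \<delta> * c * measure lborel slab"
proof -
  note cF = lift_cont[OF F(1) \<Phi>(1,2)] lift_cont[OF F(2) \<Phi>(1,2)]
  have ib: "f integrable_on slab" if "continuous_on slab f" for f :: "real \<times> E \<Rightarrow> real"
    using that unfolding slab_cbox by (rule integrable_continuous)
  have "integral slab (\<lambda>z. lift F1 z * \<Phi> z) - integral slab (\<lambda>z. lift F2 z * \<Phi> z)
      = integral slab (\<lambda>z. lift F1 z * \<Phi> z - lift F2 z * \<Phi> z)"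
    by (rule integral_diff[symmetric]; intro ib cF)
  also have "\<bar>\<dots>\<bar> \<le> (e / \<delta> * c) * measure lborel slab"
  proof (rule slab_abs_le)
    fix z assume z: "z \<in> slab"
    obtain t x where tx: "z = (t, x)" by (cases z)
    have t: "0 \<le> t" "t \<le> R" using z by (auto simp: tx slab_def)
    show "\<bar>lift F1 z * \<Phi> z - lift F2 z * \<Phi> z\<bar> \<le> e / \<delta> * c"
    proof (cases "norm x < \<delta> \<or> R \<le> norm x")
      case True
      then have "\<Phi> z = 0" using \<Phi>(2,3)[of z] by (auto simp: tx)
      then show ?thesis using c \<delta> by simp
    next
      case False
      have "\<bar>F1 t (norm x) - F2 t (norm x)\<bar> \<le> e" using t False \<delta> by (intro le) auto
      then have "\<bar>F1 t (norm x) - F2 t (norm x)\<bar> / norm x \<le> e / \<delta>"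
        using False c \<delta> by (intro frac_le) auto
      then have "\<bar>F1 t (norm x) - F2 t (norm x)\<bar> / norm x * \<bar>\<Phi> z\<bar> \<le> e / \<delta> * c"
        using \<Phi>(4)[OF z] c \<delta> by (intro mult_mono) auto
      moreover have "lift F1 z * \<Phi> z - lift F2 z * \<Phi> z = (F1 t (norm x) - F2 t (norm x)) / norm x * \<Phi> z"
        by (simp add: lift_def tx diff_divide_distrib algebra_simps)
      ultimately show ?thesis by (simp add: abs_mult abs_divide)
    qed
  qed (use c \<delta> cF in \<open>auto intro!: continuous_on_diff\<close>)
  finally show ?thesis .
qed

text \<open>For mollified sources this is \<open>classical_weak\<close>. Both sides are continuous
  in \<open>K\<close> under uniform convergence on a compact set, since off the axis the division by
  the radius costs only 1/\<delta>.\<close>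

lemma mild_weak:
  assumes D: "free_wave D Dt Dr Dtt" and K: "cont2 K"
  shows "integral slab (\<lambda>z. lift (\<lambda>t r. D t r + duhamel K t r) z * wave_op z)
    = integral slab (\<lambda>z. lift K z * \<phi> z)
      + integral (cube R) (\<lambda>x. Dt 0 (norm x) / norm x * \<phi> (0, x))
      - integral (cube R) (\<lambda>x. D 0 (norm x) / norm x * \<phi>t (0, x))"
    (is "?l K = ?r K + ?b1 - ?b2")
proof -
  note D' = D[unfolded free_wave_def]
  obtain C1 where C1: "0 < C1" "\<And>z. z \<in> slab \<Longrightarrow> \<bar>wave_op z\<bar> \<le> C1"
    using slab_bounded[OF continuous_on_subset[OF wave_op_cont]] by auto
  obtain C2 where C2: "0 < C2" "\<And>z. z \<in> slab \<Longrightarrow> \<bar>\<phi> z\<bar> \<le> C2"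
    using slab_bounded[OF continuous_on_subset[OF cont(1)]] by auto
  define C where "C = (R\<^sup>2 * C1 / \<delta> + C2 / \<delta>) * measure lborel slab"
  have cD: "cont2 (\<lambda>t r. D t r + duhamel L t r)" if "cont2 L" for L
    using D' duhamel_cont[OF that] by (auto simp: case_prod_beta intro!: continuous_on_add)
  have z: "wave_op z = 0" "\<phi> z = 0" if "norm (snd z) < \<delta> \<or> R \<le> norm (snd z)" for z
    using that supp[of "fst z" "snd z"] off_axis[of "snd z" "fst z"] by (auto simp: wave_op_def)
  have small: "\<bar>?l K - (?r K + ?b1 - ?b2)\<bar> \<le> C * e" if e: "0 < e" for e
  proof -
    \<comment> \<open>Backward triangles with apex in t <= R, r < R reach radii up to 2R.\<close>
    obtain L L' where L: "cont2 L" "cont2 L'" "\<And>s x. (L s has_real_derivative L' s x) (at x)"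
      and app: "\<And>s x. 0 \<le> s \<Longrightarrow> s \<le> 2 * R \<Longrightarrow> \<bar>x\<bar> \<le> 2 * R \<Longrightarrow> \<bar>L s x - K s x\<bar> \<le> e"
      using smooth_approx[OF K e, of "2 * R"] by blast
    have sm: "?l L = ?r L + ?b1 - ?b2"
    proof -
      have c: "cont2 (\<lambda>t r. D t r + duhamel L t r)" "cont2 (\<lambda>t r. Dt t r + duhamel_t L t r)"
        "cont2 (\<lambda>t r. Dtt t r + (L t r + duhamel_r L' t r))" "cont2 (\<lambda>t r. Dtt t r + duhamel_r L' t r)"
        using D' L(1) duhamel_cont[OF L(1)] duhamel_t_cont[OF L(1)] duhamel_r_cont[OF L(2)]
        by (auto simp: case_prod_beta intro!: continuous_on_add)
      have t: "((\<lambda>t. D t r + duhamel L t r) has_real_derivative Dt t r + duhamel_t L t r) (at t)"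
        "((\<lambda>t. Dt t r + duhamel_t L t r) has_real_derivative Dtt t r + (L t r + duhamel_r L' t r)) (at t)"
        "((\<lambda>r. D t r + duhamel L t r) has_real_derivative Dr t r + duhamel_r L t r) (at r)"
        "((\<lambda>r. Dr t r + duhamel_r L t r) has_real_derivative Dtt t r + duhamel_r L' t r) (at r)" for t r
        using D' by (auto intro!: DERIV_add duhamel_deriv_t[OF L(1)] duhamel_deriv_r[OF L(1)] duhamel_t_deriv_t[OF L] duhamel_r_deriv_r[OF L])
      show ?thesis using classical_weak[OF c t] by (simp add: L(1))
    qed
    have d1: "\<bar>?l L - ?l K\<bar> \<le> (e * R\<^sup>2) / \<delta> * C1 * measure lborel slab"
    proof (rule slab_lift_diff_le[OF cD[OF L(1)] cD[OF K] wave_op_cont])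
      fix t r assume tr: "0 \<le> t" "t \<le> R" "0 < r" "r < R"
      have "\<bar>duhamel L t r - duhamel K t r\<bar> \<le> e * t\<^sup>2"
        by (rule duhamel_diff_le[OF K L(1), where M = "2 * R"]) (use tr app e in auto)
      also have "\<dots> \<le> e * R\<^sup>2" using tr e by (intro mult_left_mono power_mono) auto
      finally show "\<bar>D t r + duhamel L t r - (D t r + duhamel K t r)\<bar> \<le> e * R\<^sup>2" by simp
    qed (use z C1 e in auto)
    have d2: "\<bar>?r L - ?r K\<bar> \<le> e / \<delta> * C2 * measure lborel slab"
      by (rule slab_lift_diff_le[OF L(1) K cont(1)]) (use z C2 e app R in auto)
    have tri: "\<bar>lK - (rK + b1 - b2)\<bar> \<le> X + Y" if "\<bar>lL - lK\<bar> \<le> X" "\<bar>rL - rK\<bar> \<le> Y" "lL = rL + b1 - b2" for lK rK b1 b2 lL rL X Y :: real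
      using that by linarith
    have "\<bar>?l K - (?r K + ?b1 - ?b2)\<bar> \<le> e * R\<^sup>2 / \<delta> * C1 * measure lborel slab + e / \<delta> * C2 * measure lborel slab"
      by (rule tri[OF d1 d2 sm])
    also have "\<dots> = C * e" by (simp add: C_def algebra_simps)
    finally show ?thesis .
  qed
  have C0: "0 \<le> C" using C1 C2 \<delta> R by (simp add: C_def)
  have "\<bar>?l K - (?r K + ?b1 - ?b2)\<bar> \<le> 0"
  proof (rule field_le_epsilon)
    fix e :: real assume "0 < e"
    then have "\<bar>?l K - (?r K + ?b1 - ?b2)\<bar> \<le> C * (e / (C + 1))" using C0 by (intro small) auto
    also have "\<dots> \<le> 0 + e" using C0 \<open>0 < e\<close> by (simp add: field_simps)
    finally show "\<bar>?l K - (?r K + ?b1 - ?b2)\<bar> \<le> 0 + e" .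
  qed
  then show ?thesis by linarith
qed

end

section \<open>Removing the axis\<close>

lemma cube_pos_deriv:
  "((\<lambda>y. (max 0 y) ^ 3) has_real_derivative 3 * (max 0 y)\<^sup>2) (at (y :: real))"
  "((\<lambda>y. 3 * (max 0 y)\<^sup>2) has_real_derivative 6 * max 0 y) (at (y :: real))"
proof -
  have *: "((\<lambda>y. (max 0 y) ^ n) has_real_derivative n * (max 0 y) ^ (n - 1)) (at (y :: real))" if n: "2 \<le> n" for n :: nat
  proof -
    consider "y < 0" | "y = 0" | "0 < y" by linarith
    then show ?thesis
    proof cases
      case 1
      have "\<forall>\<^sub>F y in nhds y. y \<in> {..<0}" using 1 by (intro eventually_nhds_in_open) auto
      then have "\<forall>\<^sub>F y in nhds y. (max 0 y) ^ n = 0" by eventually_elim (use n in auto)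
      from iffD2[OF DERIV_cong_ev[OF refl this refl] DERIV_const]
      have "((\<lambda>y. (max 0 y) ^ n) has_real_derivative 0) (at y)" .
      moreover have "real n * (max 0 y) ^ (n - 1) = 0" using 1 n by auto
      ultimately show ?thesis by (simp only:)
    next
      case 3
      have "\<forall>\<^sub>F y in nhds y. y \<in> {0<..}" using 3 by (intro eventually_nhds_in_open) auto
      then have "\<forall>\<^sub>F y in nhds y. (max 0 y) ^ n = y ^ n" by eventually_elim auto
      from iffD2[OF DERIV_cong_ev[OF refl this refl] DERIV_pow] show ?thesis using 3 by (simp add: max_def)
    next
      case 2
      obtain m where m: "n = Suc (Suc m)" using n by (auto dest!: le_Suc_ex simp: numeral_2_eq_2)
      have "((\<lambda>h. (max 0 h) ^ n / h) \<longlongrightarrow> 0) (at (0::real))"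
      proof (rule Lim_null_comparison)
        have "norm ((max 0 h) ^ n / h) \<le> \<bar>h\<bar> ^ (n - 1)" for h :: real
          by (cases "h \<le> 0") (simp_all add: m mult_nonpos_nonneg)
        then show "\<forall>\<^sub>F h in at (0::real). norm ((max 0 h) ^ n / h) \<le> \<bar>h\<bar> ^ (n - 1)" by simp
        have "((\<lambda>h::real. \<bar>h\<bar> ^ (n - 1)) \<longlongrightarrow> \<bar>0\<bar> ^ (n - 1)) (at 0)" by (intro tendsto_intros)
        then show "((\<lambda>h::real. \<bar>h\<bar> ^ (n - 1)) \<longlongrightarrow> 0) (at 0)" by (simp add: m)
      qed
      then show ?thesis using 2 n by (simp add: DERIV_def m)
    qed
  qed
  from *[of 3] show "((\<lambda>y. (max 0 y) ^ 3) has_real_derivative 3 * (max 0 y)\<^sup>2) (at y)" by simp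
  from DERIV_cmult[OF *[of 2], of 3] show "((\<lambda>y. 3 * (max 0 y)\<^sup>2) has_real_derivative 6 * max 0 y) (at y)" by simp
qed

text \<open>Two copies of max(0, y)^3 are composed, which keeps two continuous derivatives. The
  thresholds 1 and 4 are the squares of 1 and 2, as the cutoff is evaluated at
  |x|^2/\<delta>^2.\<close>

lemma cutoff_exists:
  obtains s s1 s2 :: "real \<Rightarrow> real" and B :: real
  where "\<And>y. (s has_real_derivative s1 y) (at y)" "\<And>y. (s1 has_real_derivative s2 y) (at y)"
    "continuous_on UNIV s2" "\<And>y. y < 1 \<Longrightarrow> s y = 0 \<and> s1 y = 0 \<and> s2 y = 0"
    "\<And>y. 4 \<le> y \<Longrightarrow> s y = 1 \<and> s1 y = 0 \<and> s2 y = 0"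
    "1 \<le> B" "\<And>y. \<bar>1 - s y\<bar> \<le> B" "\<And>y. \<bar>s1 y\<bar> \<le> B" "\<And>y. \<bar>s2 y\<bar> \<le> B"
proof -
  define m m1 m2 :: "real \<Rightarrow> real" where "m y = (max 0 y) ^ 3" and "m1 y = 3 * (max 0 y)\<^sup>2" and "m2 y = 6 * max 0 y" for y
  have m: "(m has_real_derivative m1 y) (at y)" "(m1 has_real_derivative m2 y) (at y)" for y
    unfolding m_def[abs_def] m1_def[abs_def] m2_def by (rule cube_pos_deriv)+
  define s where "s y = 1 - m (1 - m (y - 1))" for y
  define s1 where "s1 y = m1 (1 - m (y - 1)) * m1 (y - 1)" for y
  define s2 where "s2 y = m1 (1 - m (y - 1)) * m2 (y - 1) - m2 (1 - m (y - 1)) * (m1 (y - 1))\<^sup>2" for y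
  have ch: "((\<lambda>y. f (y - 1)) has_real_derivative f') (at y)" if "(f has_real_derivative f') (at (y - 1))" for f f' and y :: real
    using that DERIV_shift[of f f' y "-1"] by simp
  have ch1: "((\<lambda>y. 1 - m (y - 1)) has_real_derivative - m1 (y - 1)) (at y)" for y
    by (rule DERIV_cong[OF DERIV_diff[OF DERIV_const ch[OF m(1)]]]) simp
  have ds: "(s has_real_derivative s1 y) (at y)" for y
    unfolding s_def[abs_def] s1_def
    by (rule DERIV_cong[OF DERIV_diff[OF DERIV_const DERIV_chain2[OF m(1) ch1]]]) simp
  have ds1: "(s1 has_real_derivative s2 y) (at y)" for y
    unfolding s1_def[abs_def] s2_def
    by (rule DERIV_cong[OF DERIV_mult[OF DERIV_chain2[OF m(2) ch1] ch[OF m(2)]]]) (simp add: power2_eq_square algebra_simps)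
  have c2: "continuous_on UNIV s2"
    unfolding s2_def[abs_def] m_def m1_def m2_def by (intro continuous_intros)
  have c: "continuous_on UNIV s" "continuous_on UNIV s1"
    by (rule deriv_continuous_on, rule ds ds1)+
  have lo: "s y = 0 \<and> s1 y = 0 \<and> s2 y = 0" if "y < 1" for y
    using that by (simp add: s_def s1_def s2_def m_def m1_def m2_def)
  have hi: "s y = 1 \<and> s1 y = 0 \<and> s2 y = 0" if "4 \<le> y" for y
  proof -
    have "1 \<le> (y - 1) ^ 3" using that by (intro one_le_power) auto
    then have "1 - m (y - 1) \<le> 0" using that by (simp add: m_def max_def)
    then show ?thesis by (simp add: s_def s1_def s2_def m_def[of "1 - m (y - 1)"] m1_def[of "1 - m (y - 1)"] m2_def[of "1 - m (y - 1)"] max_def)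
  qed
  have bd: "\<exists>B. \<forall>y\<in>{1..4}. \<bar>f y\<bar> \<le> B" if "continuous_on UNIV f" for f :: "real \<Rightarrow> real"
    using compact_abs_bound[of "{1..4}" f] continuous_on_subset[OF that] by auto
  obtain B0 B1 B2 where B: "\<forall>y\<in>{1..4}. \<bar>1 - s y\<bar> \<le> B0" "\<forall>y\<in>{1..4}. \<bar>s1 y\<bar> \<le> B1" "\<forall>y\<in>{1..4}. \<bar>s2 y\<bar> \<le> B2"
    using bd[OF continuous_on_diff[OF continuous_on_const c(1)]] bd[OF c(2)] bd[OF c2] by blast
  define B where "B = max 1 (max B0 (max B1 B2))"
  have "\<bar>1 - s y\<bar> \<le> B \<and> \<bar>s1 y\<bar> \<le> B \<and> \<bar>s2 y\<bar> \<le> B" for y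
  proof (cases "y \<in> {1..4}")
    case True
    then show ?thesis using B by (fastforce simp: B_def le_max_iff_disj)
  next
    case False
    then show ?thesis using lo[of y] hi[of y] by (auto simp: B_def)
  qed
  moreover have "1 \<le> B" by (simp add: B_def)
  ultimately show ?thesis using that[OF ds ds1 c2 lo hi] by blast
qed

context test_data
begin

lemma axis_removal:
  fixes u F :: "real \<times> E \<Rightarrow> real" and u0 u1 :: "E \<Rightarrow> real"
  assumes D: "free_wave D Dt Dr Dtt" and K: "cont2 K"
    and cu: "continuous_on ({0..} \<times> UNIV) u" and cF: "continuous_on ({0..} \<times> UNIV) F"
    and c0: "continuous_on UNIV u0" and c1: "continuous_on UNIV u1"
    and u: "\<And>t x. \<lbrakk>0 \<le> t; x \<noteq> 0\<rbrakk> \<Longrightarrow> u (t, x) = (D t (norm x) + duhamel K t (norm x)) / norm x"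
    and F: "\<And>t x. \<lbrakk>0 \<le> t; x \<noteq> 0\<rbrakk> \<Longrightarrow> F (t, x) = K t (norm x) / norm x"
    and u0: "\<And>x. x \<noteq> 0 \<Longrightarrow> u0 x = D 0 (norm x) / norm x"
    and u1: "\<And>x. x \<noteq> 0 \<Longrightarrow> u1 x = Dt 0 (norm x) / norm x"
  shows "integral slab (\<lambda>z. u z * wave_op z) = integral slab (\<lambda>z. F z * \<phi> z)
    + integral (cube R) (\<lambda>x. u1 x * \<phi> (0, x)) - integral (cube R) (\<lambda>x. u0 x * \<phi>t (0, x))"
    (is "?L = ?R1 + ?R2 - ?R3")
proof -
  obtain s s1 s2 B where s: "\<And>y. (s has_real_derivative s1 y) (at y)" "\<And>y. (s1 has_real_derivative s2 y) (at y)"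
    "continuous_on UNIV s2" "\<And>y. y < 1 \<Longrightarrow> s y = 0 \<and> s1 y = 0 \<and> s2 y = 0"
    "\<And>y. 4 \<le> y \<Longrightarrow> s y = 1 \<and> s1 y = 0 \<and> s2 y = 0"
    "1 \<le> B" "\<And>y. \<bar>1 - s y\<bar> \<le> B" "\<And>y. \<bar>s1 y\<bar> \<le> B" "\<And>y. \<bar>s2 y\<bar> \<le> B"
    using cutoff_exists by blast
  have sc: "continuous_on UNIV s" "continuous_on UNIV s1"
    by (rule deriv_continuous_on, rule s)+
  have box: "slab \<subseteq> {0..} \<times> UNIV" by (auto simp: slab_def)
  have cu': "continuous_on slab u" and cF': "continuous_on slab F"
    using continuous_on_subset[OF cu box] continuous_on_subset[OF cF box] .
  have sub: "continuous_on slab f" if "continuous_on UNIV f" for f :: "real \<times> E \<Rightarrow> real"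
    by (rule continuous_on_subset[OF that]) simp
  define S where "S z = (\<Sum>i\<in>UNIV. \<bar>\<phi>x i z\<bar>)" for z
  have "continuous_on UNIV S" unfolding S_def by (intro continuous_intros cont)
  then have cS: "continuous_on slab S" by (rule sub)
  obtain cu where bu: "0 < cu" "\<And>z. z \<in> slab \<Longrightarrow> \<bar>u z\<bar> \<le> cu" by (rule slab_bounded[OF cu']) blast
  obtain cF where bF: "0 < cF" "\<And>z. z \<in> slab \<Longrightarrow> \<bar>F z\<bar> \<le> cF" by (rule slab_bounded[OF cF']) blast
  obtain cp where bp: "0 < cp" "\<And>z. z \<in> slab \<Longrightarrow> \<bar>\<phi> z\<bar> \<le> cp" by (rule slab_bounded[OF sub[OF cont(1)]]) blast
  obtain cd where bd: "0 < cd" "\<And>z. z \<in> slab \<Longrightarrow> \<bar>wave_op z\<bar> \<le> cd" by (rule slab_bounded[OF sub[OF wave_op_cont]]) blast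
  obtain cx where bx: "0 < cx" "\<And>z. z \<in> slab \<Longrightarrow> \<bar>S z\<bar> \<le> cx" by (rule slab_bounded[OF cS]) blast
  note bd = bu bF bp bd bx
  have bds: "\<exists>c>0. \<forall>x\<in>cube R. \<bar>f x\<bar> \<le> c" if "continuous_on UNIV f" for f :: "E \<Rightarrow> real"
    unfolding cube_def by (rule compact_abs_bound[OF compact_cbox continuous_on_subset[OF that]]) simp
  have slice: "continuous_on UNIV (\<lambda>x. f (0, x))" if "continuous_on UNIV f" for f :: "real \<times> E \<Rightarrow> real"
    by (rule continuous_on_compose2[OF that]) (auto intro!: continuous_intros)
  have c0': "continuous_on UNIV (\<lambda>x. u0 x * \<phi>t (0, x))" and c1': "continuous_on UNIV (\<lambda>x. u1 x * \<phi> (0, x))"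
    by (intro continuous_intros c0 c1 slice cont)+
  obtain e0 e1 where e: "0 < e0" "\<And>x. x \<in> cube R \<Longrightarrow> \<bar>u0 x * \<phi>t (0, x)\<bar> \<le> e0" "0 < e1" "\<And>x. x \<in> cube R \<Longrightarrow> \<bar>u1 x * \<phi> (0, x)\<bar> \<le> e1"
    using bds[OF c0'] bds[OF c1'] by blast
  \<comment> \<open>The number 64 comes from (4\<delta>)^3, the volume of the cube of half-side
    2\<delta>, and \<open>R\<close> is the length of the time interval. Only the first group of
    terms has a factor \<delta>^(-2) to absorb.\<close>
  define C where "C = cu * (B * cd + 60 * B * cp + 8 * B * cx) * (R * 64) + (B * cF * cp) * (R * 64) + B * e1 * 64 + B * e0 * 64"
  have C0: "0 \<le> C" using bd e s(6) R by (simp add: C_def)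
  have main: "\<bar>?L - (?R1 + ?R2 - ?R3)\<bar> \<le> C * \<delta>" if \<delta>: "0 < \<delta>" "\<delta> \<le> 1" "2 * \<delta> \<le> R" for \<delta>
  proof -
    \<comment> \<open>Unlike the norm, its square is a polynomial, so the derivatives of the cutoff
      have one formula for all \<open>x\<close>.\<close>
    define Y where "Y x = (norm x)\<^sup>2 / \<delta>\<^sup>2" for x :: E
    have Yc: "continuous_on A (\<lambda>z. Y (f z))" if "continuous_on A f" for A and f :: "'b::topological_space \<Rightarrow> E"
      unfolding Y_def by (intro continuous_intros that) (use \<delta> in auto)
    have Yd: "((\<lambda>h. Y (x + h *\<^sub>R axis i 1)) has_real_derivative 2 * x $ i / \<delta>\<^sup>2) (at 0)" for x i
    proof -
      have e: "(norm (x + h *\<^sub>R axis i 1))\<^sup>2 = x \<bullet> x + 2 * h * x $ i + h * h" for h :: real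
        unfolding power2_norm_eq_inner
        by (simp add: inner_add_left inner_add_right inner_axis inner_axis' algebra_simps)
      show ?thesis unfolding Y_def e by (intro DERIV_cdivide) (auto intro!: derivative_eq_intros)
    qed
    have xid: "((\<lambda>h. 2 * (x + h *\<^sub>R axis i 1) $ i / \<delta>\<^sup>2) has_real_derivative 2 / \<delta>\<^sup>2) (at 0)" for x :: E and i
      by (intro DERIV_cdivide) (auto intro!: derivative_eq_intros simp: axis_def)
    have chd: "((\<lambda>h. f (Y (x + h *\<^sub>R axis i 1))) has_real_derivative f' (Y x) * (2 * x $ i / \<delta>\<^sup>2)) (at 0)"
      if "\<And>y. (f has_real_derivative f' y) (at y)" for f f' x i
      by (rule DERIV_chain2[OF _ Yd]) (use that in simp)
    have far: "4 \<le> Y x" if "2 * \<delta> \<le> norm x" for x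
    proof -
      have "(2 * \<delta>)\<^sup>2 \<le> (norm x)\<^sup>2" using that \<delta> by (intro power_mono) auto
      then show ?thesis using \<delta> by (simp add: Y_def field_simps)
    qed
    have near: "Y x < 1" if "norm x < \<delta>" for x
      using that \<delta> power_strict_mono[of "norm x" \<delta> 2] by (simp add: Y_def)
    define c where "c z = s (Y (snd z))" for z :: "real \<times> E"
    define ci where "ci i z = s1 (Y (snd z)) * (2 * snd z $ i / \<delta>\<^sup>2)" for i and z :: "real \<times> E"
    define cii where "cii i z = s2 (Y (snd z)) * (2 * snd z $ i / \<delta>\<^sup>2)\<^sup>2 + s1 (Y (snd z)) * (2 / \<delta>\<^sup>2)" for i and z :: "real \<times> E"
    have cc: "continuous_on UNIV c" "continuous_on UNIV (ci i)" "continuous_on UNIV (cii i)" for i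
      unfolding c_def[abs_def] ci_def[abs_def] cii_def[abs_def] using \<delta>
      by (auto intro!: continuous_intros continuous_on_compose2[OF sc(1)] continuous_on_compose2[OF sc(2)] continuous_on_compose2[OF s(3)] Yc)
    have cd1: "((\<lambda>h. c (t, x + h *\<^sub>R axis i 1)) has_real_derivative ci i (t, x)) (at 0)" for t x i
      unfolding c_def ci_def by (simp only: snd_conv) (rule chd[OF s(1)])
    have cd2: "((\<lambda>h. ci i (t, x + h *\<^sub>R axis i 1)) has_real_derivative cii i (t, x)) (at 0)" for t x i
      unfolding ci_def cii_def snd_conv
      by (rule DERIV_cong[OF DERIV_mult[OF chd[OF s(2)] xid]]) (simp add: power2_eq_square mult_ac)
    define px where "px i z = ci i z * \<phi> z + c z * \<phi>x i z" for i z
    define pxx where "pxx i z = cii i z * \<phi> z + 2 * ci i z * \<phi>x i z + c z * \<phi>xx i z" for i z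
    \<comment> \<open>The cutoff does not depend on time, so the time derivatives are merely
      multiplied by it.\<close>
    interpret o: test_data_off_axis "\<lambda>z. c z * \<phi> z" "\<lambda>z. c z * \<phi>t z" "\<lambda>z. c z * \<phi>tt z" px pxx R \<delta>
    proof
      fix t x i
      show "((\<lambda>t. c (t, x) * \<phi> (t, x)) has_real_derivative c (t, x) * \<phi>t (t, x)) (at t)"
        "((\<lambda>t. c (t, x) * \<phi>t (t, x)) has_real_derivative c (t, x) * \<phi>tt (t, x)) (at t)"
        unfolding c_def snd_conv by (intro DERIV_cmult dt dtt)+
      show "((\<lambda>s. c (t, x + s *\<^sub>R axis i 1) * \<phi> (t, x + s *\<^sub>R axis i 1)) has_real_derivative px i (t, x)) (at 0)"
        unfolding px_def by (rule DERIV_cong[OF DERIV_mult[OF cd1 dx]]) simp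
      show "((\<lambda>s. px i (t, x + s *\<^sub>R axis i 1)) has_real_derivative pxx i (t, x)) (at 0)"
        unfolding px_def pxx_def
        by (rule DERIV_cong[OF DERIV_add[OF DERIV_mult[OF cd2 dx] DERIV_mult[OF cd1 dxx]]]) (simp add: algebra_simps)
      assume "norm x < \<delta>"
      then show "c (t, x) * \<phi> (t, x) = 0 \<and> c (t, x) * \<phi>t (t, x) = 0 \<and> c (t, x) * \<phi>tt (t, x) = 0 \<and> px i (t, x) = 0 \<and> pxx i (t, x) = 0"
        using s(4)[OF near] by (simp add: c_def ci_def cii_def px_def pxx_def)
    qed (use R \<delta> supp in \<open>auto simp: px_def[abs_def] pxx_def[abs_def] intro!: continuous_intros cc cont\<close>)
    \<comment> \<open>The commutator of the Laplacian with the cutoff, the only place where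
      derivatives of the cutoff occur.\<close>
    define Q where "Q z = (\<Sum>i\<in>UNIV. cii i z * \<phi> z + 2 * ci i z * \<phi>x i z)" for z
    have owave_op: "o.wave_op z = c z * wave_op z - Q z" for z
      unfolding o.wave_op_def wave_op_def pxx_def Q_def by (simp add: sum.distrib sum_distrib_left algebra_simps)
    have Qc: "continuous_on UNIV Q" unfolding Q_def[abs_def] by (intro continuous_intros cc cont)
    have oz: "c (t, 0) = 0" "o.wave_op (t, 0) = 0" for t
    proof -
      show "c (t, 0) = 0" using s(4)[OF near[of 0]] \<delta> by (simp add: c_def)
      show "o.wave_op (t, 0) = 0" unfolding o.wave_op_def using o.off_axis[of 0 t] \<delta> by simp
    qed
    have 1: "integral slab (\<lambda>z. u z * o.wave_op z) = integral slab (\<lambda>z. F z * (c z * \<phi> z))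
      + integral (cube R) (\<lambda>x. u1 x * (c (0, x) * \<phi> (0, x))) - integral (cube R) (\<lambda>x. u0 x * (c (0, x) * \<phi>t (0, x)))"
    proof -
      have a: "integral slab (\<lambda>z. u z * o.wave_op z) = integral slab (\<lambda>z. lift (\<lambda>t r. D t r + duhamel K t r) z * o.wave_op z)"
      proof (rule integral_cong)
        fix z assume "z \<in> slab"
        then show "u z * o.wave_op z = lift (\<lambda>t r. D t r + duhamel K t r) z * o.wave_op z"
          using u[of "fst z" "snd z"] oz(2)[of "fst z"] by (cases z; cases "snd z = 0") (auto simp: slab_def lift_def)
      qed
      have b: "integral slab (\<lambda>z. F z * (c z * \<phi> z)) = integral slab (\<lambda>z. lift K z * (c z * \<phi> z))"
      proof (rule integral_cong)
        fix z assume "z \<in> slab"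
        then show "F z * (c z * \<phi> z) = lift K z * (c z * \<phi> z)"
          using F[of "fst z" "snd z"] oz(1)[of "fst z"] by (cases z; cases "snd z = 0") (auto simp: slab_def lift_def)
      qed
      have d: "integral (cube R) (\<lambda>x. u1 x * (c (0, x) * \<phi> (0, x))) = integral (cube R) (\<lambda>x. Dt 0 (norm x) / norm x * (c (0, x) * \<phi> (0, x)))"
        by (rule integral_cong) (metis mult_zero_left mult_zero_right oz(1) u1)
      have e: "integral (cube R) (\<lambda>x. u0 x * (c (0, x) * \<phi>t (0, x))) = integral (cube R) (\<lambda>x. D 0 (norm x) / norm x * (c (0, x) * \<phi>t (0, x)))"
        by (rule integral_cong) (metis mult_zero_left mult_zero_right oz(1) u0)
      show ?thesis unfolding a b d e by (rule o.mild_weak[OF D K])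
    qed
    have ib: "f integrable_on slab" if "continuous_on slab f" for f :: "real \<times> E \<Rightarrow> real"
      using that unfolding slab_cbox by (rule integrable_continuous)
    have ic: "f integrable_on cube R" if "continuous_on UNIV f" for f :: "E \<Rightarrow> real"
      unfolding cube_def by (rule integrable_continuous) (rule continuous_on_subset[OF that], simp)
    have one: "1 \<le> 1 / \<delta>\<^sup>2" using \<delta> by (simp add: power_le_one)
    have hiz: "c z = 1" "ci i z = 0" "cii i z = 0" if "2 * \<delta> \<le> norm (snd z)" for z i
      using s(5)[OF far[OF that]] by (simp_all add: c_def ci_def cii_def)
    have cb: "\<bar>1 - c z\<bar> \<le> B" for z by (simp add: c_def s)
    have cxb: "\<bar>2 * snd z $ i / \<delta>\<^sup>2\<bar> \<le> 4 / \<delta>" if "norm (snd z) < 2 * \<delta>" for z :: "real \<times> E" and i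
    proof -
      have "\<bar>snd z $ i\<bar> \<le> 2 * \<delta>" using that component_le_norm_cart[of "snd z" i] by linarith
      then show ?thesis using \<delta> by (simp add: abs_mult field_simps power2_eq_square)
    qed
    have cib: "\<bar>ci i z\<bar> \<le> 4 * B / \<delta>\<^sup>2" for i z
    proof (cases "norm (snd z) < 2 * \<delta>")
      case True
      have "\<bar>ci i z\<bar> \<le> B * (4 / \<delta>)" unfolding ci_def abs_mult[of "s1 _"]
        using s(6,8) cxb[OF True] by (intro mult_mono) auto
      also have "\<dots> \<le> 4 * B / \<delta>\<^sup>2" using \<delta> s(6) by (simp add: field_simps power2_eq_square)
      finally show ?thesis .
    next
      case False
      then show ?thesis using hiz(2)[of z i] s(6) by simp
    qed
    \<comment> \<open>The constant is 18 = 4^2 + 2, from the two terms of the chain rule and |2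
      x_i/\<delta>^2| <= 4/\<delta> on the support of the derivatives.\<close>
    have ciib: "\<bar>cii i z\<bar> \<le> 18 * B / \<delta>\<^sup>2" for i z
    proof (cases "norm (snd z) < 2 * \<delta>")
      case True
      have "(2 * snd z $ i / \<delta>\<^sup>2)\<^sup>2 \<le> (4 / \<delta>)\<^sup>2"
        using power_mono[OF cxb[OF True, of i] abs_ge_zero, of 2] unfolding power2_abs .
      then have "\<bar>s2 (Y (snd z)) * (2 * snd z $ i / \<delta>\<^sup>2)\<^sup>2\<bar> \<le> B * (4 / \<delta>)\<^sup>2"
        unfolding abs_mult using s(6,9) by (intro mult_mono) auto
      moreover have "\<bar>s1 (Y (snd z)) * (2 / \<delta>\<^sup>2)\<bar> \<le> B * (2 / \<delta>\<^sup>2)"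
        unfolding abs_mult using s(6,8) by (intro mult_mono) auto
      ultimately have "\<bar>cii i z\<bar> \<le> B * (4 / \<delta>)\<^sup>2 + B * (2 / \<delta>\<^sup>2)" unfolding cii_def by linarith
      also have "\<dots> = 18 * B / \<delta>\<^sup>2" by (simp add: power_divide add_divide_distrib[symmetric])
      finally show ?thesis .
    next
      case False
      then show ?thesis using hiz(3)[of z i] s(6) by simp
    qed
    have Qb: "\<bar>Q z\<bar> \<le> (60 * B * cp + 8 * B * cx) / \<delta>\<^sup>2" if z: "z \<in> slab" for z
    proof -
      have "\<bar>Q z\<bar> \<le> (\<Sum>i\<in>UNIV. \<bar>cii i z * \<phi> z + 2 * ci i z * \<phi>x i z\<bar>)" unfolding Q_def by (rule sum_abs)
      also have "\<dots> \<le> (\<Sum>i\<in>(UNIV::3 set). 18 * B / \<delta>\<^sup>2 * cp + 8 * B / \<delta>\<^sup>2 * \<bar>\<phi>x i z\<bar>)"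
      proof (rule sum_mono)
        fix i :: 3
        have "\<bar>cii i z * \<phi> z\<bar> \<le> 18 * B / \<delta>\<^sup>2 * cp"
          unfolding abs_mult using ciib bd(6)[OF z] s(6) by (intro mult_mono) auto
        moreover have "2 * \<bar>ci i z\<bar> * \<bar>\<phi>x i z\<bar> \<le> 2 * (4 * B / \<delta>\<^sup>2) * \<bar>\<phi>x i z\<bar>"
          by (intro mult_right_mono mult_left_mono cib) auto
        then have "\<bar>2 * ci i z * \<phi>x i z\<bar> \<le> 8 * B / \<delta>\<^sup>2 * \<bar>\<phi>x i z\<bar>" by (simp add: abs_mult)
        ultimately show "\<bar>cii i z * \<phi> z + 2 * ci i z * \<phi>x i z\<bar> \<le> 18 * B / \<delta>\<^sup>2 * cp + 8 * B / \<delta>\<^sup>2 * \<bar>\<phi>x i z\<bar>" by linarith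
      qed
      also have "\<dots> = 54 * B / \<delta>\<^sup>2 * cp + 8 * B / \<delta>\<^sup>2 * S z"
        by (simp add: S_def sum.distrib sum_distrib_left)
      also have "\<dots> \<le> 60 * B / \<delta>\<^sup>2 * cp + 8 * B / \<delta>\<^sup>2 * cx"
        using bd(10)[OF z] bd(5) s(6) by (intro add_mono mult_right_mono mult_left_mono divide_right_mono) auto
      finally show ?thesis by (simp add: add_divide_distrib)
    qed
    have d1: "\<bar>?L - integral slab (\<lambda>z. u z * o.wave_op z)\<bar> \<le> cu * (B * cd + 60 * B * cp + 8 * B * cx) / \<delta>\<^sup>2 * (R * (2 * (2 * \<delta>)) ^ 3)"
    proof -
      have i: "continuous_on slab (\<lambda>z. u z * wave_op z)" "continuous_on slab (\<lambda>z. u z * o.wave_op z)"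
        by (intro continuous_intros cu' sub wave_op_cont o.wave_op_cont)+
      have "?L - integral slab (\<lambda>z. u z * o.wave_op z) = integral slab (\<lambda>z. u z * wave_op z - u z * o.wave_op z)"
        by (rule integral_diff[OF ib[OF i(1)] ib[OF i(2)], symmetric])
      also have "\<bar>\<dots>\<bar> \<le> cu * (B * cd + 60 * B * cp + 8 * B * cx) / \<delta>\<^sup>2 * (R * (2 * (2 * \<delta>)) ^ 3)"
      proof (rule slab_small_integral)
        fix z assume z: "z \<in> slab"
        have "\<bar>(1 - c z) * wave_op z\<bar> \<le> B * cd"
          unfolding abs_mult using cb bd(8)[OF z] s(6) by (intro mult_mono) auto
        also have "\<dots> \<le> B * cd / \<delta>\<^sup>2" using mult_left_mono[OF one, of "B * cd"] s(6) bd by simp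
        finally have le: "\<bar>(1 - c z) * wave_op z + Q z\<bar> \<le> B * cd / \<delta>\<^sup>2 + (60 * B * cp + 8 * B * cx) / \<delta>\<^sup>2"
          using Qb[OF z] by linarith
        have eq: "u z * wave_op z - u z * o.wave_op z = u z * ((1 - c z) * wave_op z + Q z)"
          unfolding owave_op by (simp add: algebra_simps)
        from le have "\<bar>u z\<bar> * \<bar>(1 - c z) * wave_op z + Q z\<bar> \<le> cu * (B * cd / \<delta>\<^sup>2 + (60 * B * cp + 8 * B * cx) / \<delta>\<^sup>2)"
          using bd(1) bd(2)[OF z] by (intro mult_mono) auto
        then show "\<bar>u z * wave_op z - u z * o.wave_op z\<bar> \<le> cu * (B * cd + 60 * B * cp + 8 * B * cx) / \<delta>\<^sup>2"
          unfolding eq abs_mult[of "u z"] by (simp add: algebra_simps add_divide_distrib)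
      next
        fix z :: "real \<times> E" assume "2 * \<delta> \<le> norm (snd z)"
        then show "u z * wave_op z - u z * o.wave_op z = 0"
          using hiz[of z] by (simp add: owave_op Q_def)
      qed (use \<delta> bd s(6) i in \<open>auto intro!: continuous_on_diff\<close>)
      finally show ?thesis .
    qed
    have d2: "\<bar>?R1 - integral slab (\<lambda>z. F z * (c z * \<phi> z))\<bar> \<le> B * cF * cp * (R * (2 * (2 * \<delta>)) ^ 3)"
    proof -
      have i: "continuous_on slab (\<lambda>z. F z * \<phi> z)" "continuous_on slab (\<lambda>z. F z * (c z * \<phi> z))"
        by (intro continuous_intros cF' sub cont cc)+
      have "?R1 - integral slab (\<lambda>z. F z * (c z * \<phi> z)) = integral slab (\<lambda>z. F z * \<phi> z - F z * (c z * \<phi> z))"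
        by (rule integral_diff[OF ib[OF i(1)] ib[OF i(2)], symmetric])
      also have "\<bar>\<dots>\<bar> \<le> B * cF * cp * (R * (2 * (2 * \<delta>)) ^ 3)"
      proof (rule slab_small_integral)
        fix z assume z: "z \<in> slab"
        have "\<bar>1 - c z\<bar> * \<bar>F z\<bar> * \<bar>\<phi> z\<bar> \<le> B * cF * cp"
          using cb bd(4)[OF z] bd(6)[OF z] s(6) bd by (intro mult_mono) auto
        then show "\<bar>F z * \<phi> z - F z * (c z * \<phi> z)\<bar> \<le> B * cF * cp"
          by (simp add: abs_mult[symmetric] algebra_simps)
      next
        fix z :: "real \<times> E" assume "2 * \<delta> \<le> norm (snd z)"
        then show "F z * \<phi> z - F z * (c z * \<phi> z) = 0"
          using hiz[of z] by simp
      qed (use \<delta> bd s(6) i in \<open>auto intro!: continuous_on_diff\<close>)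
      finally show ?thesis .
    qed
    have d3: "\<bar>integral (cube R) (\<lambda>x. w x) - integral (cube R) (\<lambda>x. c (0, x) * w x)\<bar> \<le> B * ee * (2 * (2 * \<delta>)) ^ 3"
      if w: "continuous_on UNIV w" "\<And>x. x \<in> cube R \<Longrightarrow> \<bar>w x\<bar> \<le> ee" "0 < ee" for w :: "E \<Rightarrow> real" and ee
    proof -
      have i: "continuous_on UNIV (\<lambda>x. c (0, x) * w x)" by (intro continuous_intros w slice cc)
      have "integral (cube R) (\<lambda>x. w x) - integral (cube R) (\<lambda>x. c (0, x) * w x) = integral (cube R) (\<lambda>x. w x - c (0, x) * w x)"
        by (rule integral_diff[OF ic[OF w(1)] ic[OF i], symmetric])
      also have "\<bar>\<dots>\<bar> \<le> B * ee * (2 * (2 * \<delta>)) ^ 3"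
      proof (rule cube_small_integral)
        show "continuous_on (cube R) (\<lambda>x. w x - c (0, x) * w x)"
          by (rule continuous_on_subset[OF continuous_on_diff[OF w(1) i]]) simp
        fix x assume x: "x \<in> cube R"
        have "\<bar>1 - c (0, x)\<bar> * \<bar>w x\<bar> \<le> B * ee"
          using cb w(2)[OF x] s(6) by (intro mult_mono) auto
        then show "\<bar>w x - c (0, x) * w x\<bar> \<le> B * ee" by (simp add: abs_mult[symmetric] algebra_simps)
      next
        fix x :: E assume "2 * \<delta> \<le> norm x"
        then show "w x - c (0, x) * w x = 0" using hiz(1)[of "(0, x)"] by simp
      qed (use \<delta> s(6) w in auto)
      finally show ?thesis .
    qed
    have d31: "\<bar>?R2 - integral (cube R) (\<lambda>x. u1 x * (c (0, x) * \<phi> (0, x)))\<bar> \<le> B * e1 * (2 * (2 * \<delta>)) ^ 3"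
      using d3[OF c1' e(4) e(3)] by (simp add: mult.left_commute)
    have d32: "\<bar>?R3 - integral (cube R) (\<lambda>x. u0 x * (c (0, x) * \<phi>t (0, x)))\<bar> \<le> B * e0 * (2 * (2 * \<delta>)) ^ 3"
      using d3[OF c0' e(2) e(1)] by (simp add: mult.left_commute)
    have tri: "\<bar>l - (a + b - d)\<bar> \<le> X + Y + Z + W" if "\<bar>l - l'\<bar> \<le> X" "\<bar>a - a'\<bar> \<le> Y" "\<bar>b - b'\<bar> \<le> Z" "\<bar>d - d'\<bar> \<le> W" "l' = a' + b' - d'"
      for l l' a a' b b' d d' X Y Z W :: real using that by linarith
    have "\<bar>?L - (?R1 + ?R2 - ?R3)\<bar> \<le> cu * (B * cd + 60 * B * cp + 8 * B * cx) / \<delta>\<^sup>2 * (R * (2 * (2 * \<delta>)) ^ 3)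
       + B * cF * cp * (R * (2 * (2 * \<delta>)) ^ 3) + B * e1 * (2 * (2 * \<delta>)) ^ 3 + B * e0 * (2 * (2 * \<delta>)) ^ 3"
      by (rule tri[OF d1 d2 d31 d32 1])
    also have "\<dots> \<le> C * \<delta>"
    proof -
      have p: "(2 * (2 * \<delta>)) ^ 3 = 64 * \<delta> ^ 3" by (simp add: power_mult_distrib)
      have p3: "\<delta> ^ 3 \<le> \<delta>" using \<delta> power_decreasing[of 1 3 \<delta>] by simp
      have a: "X / \<delta>\<^sup>2 * (R * (64 * \<delta> ^ 3)) = X * (R * 64) * \<delta>" for X
        using \<delta> by (simp add: field_simps power2_eq_square power3_eq_cube)
      have b: "X * (R * (64 * \<delta> ^ 3)) \<le> X * (R * 64) * \<delta>" if "0 \<le> X" for X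
        using p3 R mult_left_mono[OF p3, of "X * (R * 64)"] that by (simp add: mult_ac)
      have d: "X * (64 * \<delta> ^ 3) \<le> X * 64 * \<delta>" if "0 \<le> X" for X
        using mult_left_mono[OF p3, of "X * 64"] that by (simp add: mult_ac)
      show ?thesis unfolding p a C_def distrib_right
        by (intro add_mono b d order_refl) (use bd e s(6) in auto)
    qed
    finally show ?thesis .
  qed
  have "\<bar>?L - (?R1 + ?R2 - ?R3)\<bar> \<le> 0"
  proof (rule field_le_epsilon)
    fix e :: real assume e: "0 < e"
    define \<delta> where "\<delta> = min (e / (C + 1)) (min 1 (R / 2))"
    have \<delta>: "0 < \<delta>" "\<delta> \<le> 1" "2 * \<delta> \<le> R" "\<delta> \<le> e / (C + 1)" using e C0 R by (auto simp: \<delta>_def)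
    have "\<bar>?L - (?R1 + ?R2 - ?R3)\<bar> \<le> C * \<delta>" using \<delta> by (intro main)
    also have "\<dots> \<le> C * (e / (C + 1))" using C0 \<delta> by (intro mult_left_mono)
    also have "\<dots> \<le> 0 + e" using C0 e by (simp add: field_simps)
    finally show "\<bar>?L - (?R1 + ?R2 - ?R3)\<bar> \<le> 0 + e" .
  qed
  then show ?thesis by linarith
qed

end

section \<open>From test functions to weak solutions\<close>

lemma has_derivative_dd:
  assumes "(\<phi> has_derivative D) (at z)"
  shows "((\<lambda>s. \<phi> (z + s *\<^sub>R w)) has_real_derivative D w) (at 0)" "dd \<phi> w z = D w"
proof -
  have "((\<lambda>s. z + s *\<^sub>R w) has_derivative (\<lambda>s. s *\<^sub>R w)) (at (0::real))"
    by (auto intro!: derivative_eq_intros)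
  from has_derivative_compose[OF this, of \<phi> D] assms
  have "((\<lambda>s. \<phi> (z + s *\<^sub>R w)) has_derivative (\<lambda>s. D (s *\<^sub>R w))) (at 0)" by simp
  moreover have "D (s *\<^sub>R w) = s * D w" for s
    using linear_scale[OF has_derivative_linear[OF assms]] by simp
  ultimately show "((\<lambda>s. \<phi> (z + s *\<^sub>R w)) has_real_derivative D w) (at 0)"
    by (simp add: has_field_derivative_def mult_commute_abs)
  then show "dd \<phi> w z = D w" unfolding dd_def by (rule DERIV_imp_deriv)
qed

lemma C1_fun_dd:
  assumes "C1_fun \<phi>"
  shows "((\<lambda>s. \<phi> (z + s *\<^sub>R w)) has_real_derivative dd \<phi> w z) (at 0)"
    "continuous_on UNIV \<phi>" "continuous_on UNIV (dd \<phi> w)"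
proof -
  obtain f' where f': "\<And>x. (\<phi> has_derivative f' x) (at x)" "\<And>w. continuous_on UNIV (\<lambda>x. f' x w)"
    using assms unfolding C1_fun_def by blast
  have e: "dd \<phi> w = (\<lambda>z. f' z w)" for w
    using has_derivative_dd(2)[OF f'(1)] by (rule ext)
  show "((\<lambda>s. \<phi> (z + s *\<^sub>R w)) has_real_derivative dd \<phi> w z) (at 0)"
    unfolding e by (rule has_derivative_dd(1)[OF f'(1)])
  show "continuous_on UNIV (dd \<phi> w)" unfolding e by (rule f'(2))
  show "continuous_on UNIV \<phi>"
    by (intro continuous_at_imp_continuous_on ballI has_derivative_continuous[OF f'(1)])
qed

lemma C2_fun_C1:
  assumes "C2_fun \<phi>"
  shows "C1_fun \<phi>" "C1_fun (dd \<phi> w)"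
proof -
  obtain f' where f': "\<And>x. (\<phi> has_derivative f' x) (at x)" "\<And>w. C1_fun (\<lambda>x. f' x w)"
    using assms unfolding C2_fun_def by blast
  show "C1_fun \<phi>" unfolding C1_fun_def using f' C1_fun_dd(2)[OF f'(2)] by blast
  have "dd \<phi> w = (\<lambda>z. f' z w)" using has_derivative_dd(2)[OF f'(1)] by (rule ext)
  then show "C1_fun (dd \<phi> w)" using f'(2) by simp
qed

lemma dd_shift:
  assumes "C1_fun \<phi>"
  shows "((\<lambda>s. \<phi> (z + s *\<^sub>R w)) has_real_derivative dd \<phi> w (z + a *\<^sub>R w)) (at a)"
proof -
  have "((\<lambda>s. \<phi> (z + a *\<^sub>R w + s *\<^sub>R w)) has_real_derivative dd \<phi> w (z + a *\<^sub>R w)) (at 0)"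
    by (rule C1_fun_dd(1)[OF assms])
  moreover have "z + a *\<^sub>R w + s *\<^sub>R w = z + (s + a) *\<^sub>R w" for s by (simp add: algebra_simps)
  ultimately show ?thesis using DERIV_shift[of "\<lambda>s. \<phi> (z + s *\<^sub>R w)" _ 0 a] by simp
qed

lemma dd_zero_open:
  assumes "open N" "\<And>z. z \<in> N \<Longrightarrow> \<phi> z = 0" "z \<in> N"
  shows "dd \<phi> w z = 0"
proof -
  have "open ((\<lambda>s::real. z + s *\<^sub>R w) -` N)"
    by (intro open_vimage assms continuous_intros)
  then have "\<forall>\<^sub>F s in nhds 0. s \<in> (\<lambda>s::real. z + s *\<^sub>R w) -` N"
    using assms(3) by (intro eventually_nhds_in_open) auto
  then have "\<forall>\<^sub>F s in nhds 0. \<phi> (z + s *\<^sub>R w) = 0" by eventually_elim (use assms(2) in auto)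
  from iffD2[OF DERIV_cong_ev[OF refl this refl] DERIV_const]
  show ?thesis unfolding dd_def by (rule DERIV_imp_deriv)
qed

lemma test_fun_data:
  assumes "test_fun \<phi>"
  obtains R where "test_data \<phi> (dd \<phi> e_t) (dtt \<phi>) (\<lambda>i. dd \<phi> (e_x i)) (\<lambda>i. dd (dd \<phi> (e_x i)) (e_x i)) R"
proof -
  have c2: "C2_fun \<phi>" and cs: "compact (closure {z. \<phi> z \<noteq> 0})" using assms by (auto simp: test_fun_def)
  define N where "N = - closure {z. \<phi> z \<noteq> 0}"
  have N: "open N" by (simp add: N_def open_Compl)
  have z0: "\<phi> z = 0" if "z \<in> N" for z using that closure_subset[of "{z. \<phi> z \<noteq> 0}"] by (auto simp: N_def)
  have z1: "dd \<phi> w z = 0" if "z \<in> N" for z w by (rule dd_zero_open[OF N z0 that])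
  have z2: "dd (dd \<phi> w) w z = 0" if "z \<in> N" for z w by (rule dd_zero_open[OF N z1 that])
  obtain R where R: "0 < R" "\<And>z. z \<in> closure {z. \<phi> z \<noteq> 0} \<Longrightarrow> norm z < R"
    using compact_imp_bounded[OF cs] unfolding bounded_pos_less by auto
  note C1 = C2_fun_C1[OF c2]
  have "test_data \<phi> (dd \<phi> e_t) (dtt \<phi>) (\<lambda>i. dd \<phi> (e_x i)) (\<lambda>i. dd (dd \<phi> (e_x i)) (e_x i)) R"
  proof
    show "continuous_on UNIV \<phi>" by (rule C1_fun_dd(2)[OF C1(1)])
    show "continuous_on UNIV (dd \<phi> e_t)" "continuous_on UNIV (dd \<phi> (e_x i))" for i
      by (rule C1_fun_dd(2)[OF C1(2)])+
    show "continuous_on UNIV (dtt \<phi>)" "continuous_on UNIV (dd (dd \<phi> (e_x i)) (e_x i))" for i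
      unfolding dtt_def by (rule C1_fun_dd(3)[OF C1(2)])+
    show "0 < R" by fact
    fix t x and i :: 3
    have te: "(0, x) + s *\<^sub>R e_t = (s, x)" for s and x :: "real^3" by (simp add: e_t_def)
    have xe: "(t, x) + s *\<^sub>R e_x i = (t, x + s *\<^sub>R axis i 1)" for s by (simp add: e_x_def)
    show "((\<lambda>t. \<phi> (t, x)) has_real_derivative dd \<phi> e_t (t, x)) (at t)"
      using dd_shift[OF C1(1), of "(0, x)" e_t t] by (simp add: te)
    show "((\<lambda>t. dd \<phi> e_t (t, x)) has_real_derivative dtt \<phi> (t, x)) (at t)"
      using dd_shift[OF C1(2), of e_t "(0, x)" e_t t] by (simp add: te dtt_def)
    show "((\<lambda>s. \<phi> (t, x + s *\<^sub>R axis i 1)) has_real_derivative dd \<phi> (e_x i) (t, x)) (at 0)"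
      using C1_fun_dd(1)[OF C1(1), of "(t, x)" "e_x i"] by (simp add: xe)
    show "((\<lambda>s. dd \<phi> (e_x i) (t, x + s *\<^sub>R axis i 1)) has_real_derivative dd (dd \<phi> (e_x i)) (e_x i) (t, x)) (at 0)"
      using C1_fun_dd(1)[OF C1(2), of "e_x i" "(t, x)" "e_x i"] by (simp add: xe)
    assume "R \<le> \<bar>t\<bar> \<or> R \<le> norm x"
    then have "R \<le> norm (t, x)" using norm_fst_le[of t x] norm_snd_le[of x t] by auto
    then have "(t, x) \<in> N" using R(2) by (fastforce simp: N_def)
    then show "\<phi> (t, x) = 0 \<and> dd \<phi> e_t (t, x) = 0 \<and> dtt \<phi> (t, x) = 0 \<and> dd \<phi> (e_x i) (t, x) = 0
        \<and> dd (dd \<phi> (e_x i)) (e_x i) (t, x) = 0"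
      using z0 z1 z2 by (simp add: dtt_def)
  qed
  then show ?thesis by (rule that)
qed

text \<open>The interface between profiles and the weak formulation: the formulas hold off the axis,
  and continuity up to the axis is what lets the cutoff be removed.\<close>

lemma weak_wave_solI:
  fixes u F :: "real \<Rightarrow> E \<Rightarrow> real" and u0 u1 :: "E \<Rightarrow> real"
  assumes D: "free_wave D Dt Dr Dtt" and K: "cont2 K"
    and cu: "continuous_on ({0..} \<times> UNIV) (\<lambda>(t, x). u t x)" and cF: "continuous_on ({0..} \<times> UNIV) (\<lambda>(t, x). F t x)"
    and c0: "continuous_on UNIV u0" and c1: "continuous_on UNIV u1"
    and u: "\<And>t x. \<lbrakk>0 \<le> t; x \<noteq> 0\<rbrakk> \<Longrightarrow> u t x = (D t (norm x) + duhamel K t (norm x)) / norm x"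
    and F: "\<And>t x. \<lbrakk>0 \<le> t; x \<noteq> 0\<rbrakk> \<Longrightarrow> F t x = K t (norm x) / norm x"
    and u0: "\<And>x. x \<noteq> 0 \<Longrightarrow> u0 x = D 0 (norm x) / norm x"
    and u1: "\<And>x. x \<noteq> 0 \<Longrightarrow> u1 x = Dt 0 (norm x) / norm x"
  shows "weak_wave_sol u F u0 u1"
  unfolding weak_wave_sol_def
proof (intro allI impI)
  fix \<phi> :: "real \<times> E \<Rightarrow> real" assume "test_fun \<phi>"
  then obtain R where "test_data \<phi> (dd \<phi> e_t) (dtt \<phi>) (\<lambda>i. dd \<phi> (e_x i)) (\<lambda>i. dd (dd \<phi> (e_x i)) (e_x i)) R"
    by (rule test_fun_data)
  then interpret test_data \<phi> "dd \<phi> e_t" "dtt \<phi>" "\<lambda>i. dd \<phi> (e_x i)" "\<lambda>i. dd (dd \<phi> (e_x i)) (e_x i)" R .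
  have wave_op: "wave_op z = dtt \<phi> z - lap \<phi> z" for z by (simp add: wave_op_def lap_def)
  have out: "R \<le> \<bar>t\<bar> \<or> R \<le> norm x" if "(t, x) \<notin> slab" "0 \<le> t" for t x
    using that not_in_cube[of x R] by (auto simp: slab_def)
  have sub: "slab \<subseteq> {0..} \<times> UNIV" by (auto simp: slab_def)
  have 1: "integral ({0..} \<times> UNIV) (\<lambda>(t, x). u t x * (dtt \<phi> (t, x) - lap \<phi> (t, x))) = integral slab (\<lambda>z. case_prod u z * wave_op z)"
    unfolding wave_op case_prod_beta prod.collapse
  proof (rule integral_outside[OF _ sub])
    fix z assume "z \<notin> slab" "z \<in> {0..} \<times> (UNIV :: E set)"
    then have "wave_op z = 0" using out[of "fst z" "snd z"] supp[of "fst z" "snd z"] by (auto simp: wave_op_def)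
    then show "u (fst z) (snd z) * (dtt \<phi> z - lap \<phi> z) = 0" by (simp add: wave_op)
  qed
  have 2: "integral ({0..} \<times> UNIV) (\<lambda>(t, x). F t x * \<phi> (t, x)) = integral slab (\<lambda>z. case_prod F z * \<phi> z)"
    unfolding case_prod_beta prod.collapse
  proof (rule integral_outside[OF _ sub])
    fix z assume "z \<notin> slab" "z \<in> {0..} \<times> (UNIV :: E set)"
    then have "\<phi> z = 0" using out[of "fst z" "snd z"] supp[of "fst z" "snd z"] by auto
    then show "F (fst z) (snd z) * \<phi> z = 0" by simp
  qed
  have 3: "integral UNIV (\<lambda>x. u1 x * \<phi> (0, x)) = integral (cube R) (\<lambda>x. u1 x * \<phi> (0, x))"
    by (rule integral_outside) (use supp not_in_cube in auto)
  have 4: "integral UNIV (\<lambda>x. u0 x * dd \<phi> e_t (0, x)) = integral (cube R) (\<lambda>x. u0 x * dd \<phi> e_t (0, x))"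
    by (rule integral_outside) (use supp not_in_cube in auto)
  show "integral ({0..} \<times> UNIV) (\<lambda>(t, x). u t x * (dtt \<phi> (t, x) - lap \<phi> (t, x))) =
        integral ({0..} \<times> UNIV) (\<lambda>(t, x). F t x * \<phi> (t, x)) + integral UNIV (\<lambda>x. u1 x * \<phi> (0, x)) -
        integral UNIV (\<lambda>x. u0 x * dd \<phi> e_t (0, x))"
    unfolding 1 2 3 4 by (rule axis_removal[OF D K cu cF c0 c1 _ _ u0 u1]) (simp_all add: u F)
qed

section \<open>Radial solutions of the free wave equation\<close>

lemma supp_dd_zero:
  assumes "supp_in_unit_ball f" "1 \<le> norm z"
  shows "f z = 0" "dd f w z = 0" "dd (dd f w) w z = 0"
proof -
  define N where "N = - closure {z. f z \<noteq> 0}"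
  have N: "open N" by (simp add: N_def open_Compl)
  have z: "z \<in> N" using assms by (auto simp: N_def supp_in_unit_ball_def)
  have z0: "f z = 0" if "z \<in> N" for z using that closure_subset[of "{z. f z \<noteq> 0}"] by (auto simp: N_def)
  have z1: "dd f w z = 0" if "z \<in> N" for z by (rule dd_zero_open[OF N z0 that])
  show "f z = 0" "dd f w z = 0" "dd (dd f w) w z = 0"
    using z0[OF z] z1[OF z] dd_zero_open[OF N z1 z] by auto
qed

text \<open>The profile is taken along a whole line through the origin, which makes it the even
  extension and keeps the regularity of the function at radius 0.\<close>

lemma radial_profile:
  assumes "C1_fun f" "radial f" "supp_in_unit_ball f"
  defines "e \<equiv> axis 1 1 :: E"
  shows "((\<lambda>r. f (r *\<^sub>R e)) has_real_derivative dd f e (x *\<^sub>R e)) (at x)"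
    "continuous_on UNIV (\<lambda>r. f (r *\<^sub>R e))" "continuous_on UNIV (\<lambda>r. dd f e (r *\<^sub>R e))"
    "f ((- r) *\<^sub>R e) = f (r *\<^sub>R e)" "f z = f (norm z *\<^sub>R e)"
    "1 \<le> \<bar>r\<bar> \<Longrightarrow> f (r *\<^sub>R e) = 0" "1 \<le> \<bar>r\<bar> \<Longrightarrow> dd f e (r *\<^sub>R e) = 0"
proof -
  have n: "norm e = 1" by (simp add: e_def)
  show "((\<lambda>r. f (r *\<^sub>R e)) has_real_derivative dd f e (x *\<^sub>R e)) (at x)"
    using dd_shift[OF assms(1), of 0 e x] by simp
  show "continuous_on UNIV (\<lambda>r. f (r *\<^sub>R e))" "continuous_on UNIV (\<lambda>r. dd f e (r *\<^sub>R e))"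
    by (rule continuous_on_compose2[OF C1_fun_dd(2)[OF assms(1)]] continuous_on_compose2[OF C1_fun_dd(3)[OF assms(1)]],
      auto intro!: continuous_intros)+
  have rad: "norm y = norm z \<Longrightarrow> f y = f z" for y z using assms(2) unfolding radial_def by blast
  show "f ((- r) *\<^sub>R e) = f (r *\<^sub>R e)" "f z = f (norm z *\<^sub>R e)" by (rule rad, simp add: n)+
  show "1 \<le> \<bar>r\<bar> \<Longrightarrow> f (r *\<^sub>R e) = 0" "1 \<le> \<bar>r\<bar> \<Longrightarrow> dd f e (r *\<^sub>R e) = 0"
    using supp_dd_zero[OF assms(3)] n by auto
qed

text \<open>The 9 is 3^2, from 2 + |x| <= 3 and e >= -2.\<close>

lemma one_le_wt: "\<bar>x\<bar> \<le> 1 \<Longrightarrow> - 2 \<le> e \<Longrightarrow> e \<le> 0 \<Longrightarrow> 1 \<le> 9 * wt e x"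
proof -
  assume a: "\<bar>x\<bar> \<le> 1" "- 2 \<le> e" "e \<le> 0"
  have "1 / 9 = (3::real) powr - 2" by (simp add: powr_minus_divide)
  also have "\<dots> \<le> 3 powr e" using a by (intro powr_mono) auto
  also have "\<dots> = wt e 1" by (simp add: wt_def)
  also have "\<dots> \<le> wt e x" using a by (intro wt_anti) auto
  finally show ?thesis by simp
qed

text \<open>d'Alembert's formula for the odd extensions of r f and r g. Here \<open>P\<close> is the
  derivative of \<open>D\<close> along outgoing rays, \<open>a\<close> stands for \<kappa>q, and the
  mixed derivative \<open>Dtr\<close> is exported for the regularity of u_t on the axis.\<close>

lemma free_solution:
  assumes f: "C2_fun f" "radial f" "supp_in_unit_ball f" and g: "C1_fun g" "radial g" "supp_in_unit_ball g"
    and par: "0 < \<kappa>" "\<kappa> \<le> 1" "1 < q" "q < 2" "0 < a" "a < 1"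
  obtains D Dt Dr Dtt Dtr P C where "free_wave D Dt Dr Dtt" "cont2 Dtr"
    "\<And>t r. (Dt t has_real_derivative Dtr t r) (at r)" "\<And>t r. ((\<lambda>t. Dr t r) has_real_derivative Dtr t r) (at t)"
    "\<And>t r. D t (- r) = - D t r" "\<And>t r. Dt t (- r) = - Dt t r"
    "\<And>x. x \<noteq> 0 \<Longrightarrow> f x = D 0 (norm x) / norm x" "\<And>x. x \<noteq> 0 \<Longrightarrow> g x = Dt 0 (norm x) / norm x"
    "\<And>c s. ((\<lambda>s. D s (c + s)) has_real_derivative P s (c + s)) (at s)" "(0::real) < C"
    "\<And>t r. \<lbrakk>0 \<le> t; 0 \<le> r\<rbrakk> \<Longrightarrow> \<bar>P t r\<bar> \<le> C * wt (- 1 - \<kappa>) (t + r)"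
    "\<And>r. 0 \<le> r \<Longrightarrow> \<bar>D 0 r\<bar> \<le> C * r * wt (- 1 - \<kappa>) r"
    "\<And>t r. \<lbrakk>0 \<le> t; 0 \<le> r\<rbrakk> \<Longrightarrow> \<bar>Dt t r\<bar> \<le> C * (r * wt (1 - q) (t + r) * wt (- a) (t - r))"
proof -
  define e where "e = (axis 1 1 :: E)"
  note f1 = C2_fun_C1(1)[OF f(1)] and f2 = C2_fun_C1(2)[OF f(1)]
  define fh fh1 fh2 gh gh1 where "fh r = f (r *\<^sub>R e)" and "fh1 r = dd f e (r *\<^sub>R e)" and "fh2 r = dd (dd f e) e (r *\<^sub>R e)"
    and "gh r = g (r *\<^sub>R e)" and "gh1 r = dd g e (r *\<^sub>R e)" for r
  note pf = radial_profile[OF f1 f(2,3), folded e_def] and pg = radial_profile[OF g, folded e_def]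
  have dfh: "(fh has_real_derivative fh1 x) (at x)" and dgh: "(gh has_real_derivative gh1 x) (at x)" for x
    unfolding fh_def[abs_def] fh1_def gh_def[abs_def] gh1_def by (rule pf pg)+
  have dfh1: "(fh1 has_real_derivative fh2 x) (at x)" for x
    unfolding fh1_def[abs_def] fh2_def using dd_shift[OF f2, of e 0 e x] by simp
  have c: "continuous_on UNIV fh" "continuous_on UNIV fh1" "continuous_on UNIV gh" "continuous_on UNIV gh1"
    unfolding fh_def[abs_def] fh1_def[abs_def] gh_def[abs_def] gh1_def[abs_def] by (rule pf pg)+
  have c2: "continuous_on UNIV fh2" unfolding fh2_def[abs_def]
    by (rule continuous_on_compose2[OF C1_fun_dd(3)[OF f2]]) (auto intro!: continuous_intros)
  have ev: "fh (- x) = fh x" "gh (- x) = gh x" for x unfolding fh_def gh_def by (rule pf pg)+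
  have od: "fh1 (- x) = - fh1 x" for x
  proof -
    have "((\<lambda>x. fh (- x)) has_real_derivative - fh1 (- x)) (at x)"
      using dfh[of "- x"] by (simp add: DERIV_mirror)
    then have "(fh has_real_derivative - fh1 (- x)) (at x)" by (simp add: ev)
    from DERIV_unique[OF this dfh] show ?thesis by simp
  qed
  have z: "fh x = 0" "fh1 x = 0" "gh x = 0" if "1 \<le> \<bar>x\<bar>" for x
    unfolding fh_def fh1_def gh_def using pf(6,7)[OF that] pg(6)[OF that] by auto
  define F F1 F2 \<rho> \<rho>1 where "F x = x * fh x" and "F1 x = fh x + x * fh1 x" and "F2 x = 2 * fh1 x + x * fh2 x"
    and "\<rho> x = x * gh x" and "\<rho>1 x = gh x + x * gh1 x" for x
  have cF: "continuous_on UNIV F" "continuous_on UNIV F1" "continuous_on UNIV F2" "continuous_on UNIV \<rho>" "continuous_on UNIV \<rho>1"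
    unfolding F_def[abs_def] F1_def[abs_def] F2_def[abs_def] \<rho>_def[abs_def] \<rho>1_def[abs_def] by (intro continuous_intros c c2)+
  define \<Gamma> where "\<Gamma> = sint \<rho>"
  have d: "(F has_real_derivative F1 x) (at x)" "(F1 has_real_derivative F2 x) (at x)" "(\<rho> has_real_derivative \<rho>1 x) (at x)"
    "(\<Gamma> has_real_derivative \<rho> x) (at x)" for x
    unfolding F_def[abs_def] F1_def[abs_def] F2_def \<rho>_def[abs_def] \<rho>1_def \<Gamma>_def
    by (auto intro!: derivative_eq_intros dfh dfh1 dgh) (auto intro!: sint_deriv continuous_intros c)
  have c\<Gamma>: "continuous_on UNIV \<Gamma>" by (rule deriv_continuous_on) (rule d)
  have par2: "F (- x) = - F x" "F1 (- x) = F1 x" "\<rho> (- x) = - \<rho> x" "\<Gamma> (- x) = \<Gamma> x" for x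
    unfolding \<Gamma>_def by (auto simp: F_def F1_def \<rho>_def ev od sint_odd)
  have dp: "((\<lambda>t. G (r + t)) has_real_derivative G' (r + t)) (at t)" "((\<lambda>t. G (r - t)) has_real_derivative - G' (r - t)) (at t)"
    "((\<lambda>r. G (r + t)) has_real_derivative G' (r + t)) (at r)" "((\<lambda>r. G (r - t)) has_real_derivative G' (r - t)) (at r)"
    if "\<And>x. (G has_real_derivative G' x) (at x)" for G G' and r t :: real
  proof -
    have ch: "((\<lambda>x. G (l x)) has_real_derivative G' (l y) * l') (at y)" if "(l has_real_derivative l') (at y)" for l l' and y :: real
      by (rule DERIV_chain2[where f = G and g = l, OF _ that]) fact
    show "((\<lambda>t. G (r + t)) has_real_derivative G' (r + t)) (at t)"
      by (rule DERIV_cong[OF ch[of "\<lambda>t. r + t" 1]]) (auto intro!: derivative_eq_intros)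
    show "((\<lambda>t. G (r - t)) has_real_derivative - G' (r - t)) (at t)"
      by (rule DERIV_cong[OF ch[of "\<lambda>t. r - t" "-1"]]) (auto intro!: derivative_eq_intros)
    show "((\<lambda>r. G (r + t)) has_real_derivative G' (r + t)) (at r)"
      by (rule DERIV_cong[OF ch[of "\<lambda>r. r + t" 1]]) (auto intro!: derivative_eq_intros)
    show "((\<lambda>r. G (r - t)) has_real_derivative G' (r - t)) (at r)"
      by (rule DERIV_cong[OF ch[of "\<lambda>r. r - t" 1]]) (auto intro!: derivative_eq_intros)
  qed
  define D where "D t r = (F (r + t) + F (r - t) + (\<Gamma> (r + t) - \<Gamma> (r - t))) / 2" for t r
  define Dt where "Dt t r = (F1 (r + t) - F1 (r - t) + (\<rho> (r + t) + \<rho> (r - t))) / 2" for t r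
  define Dr where "Dr t r = (F1 (r + t) + F1 (r - t) + (\<rho> (r + t) - \<rho> (r - t))) / 2" for t r
  define Dtt where "Dtt t r = (F2 (r + t) + F2 (r - t) + (\<rho>1 (r + t) - \<rho>1 (r - t))) / 2" for t r
  define Dtr where "Dtr t r = (F2 (r + t) - F2 (r - t) + (\<rho>1 (r + t) + \<rho>1 (r - t))) / 2" for t r
  have cc: "continuous_on UNIV (\<lambda>z. G (snd z + fst z))" "continuous_on UNIV (\<lambda>z. G (snd z - fst z))"
    if "continuous_on UNIV G" for G :: "real \<Rightarrow> real"
    by (rule continuous_on_compose2[OF that]; auto intro!: continuous_intros)+
  have fw: "free_wave D Dt Dr Dtt"
    unfolding free_wave_def
  proof (intro conjI allI)
    show "cont2 D" "cont2 Dt" "cont2 Dr" "cont2 Dtt"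
      unfolding D_def Dt_def Dr_def Dtt_def case_prod_beta by (intro continuous_intros cc cF c\<Gamma>; simp)+
    show "((\<lambda>t. D t r) has_real_derivative Dt t r) (at t)" for t r
      unfolding D_def Dt_def
      by (rule DERIV_cong[OF DERIV_cdivide[OF DERIV_add[OF DERIV_add[OF dp(1)[OF d(1)] dp(2)[OF d(1)]] DERIV_diff[OF dp(1)[OF d(4)] dp(2)[OF d(4)]]]]]) simp
    show "((\<lambda>t. Dt t r) has_real_derivative Dtt t r) (at t)" for t r
      unfolding Dtt_def Dt_def
      by (rule DERIV_cong[OF DERIV_cdivide[OF DERIV_add[OF DERIV_diff[OF dp(1)[OF d(2)] dp(2)[OF d(2)]] DERIV_add[OF dp(1)[OF d(3)] dp(2)[OF d(3)]]]]]) simp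
    show "(D t has_real_derivative Dr t r) (at r)" for t r
      unfolding D_def[abs_def] Dr_def
      by (rule DERIV_cdivide[OF DERIV_add[OF DERIV_add[OF dp(3)[OF d(1)] dp(4)[OF d(1)]] DERIV_diff[OF dp(3)[OF d(4)] dp(4)[OF d(4)]]]])
    show "(Dr t has_real_derivative Dtt t r) (at r)" for t r
      unfolding Dtt_def Dr_def[abs_def]
      by (rule DERIV_cdivide[OF DERIV_add[OF DERIV_add[OF dp(3)[OF d(2)] dp(4)[OF d(2)]] DERIV_diff[OF dp(3)[OF d(3)] dp(4)[OF d(3)]]]])
  qed
  have cDtr: "cont2 Dtr" unfolding Dtr_def case_prod_beta by (intro continuous_intros cc cF; simp)
  have dDt_r: "(Dt t has_real_derivative Dtr t r) (at r)" for t r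
    unfolding Dtr_def Dt_def[abs_def]
    by (rule DERIV_cdivide[OF DERIV_add[OF DERIV_diff[OF dp(3)[OF d(2)] dp(4)[OF d(2)]] DERIV_add[OF dp(3)[OF d(3)] dp(4)[OF d(3)]]]])
  have dDr_t: "((\<lambda>t. Dr t r) has_real_derivative Dtr t r) (at t)" for t r
    unfolding Dtr_def Dr_def
    by (rule DERIV_cong[OF DERIV_cdivide[OF DERIV_add[OF DERIV_add[OF dp(1)[OF d(2)] dp(2)[OF d(2)]] DERIV_diff[OF dp(1)[OF d(3)] dp(2)[OF d(3)]]]]]) simp
  have m: "- r + t = - (r - t)" "- r - t = - (r + t)" for r t :: real by auto
  have odd: "D t (- r) = - D t r" "Dt t (- r) = - Dt t r" for t r
    unfolding D_def Dt_def m par2 by (simp_all add: field_simps)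
  \<comment> \<open>By parity one function on the line governs everything: (\<partial>t +
    \<partial>r) D is k(t + r), and D_t is half of k(t + r) - k(t - r). It is supported in [-1, 1],
    so D_t lives in |t - r| <= 1, which is Huygens' principle.\<close>
  define k where "k x = F1 x + \<rho> x" for x
  have dk: "(k has_real_derivative F2 x + \<rho>1 x) (at x)" for x
    unfolding k_def[abs_def] by (intro DERIV_add d)
  have Dtk: "Dt t r = (k (t + r) - k (t - r)) / 2" for t r
    unfolding Dt_def k_def using par2(2)[of "t - r"] par2(3)[of "t - r"] by (simp add: add.commute)
  have dchar: "((\<lambda>s. D s (c + s)) has_real_derivative k (s + (c + s))) (at s)" for c s
  proof -
    have "((\<lambda>s. (F (c + 2 * s) + F c + (\<Gamma> (c + 2 * s) - \<Gamma> c)) / 2) has_real_derivative (F1 (c + 2 * s) * 2 + 0 + (\<rho> (c + 2 * s) * 2 - 0)) / 2) (at s)"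
    proof -
      have l: "((\<lambda>s. c + 2 * s) has_real_derivative 2) (at s)" by (auto intro!: derivative_eq_intros)
      show ?thesis
        by (rule DERIV_cdivide[OF DERIV_add[OF DERIV_add[OF DERIV_chain2[where f = F and g = "\<lambda>s. c + 2 * s", OF d(1) l] DERIV_const]
          DERIV_diff[OF DERIV_chain2[where f = \<Gamma> and g = "\<lambda>s. c + 2 * s", OF d(4) l] DERIV_const]]])
    qed
    moreover have "(\<lambda>s. D s (c + s)) = (\<lambda>s. (F (c + 2 * s) + F c + (\<Gamma> (c + 2 * s) - \<Gamma> c)) / 2)"
    proof
      fix s
      have "c + s + s = c + 2 * s" "c + s - s = c" by auto
      then show "D s (c + s) = (F (c + 2 * s) + F c + (\<Gamma> (c + 2 * s) - \<Gamma> c)) / 2" by (simp only: D_def)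
    qed
    moreover have "(F1 (c + 2 * s) * 2 + 0 + (\<rho> (c + 2 * s) * 2 - 0)) / 2 = k (s + (c + s))"
    proof -
      have "s + (c + s) = c + 2 * s" by simp
      then show ?thesis unfolding k_def by (simp only:) simp
    qed
    ultimately show ?thesis by (simp only:)
  qed
  have bd: "\<exists>B>0. \<forall>y\<in>{-1..1}. \<bar>G y\<bar> \<le> B" if "continuous_on UNIV G" for G :: "real \<Rightarrow> real"
    by (rule compact_abs_bound[OF compact_Icc continuous_on_subset[OF that]]) simp
  have ck: "continuous_on UNIV k" "continuous_on UNIV (\<lambda>x. F2 x + \<rho>1 x)"
    unfolding k_def[abs_def] by (intro continuous_intros cF)+
  obtain B0 B1 B2 where B: "0 < B0" "0 < B1" "0 < B2" "\<forall>y\<in>{-1..1}. \<bar>fh y\<bar> \<le> B0" "\<forall>y\<in>{-1..1}. \<bar>k y\<bar> \<le> B1" "\<forall>y\<in>{-1..1}. \<bar>F2 y + \<rho>1 y\<bar> \<le> B2"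
    using bd[OF c(1)] bd[OF ck(1)] bd[OF ck(2)] by blast
  define C where "C = B0 + B1 + B2"
  have C: "0 < C" using B by (simp add: C_def)
  have kz: "k x = 0" if "1 \<le> \<bar>x\<bar>" for x using z[OF that] by (simp add: k_def F1_def \<rho>_def)
  have kC: "\<bar>k x\<bar> \<le> C" for x
    using B kz[of x] C by (cases "x \<in> {-1..1}") (fastforce simp: C_def, auto)
  have lip: "\<bar>k x - k y\<bar> \<le> C * \<bar>x - y\<bar>" if "x \<in> {-1..1}" "y \<in> {-1..1}" for x y
  proof -
    have "norm (k x - k y) \<le> C * norm (x - y)"
    proof (rule field_differentiable_bound[where S = "{-1..1}" and f' = "\<lambda>x. F2 x + \<rho>1 x"])
      fix w :: real assume "w \<in> {-1..1}"
      then show "norm (F2 w + \<rho>1 w) \<le> C" using B by (fastforce simp: C_def)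
    qed (use that dk in \<open>auto intro: has_field_derivative_at_within\<close>)
    then show ?thesis by simp
  qed
  have b1: "\<bar>k (t + r)\<bar> \<le> 15 * C * wt (- 1 - \<kappa>) (t + r)" for t r
  proof (cases "\<bar>t + r\<bar> \<le> 1")
    case True
    have "\<bar>k (t + r)\<bar> \<le> C * 1" using kC by simp
    also have "\<dots> \<le> C * (9 * wt (- 1 - \<kappa>) (t + r))" using True par C by (intro mult_left_mono one_le_wt) auto
    also have "\<dots> \<le> 15 * C * wt (- 1 - \<kappa>) (t + r)" using C by simp
    finally show ?thesis .
  qed (use kz C in auto)
  have b2: "\<bar>D 0 r\<bar> \<le> 15 * C * r * wt (- 1 - \<kappa>) r" if r: "0 \<le> r" for r
  proof (cases "r \<le> 1")
    case True
    have "\<bar>fh r\<bar> \<le> C * 1" using bspec[OF B(4), of r] B(1-3) True r by (simp add: C_def)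
    also have "\<dots> \<le> C * (9 * wt (- 1 - \<kappa>) r)" using True r par C by (intro mult_left_mono one_le_wt) auto
    also have "\<dots> \<le> 15 * C * wt (- 1 - \<kappa>) r" using C by simp
    finally have "r * \<bar>fh r\<bar> \<le> r * (15 * C * wt (- 1 - \<kappa>) r)" using r by (rule mult_left_mono)
    then show ?thesis using r by (simp add: D_def F_def abs_mult mult_ac)
  next
    case False
    then show ?thesis using z(1)[of r] r C by (simp add: D_def F_def)
  qed
  have b3: "\<bar>Dt t r\<bar> \<le> 15 * C * (r * wt (1 - q) (t + r) * wt (- a) (t - r))" if tr: "0 \<le> t" "0 \<le> r" for t r
  proof (cases "\<bar>t - r\<bar> \<le> 1")
    case False
    then have "k (t + r) = 0" "k (t - r) = 0" using tr by (auto intro!: kz)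
    then show ?thesis using tr C by (simp add: Dtk)
  next
    case True
    have n1: "\<bar>Dt t r\<bar> \<le> C" 
      using abs_triangle_ineq4[of "k (t + r)" "k (t - r)"] kC[of "t + r"] kC[of "t - r"] by (simp add: Dtk abs_divide)
    have n2: "\<bar>Dt t r\<bar> \<le> C * r"
    proof -
      \<comment> \<open>The Lipschitz bound \<open>lip\<close> holds on [-1, 1] only; as
        \<open>k\<close> vanishes from 1 on, t + r may be replaced by min 1 (t + r).\<close>
      define \<xi> where "\<xi> = min 1 (t + r)"
      have "k (t + r) = k \<xi>" using kz[of "t + r"] kz[of 1] tr by (auto simp: \<xi>_def min_def)
      moreover have "\<xi> \<in> {-1..1}" "t - r \<in> {-1..1}" using True tr by (auto simp: \<xi>_def abs_le_iff)
      ultimately have "\<bar>k (t + r) - k (t - r)\<bar> \<le> C * \<bar>\<xi> - (t - r)\<bar>"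
        using lip[of \<xi> "t - r"] by simp
      also have "\<dots> \<le> C * (2 * r)" using C True tr by (intro mult_left_mono) (auto simp: \<xi>_def)
      finally show ?thesis by (simp add: Dtk)
    qed
    have "wt (-1) 1 \<le> wt (- a) (t - r)"
    proof -
      have "wt (-1) 1 \<le> wt (- a) 1" unfolding wt_def using par by (intro powr_mono) auto
      also have "\<dots> \<le> wt (- a) (t - r)" using True par by (intro wt_anti) auto
      finally show ?thesis .
    qed
    then have w1: "1 / 3 \<le> wt (- a) (t - r)" by (simp add: wt_def powr_minus_divide)
    have "wt (-1) (1 + 2 * r) \<le> wt (1 - q) (t + r)"
    proof -
      have "wt (-1) (1 + 2 * r) \<le> wt (1 - q) (1 + 2 * r)" unfolding wt_def using par by (intro powr_mono) auto
      also have "\<dots> \<le> wt (1 - q) (t + r)" using True par tr by (intro wt_anti) auto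
      finally show ?thesis .
    qed
    then have w2: "1 / (3 + 2 * r) \<le> wt (1 - q) (t + r)" using tr by (simp add: wt_def powr_minus_divide)
    \<comment> \<open>By \<open>n1\<close> and \<open>n2\<close>, |D_t| is at most C min(1, r), and
      min(1, r) <= 5r/(3 + 2r). The remaining factor 3 of 15 pays for the weight in t - r.\<close>
    have "\<bar>Dt t r\<bar> \<le> 15 * C * (r * (1 / (3 + 2 * r)) * (1 / 3))"
    proof (cases "r \<le> 1")
      case True
      have "C * r * (3 + 2 * r) \<le> C * r * 5" using True tr C by (intro mult_left_mono) auto
      then have "C * r \<le> 15 * C * (r * (1 / (3 + 2 * r)) * (1 / 3))" using tr by (simp add: field_simps)
      then show ?thesis using n2 by linarith
    next
      case False
      have "C * (3 + 2 * r) \<le> C * (5 * r)" using False C by (intro mult_left_mono) auto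
      then have "C \<le> 15 * C * (r * (1 / (3 + 2 * r)) * (1 / 3))" using tr by (simp add: field_simps)
      then show ?thesis using n1 by linarith
    qed
    also have "\<dots> \<le> 15 * C * (r * wt (1 - q) (t + r) * wt (- a) (t - r))"
      using w1 w2 tr C by (intro mult_left_mono mult_mono) auto
    finally show ?thesis .
  qed
  have i0: "f x = D 0 (norm x) / norm x" "g x = Dt 0 (norm x) / norm x" if "x \<noteq> 0" for x
    using that pf(5)[of x] pg(5)[of x] by (simp_all add: D_def Dt_def F_def \<rho>_def fh_def gh_def)
  show ?thesis
    by (rule that[OF fw cDtr dDt_r dDr_t odd i0, of "\<lambda>t r. k (t + r)" "15 * C"]) (use dchar b1 b2 b3 C in auto)
qed

section \<open>Powers, quotients by the radius and a fixed point principle\<close>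

text \<open>No completeness assumption: membership in \<open>S\<close> passes to limits at the geometric rate.\<close>

lemma contraction_fixpoint:
  fixes T :: "('x \<Rightarrow> real) \<Rightarrow> 'x \<Rightarrow> real" and \<Phi> :: "'x \<Rightarrow> real"
  assumes f0: "f0 \<in> S" and T: "\<And>f. f \<in> S \<Longrightarrow> T f \<in> S"
    and contr: "\<And>f g d. \<lbrakk>f \<in> S; g \<in> S; 0 \<le> d; \<forall>x\<in>X. \<bar>f x - g x\<bar> \<le> d * \<Phi> x\<rbrakk> \<Longrightarrow> \<forall>x\<in>X. \<bar>T f x - T g x\<bar> \<le> d / 2 * \<Phi> x"
    and \<Phi>: "\<And>x. x \<in> X \<Longrightarrow> 0 \<le> \<Phi> x" and b: "0 \<le> b" "\<And>f g. \<lbrakk>f \<in> S; g \<in> S\<rbrakk> \<Longrightarrow> \<forall>x\<in>X. \<bar>f x - g x\<bar> \<le> b * \<Phi> x"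
    and closed: "\<And>F f. \<lbrakk>\<And>n. F n \<in> S; \<And>n. \<forall>x\<in>X. \<bar>F n x - f x\<bar> \<le> b / 2 ^ n * \<Phi> x\<rbrakk> \<Longrightarrow> f \<in> S"
  shows "\<exists>f\<in>S. \<forall>x\<in>X. T f x = f x"
proof -
  define F where "F n = (T ^^ n) f0" for n
  have FS: "F n \<in> S" for n by (induction n) (auto simp: F_def f0 T)
  have it: "\<forall>x\<in>X. \<bar>(T ^^ n) f x - (T ^^ n) g x\<bar> \<le> b / 2 ^ n * \<Phi> x" if "f \<in> S" "g \<in> S" for n f g
  proof (induction n)
    case (Suc n)
    have "(T ^^ n) h \<in> S" if "h \<in> S" for h using that by (induction n) (auto simp: T)
    from contr[OF this[OF \<open>f \<in> S\<close>] this[OF \<open>g \<in> S\<close>] _ Suc] b(1) show ?case by (simp add: mult.commute)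
  qed (use b that in simp)
  have cau: "\<bar>F (n + k) x - F n x\<bar> \<le> b / 2 ^ n * \<Phi> x" if "x \<in> X" for n k x
    using it[OF FS[of k] f0, of n] that by (simp add: F_def funpow_add)
  have to0: "(\<lambda>n. b / 2 ^ n * \<Phi> x) \<longlonglongrightarrow> 0" for x
  proof -
    have "(\<lambda>n. b * \<Phi> x * (1 / 2) ^ n) \<longlonglongrightarrow> b * \<Phi> x * 0" by (intro tendsto_mult tendsto_const LIMSEQ_power_zero) auto
    then show ?thesis by (simp add: power_divide mult_ac)
  qed
  have conv: "convergent (\<lambda>n. F n x)" if "x \<in> X" for x
  proof -
    have "Cauchy (\<lambda>n. F n x)"
    proof (rule CauchyI')
      fix e :: real assume "0 < e"
      from order_tendstoD(2)[OF to0 this, of x] obtain N where N: "\<And>n. n \<ge> N \<Longrightarrow> b / 2 ^ n * \<Phi> x < e"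
        by (auto simp: eventually_sequentially)
      have "norm (F m x - F n x) < e" if mn: "m \<ge> N" "n > m" for m n
      proof -
        obtain k where k: "n = m + k" using le_Suc_ex[of m n] mn(2) by auto
        show ?thesis using cau[OF \<open>x \<in> X\<close>, of m k] N[OF mn(1)] by (simp add: k abs_minus_commute)
      qed
      then show "\<exists>M. \<forall>m\<ge>M. \<forall>n>m. dist (F m x) (F n x) < e" by (auto simp: dist_norm)
    qed
    then show ?thesis by (simp add: Cauchy_convergent_iff)
  qed
  define f where "f x = lim (\<lambda>n. F n x)" for x
  have lim: "(\<lambda>n. F n x) \<longlonglongrightarrow> f x" if "x \<in> X" for x
    using conv[OF that] by (simp add: f_def convergent_LIMSEQ_iff)
  have rate: "\<bar>F n x - f x\<bar> \<le> b / 2 ^ n * \<Phi> x" if "x \<in> X" for n x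
  proof (rule LIMSEQ_le_const2)
    show "(\<lambda>k. \<bar>F n x - F (n + k) x\<bar>) \<longlonglongrightarrow> \<bar>F n x - f x\<bar>"
      by (intro tendsto_intros LIMSEQ_ignore_initial_segment[OF lim[OF that], of n, unfolded add.commute[of _ n]])
    show "\<exists>N. \<forall>k\<ge>N. \<bar>F n x - F (n + k) x\<bar> \<le> b / 2 ^ n * \<Phi> x" using cau[OF that] by (metis abs_minus_commute)
  qed
  have fS: "f \<in> S" by (rule closed[of F, OF FS]) (use rate in blast)
  have "T f x = f x" if x: "x \<in> X" for x
  proof -
    have "\<bar>T f x - f x\<bar> \<le> b / 2 ^ n * \<Phi> x" for n
    proof -
      have "\<bar>T (F n) x - T f x\<bar> \<le> b / 2 ^ n / 2 * \<Phi> x"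
        using contr[OF FS fS, of "b / 2 ^ n" n] rate[of _ n] b(1) x by simp
      moreover have "T (F n) x = F (Suc n) x" by (simp add: F_def)
      moreover have "\<bar>F (Suc n) x - f x\<bar> \<le> b / 2 ^ n / 2 * \<Phi> x" using rate[OF x, of "Suc n"] by (simp add: mult.commute)
      ultimately have "\<bar>T f x - f x\<bar> \<le> b / 2 ^ n / 2 * \<Phi> x + b / 2 ^ n / 2 * \<Phi> x"
        using abs_triangle_ineq4[of "T f x - T (F n) x" "f x - T (F n) x"] by (simp add: abs_minus_commute)
      then show ?thesis by (simp add: field_simps)
    qed
    then have "\<bar>T f x - f x\<bar> \<le> 0" using LIMSEQ_le_const[OF to0[of x]] by blast
    then show ?thesis by simp
  qed
  then show ?thesis using fS by blast
qed

lemma abs_powr_deriv: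
  assumes "1 < e"
  shows "((\<lambda>y. \<bar>y\<bar> powr e) has_real_derivative e * (\<bar>y\<bar> powr (e - 1) * sgn y)) (at (y::real))"
proof -
  consider "y < 0" | "y = 0" | "0 < y" by linarith
  then show ?thesis
  proof cases
    case 1
    have "\<forall>\<^sub>F y in nhds y. y \<in> {..<0}" using 1 by (intro eventually_nhds_in_open) auto
    then have ev: "\<forall>\<^sub>F y in nhds y. \<bar>y\<bar> powr e = (0 + (-1) * y) powr e" by eventually_elim auto
    show ?thesis
      by (rule iffD2[OF DERIV_cong_ev[OF refl ev refl]])
        (rule DERIV_cong[OF powr_affine_deriv], use 1 in auto)
  next
    case 3
    have "\<forall>\<^sub>F y in nhds y. y \<in> {0<..}" using 3 by (intro eventually_nhds_in_open) auto
    then have ev: "\<forall>\<^sub>F y in nhds y. \<bar>y\<bar> powr e = (0 + 1 * y) powr e" by eventually_elim auto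
    show ?thesis
      by (rule iffD2[OF DERIV_cong_ev[OF refl ev refl]])
        (rule DERIV_cong[OF powr_affine_deriv], use 3 in auto)
  next
    case 2
    have "((\<lambda>h. \<bar>h\<bar> powr e / h) \<longlongrightarrow> 0) (at (0::real))"
    proof (rule Lim_null_comparison)
      have "norm (\<bar>h\<bar> powr e / h) = \<bar>h\<bar> powr (e - 1)" if "h \<noteq> 0" for h :: real
        using that by (simp add: powr_diff abs_divide)
      then show "\<forall>\<^sub>F h in at (0::real). norm (\<bar>h\<bar> powr e / h) \<le> \<bar>h\<bar> powr (e - 1)"
        by (auto simp: eventually_at_filter)
      have "((\<lambda>h::real. \<bar>h\<bar> powr (e - 1)) \<longlongrightarrow> \<bar>0\<bar> powr (e - 1)) (at 0)"
        using assms by (intro tendsto_powr' tendsto_intros) auto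
      then show "((\<lambda>h::real. \<bar>h\<bar> powr (e - 1)) \<longlongrightarrow> 0) (at 0)" by simp
    qed
    then show ?thesis using 2 by (simp add: DERIV_def)
  qed
qed

lemma abs_powr_diff:
  fixes x y :: real
  assumes "1 < e" "\<bar>x\<bar> \<le> b" "\<bar>y\<bar> \<le> b"
  shows "\<bar>\<bar>x\<bar> powr e - \<bar>y\<bar> powr e\<bar> \<le> e * b powr (e - 1) * \<bar>x - y\<bar>"
proof -
  have "norm (\<bar>x\<bar> powr e - \<bar>y\<bar> powr e) \<le> e * b powr (e - 1) * norm (x - y)"
  proof (rule field_differentiable_bound[where S = "{-b..b}" and f' = "\<lambda>y. e * (\<bar>y\<bar> powr (e - 1) * sgn y)"])
    fix z assume z: "z \<in> {-b..b}"
    show "((\<lambda>y. \<bar>y\<bar> powr e) has_real_derivative e * (\<bar>z\<bar> powr (e - 1) * sgn z)) (at z within {-b..b})"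
      by (rule has_field_derivative_at_within[OF abs_powr_deriv[OF assms(1)]])
    have "\<bar>z\<bar> powr (e - 1) * \<bar>sgn z\<bar> \<le> b powr (e - 1) * 1"
      using z assms(1) by (intro mult_mono powr_mono2) (auto simp: sgn_if)
    then show "norm (e * (\<bar>z\<bar> powr (e - 1) * sgn z)) \<le> e * b powr (e - 1)"
      using assms(1) by (simp add: abs_mult)
  qed (use assms in \<open>auto simp: abs_le_iff\<close>)
  then show ?thesis by simp
qed

text \<open>The jump of \<open>sgn\<close> does no harm: the signed power is the difference of the
  powers of the positive and the negative part.\<close>

lemma continuous_on_abs_powr:
  fixes f :: "'b::topological_space \<Rightarrow> real"
  assumes "continuous_on S f" "0 < e"
  shows "continuous_on S (\<lambda>x. \<bar>f x\<bar> powr e)" "continuous_on S (\<lambda>x. \<bar>f x\<bar> powr e * sgn (f x))"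
proof -
  show "continuous_on S (\<lambda>x. \<bar>f x\<bar> powr e)"
    using assms by (intro continuous_on_powr' continuous_intros) auto
  have "\<bar>y\<bar> powr e * sgn y = (max 0 y) powr e - (max 0 (- y)) powr e" for y :: real
    using assms(2) by (auto simp: sgn_if max_def)
  moreover have "continuous_on S (\<lambda>x. (max 0 (f x)) powr e - (max 0 (- f x)) powr e)"
    using assms by (intro continuous_on_diff continuous_on_powr' continuous_intros) auto
  ultimately show "continuous_on S (\<lambda>x. \<bar>f x\<bar> powr e * sgn (f x))" by simp
qed

text \<open>If \<open>G t\<close> is the derivative of \<open>U t\<close> and \<open>U t 0 = 0\<close>, this is \<open>U t r / r\<close>, extended continuously to \<open>r = 0\<close>.\<close>

definition quo :: "(real \<Rightarrow> real \<Rightarrow> real) \<Rightarrow> real \<Rightarrow> real \<Rightarrow> real" where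
  "quo G t r = integral {0..1} (\<lambda>\<theta>. G t (r * \<theta>))"

lemma sint_quo: "sint (G t) r = r * quo G t r"
  by (simp add: sint_def quo_def)

lemma quo_cont:
  assumes "cont2 G"
  shows "cont2 (quo G)"
proof -
  have "continuous_on (UNIV \<times> cbox 0 1) (\<lambda>(z :: real \<times> real, \<theta>::real). G (fst z) (snd z * \<theta>))"
    unfolding case_prod_beta by (intro cont2_comp[OF assms] continuous_intros)
  from integral_continuous_on_param[OF this] show ?thesis by (simp add: quo_def case_prod_beta)
qed

text \<open>Differentiation under the integral treats r = 0 like any other radius, where a literal
  quotient by \<open>r\<close> would call for a limit.\<close>

lemma quo_deriv:
  assumes G: "cont2 G" and G': "cont2 G'" and d: "\<And>t r. ((\<lambda>t. G t r) has_real_derivative G' t r) (at t)"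
  shows "((\<lambda>t. quo G t r) has_real_derivative quo G' t r) (at t)"
proof -
  have "((\<lambda>t. integral (cbox 0 1) (\<lambda>\<theta>. G t (r * \<theta>))) has_real_derivative
      integral (cbox 0 1) (\<lambda>\<theta>. G' t (r * \<theta>))) (at t within UNIV)"
  proof (rule leibniz_rule_field_derivative)
    show "(\<lambda>\<theta>. G t (r * \<theta>)) integrable_on cbox 0 1" for t
      by (intro integrable_continuous cont2_comp[OF G] continuous_intros)
    show "continuous_on (UNIV \<times> cbox 0 1) (\<lambda>(t, \<theta>). G' t (r * \<theta>))"
      unfolding case_prod_beta by (intro cont2_comp[OF G'] continuous_intros)
  qed (use d in auto)
  then show ?thesis by (simp add: quo_def)
qed

lemma quo_0: "quo G t 0 = G t 0"
  by (simp add: quo_def)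

lemma quo_eq:
  assumes "\<And>r. (F has_real_derivative G t r) (at r)" "F 0 = 0" "r \<noteq> 0"
  shows "quo G t r = F r / r"
  using sint_eq[OF assms(1), of r] assms(2,3) by (simp add: sint_quo field_simps)

section \<open>The solution map and its bounds\<close>

lemma wt_le_1: "e \<le> 0 \<Longrightarrow> wt e x \<le> 1"
  unfolding wt_def using powr_mono[of e 0 "2 + \<bar>x\<bar>"] by (simp add: add_nonneg_eq_0_iff)

lemma wt_exp_mono: "e \<le> f \<Longrightarrow> wt e x \<le> wt f x"
  unfolding wt_def by (rule powr_mono) auto

lemma wt_powr: "wt e x powr f = wt (e * f) x"
  unfolding wt_def by (simp add: powr_powr)

text \<open>At x = 0 the value is 0 by the convention for division; the linear bound on
  \<open>X\<close> keeps the power bounded, so 0 is also the limit.\<close>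

lemma nonlinearity_cont:
  assumes X: "cont2 X" and b: "\<And>s x. \<bar>X s x\<bar> \<le> M * \<bar>x\<bar>" and e: "0 < e"
  shows "cont2 (\<lambda>s x. x * \<bar>X s x / x\<bar> powr e)"
proof -
  define G where "G z = snd z * \<bar>X (fst z) (snd z) / snd z\<bar> powr e" for z :: "real \<times> real"
  have "isCont G z" for z
  proof (cases "snd z = 0")
    case False
    have o: "open {z :: real \<times> real. snd z \<noteq> 0}"
      by (rule open_Collect_neq) (auto intro!: continuous_intros)
    have "continuous_on {z :: real \<times> real. snd z \<noteq> 0} (\<lambda>z. X (fst z) (snd z))"
      using continuous_on_subset[OF X] by (simp add: case_prod_beta)
    then have "continuous_on {z :: real \<times> real. snd z \<noteq> 0} G"
      unfolding G_def using e by (intro continuous_intros continuous_on_abs_powr) auto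
    then show ?thesis using False unfolding continuous_on_eq_continuous_at[OF o] by blast
  next
    case True
    have M: "0 \<le> M" using b[of 0 1] by (simp add: abs_ge_zero[THEN order.trans])
    have "norm (G w) \<le> \<bar>snd w\<bar> * M powr e" for w
    proof (cases "snd w = 0")
      case False
      have "\<bar>X (fst w) (snd w) / snd w\<bar> \<le> M" using b[of "fst w" "snd w"] False by (simp add: abs_divide field_simps)
      then have "\<bar>X (fst w) (snd w) / snd w\<bar> powr e \<le> M powr e" using e by (intro powr_mono2) auto
      then show ?thesis by (simp add: G_def abs_mult mult_left_mono)
    qed (simp add: G_def)
    then have le: "\<forall>\<^sub>F w in at z. norm (G w) \<le> \<bar>snd w\<bar> * M powr e" by (rule always_eventually[OF allI])
    have "((\<lambda>w. \<bar>snd w\<bar> * M powr e) \<longlongrightarrow> \<bar>snd z\<bar> * M powr e) (at z)" by (intro tendsto_intros)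
    then have lim: "((\<lambda>w. \<bar>snd w\<bar> * M powr e) \<longlongrightarrow> 0) (at z)" unfolding True by simp
    have "(G \<longlongrightarrow> 0) (at z)" by (rule Lim_null_comparison[OF le lim])
    then show ?thesis using True by (simp add: isCont_def G_def)
  qed
  then have "continuous_on UNIV G" by (intro continuous_at_imp_continuous_on) auto
  then show ?thesis by (simp add: G_def case_prod_beta)
qed

section \<open>The coupled system for the profiles\<close>

text \<open>\<open>D1\<close> and \<open>D2\<close> are the free profiles of r u and r v, and
  \<open>P2\<close> is the derivative of \<open>D2\<close> along outgoing rays. The amplitude
  \<epsilon> is kept outside, so that \<open>C\<close> can be chosen before it.\<close>

locale coupled =
  fixes p q \<kappa> C \<epsilon> M :: real
    and D1 Dt1 Dr1 Dtt1 Dtr1 D2 Dt2 Dr2 Dtt2 P2 :: "real \<Rightarrow> real \<Rightarrow> real"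
  assumes par: "1 < q" "q < 2" "2 < p" "0 < \<kappa>" "\<kappa> \<le> 1" "\<kappa> * q < 1" "1 < \<kappa> * q * p" "\<kappa> \<le> p * (q - 1) - 2"
    and pos: "0 < \<epsilon>" "0 < M" "0 < C"
    and w1: "free_wave D1 Dt1 Dr1 Dtt1" "cont2 Dtr1"
      "\<And>t r. (Dt1 t has_real_derivative Dtr1 t r) (at r)" "\<And>t r. ((\<lambda>t. Dr1 t r) has_real_derivative Dtr1 t r) (at t)"
      "\<And>t r. D1 t (- r) = - D1 t r" "\<And>t r. Dt1 t (- r) = - Dt1 t r"
    and w1_le: "\<And>t r. \<lbrakk>0 \<le> t; 0 \<le> r\<rbrakk> \<Longrightarrow> \<bar>Dt1 t r\<bar> \<le> C * (r * wt (1 - q) (t + r) * wt (- (\<kappa> * q)) (t - r))"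
    and w2: "free_wave D2 Dt2 Dr2 Dtt2" "\<And>t r. D2 t (- r) = - D2 t r"
      "\<And>c s. ((\<lambda>s. D2 s (c + s)) has_real_derivative P2 s (c + s)) (at s)"
    and w2_le: "\<And>t r. \<lbrakk>0 \<le> t; 0 \<le> r\<rbrakk> \<Longrightarrow> \<bar>P2 t r\<bar> \<le> C * wt (- 1 - \<kappa>) (t + r)"
      "\<And>r. 0 \<le> r \<Longrightarrow> \<bar>D2 0 r\<bar> \<le> C * r * wt (- 1 - \<kappa>) r"
begin

text \<open>\<open>M\<close> and \<open>N\<close> are the sizes of \<open>r u\<^sub>t\<close> and \<open>r v\<close> in the weighted norms. Clamping the time in \<open>K\<close> makes
  it continuous on the whole plane; only times \<open>s \<ge> 0\<close> matter.\<close>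

definition "N = (\<epsilon> * C + M powr p / (\<kappa> * q * p - 1)) * (1 / \<kappa> + 2)"
definition "weak_const = 1 / (1 - \<kappa> * q) + 1 / (2 - q)"

definition K :: "(real \<times> real \<Rightarrow> real) \<Rightarrow> real \<Rightarrow> real \<Rightarrow> real" where
  "K W s x = x * \<bar>W (max 0 s, x) / x\<bar> powr p"
definition V :: "(real \<times> real \<Rightarrow> real) \<Rightarrow> real \<Rightarrow> real \<Rightarrow> real" where
  "V W t r = \<epsilon> * D2 t r + duhamel (K W) t r"
definition Vr :: "(real \<times> real \<Rightarrow> real) \<Rightarrow> real \<Rightarrow> real \<Rightarrow> real" where
  "Vr W t r = \<epsilon> * Dr2 t r + duhamel_r (K W) t r"
definition P :: "(real \<times> real \<Rightarrow> real) \<Rightarrow> real \<Rightarrow> real \<Rightarrow> real" where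
  "P W t r = \<epsilon> * P2 t r + sint (\<lambda>s. K W s (r + t - s)) t"
definition H :: "(real \<times> real \<Rightarrow> real) \<Rightarrow> real \<Rightarrow> real \<Rightarrow> real" where
  "H W s x = x * \<bar>quo (Vr W) s x\<bar> powr q"
definition picard :: "(real \<times> real \<Rightarrow> real) \<Rightarrow> real \<times> real \<Rightarrow> real" where
  "picard W z = \<epsilon> * Dt1 (fst z) (snd z) + duhamel_t (H W) (fst z) (snd z)"

text \<open>The ball of radius \<open>M\<close> in the stronger norm, among continuous odd
  functions. Nothing is prescribed at negative times.\<close>

definition good :: "(real \<times> real \<Rightarrow> real) set" where
  "good = {W. continuous_on ({0..} \<times> UNIV) W \<and> (\<forall>t\<ge>0. \<forall>r. W (t, - r) = - W (t, r)) \<and>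
    (\<forall>t\<ge>0. \<forall>r\<ge>0. \<bar>W (t, r)\<bar> \<le> M * (r * wt (1 - q) (t + r) * wt (- (\<kappa> * q)) (t - r)))}"

lemma a01: "0 < \<kappa> * q" using par by simp

lemma N_pos: "0 < N" and weak_const_pos: "0 < weak_const"
proof -
  have "0 \<le> M powr p / (\<kappa> * q * p - 1)" using par by simp
  then have "0 < \<epsilon> * C + M powr p / (\<kappa> * q * p - 1)" using pos by (intro add_pos_nonneg) auto
  then show "0 < N" unfolding N_def using par by (intro mult_pos_pos) (auto intro: add_pos_pos)
  show "0 < weak_const" unfolding weak_const_def using par by (auto intro!: add_pos_pos)
qed

context
  fixes W assumes W: "W \<in> good"
begin

lemma W_le: "0 \<le> t \<Longrightarrow> 0 \<le> r \<Longrightarrow> \<bar>W (t, r)\<bar> \<le> M * (r * wt (1 - q) (t + r) * wt (- (\<kappa> * q)) (t - r))"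
  and W_odd: "0 \<le> t \<Longrightarrow> W (t, - r) = - W (t, r)"
  using W by (auto simp: good_def)

lemma W_div_le:
  assumes "0 \<le> s" "0 < x"
  shows "\<bar>W (max 0 s, x) / x\<bar> \<le> M * wt (1 - q) (s + x) * wt (- (\<kappa> * q)) (s - x)"
  using W_le[of s x] assms by (simp add: abs_divide field_simps max_def)

lemma K_cont: "cont2 (K W)"
proof -
  have "continuous_on UNIV (\<lambda>z :: real \<times> real. W (max 0 (fst z), snd z))"
    by (rule continuous_on_compose2[of "{0..} \<times> UNIV" W]) (use W in \<open>auto simp: good_def intro!: continuous_intros\<close>)
  then have c: "cont2 (\<lambda>s x. W (max 0 s, x))" by (simp add: case_prod_beta)
  have b: "\<bar>W (max 0 s, x)\<bar> \<le> M * \<bar>x\<bar>" for s x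
  proof -
    have *: "\<bar>W (t, r)\<bar> \<le> M * r" if "0 \<le> t" "0 \<le> r" for t r
    proof -
      have "wt (1 - q) (t + r) * wt (- (\<kappa> * q)) (t - r) \<le> 1 * 1"
        using par by (intro mult_mono wt_le_1) auto
      then have "M * (r * (wt (1 - q) (t + r) * wt (- (\<kappa> * q)) (t - r))) \<le> M * (r * (1 * 1))"
        using that pos by (intro mult_left_mono) auto
      then show ?thesis using W_le[OF that] by (simp add: mult.assoc)
    qed
    show ?thesis
      using *[of "max 0 s" x] *[of "max 0 s" "- x"] W_odd[of "max 0 s" x] by (cases "0 \<le> x") auto
  qed
  have "K W = (\<lambda>s x. x * \<bar>W (max 0 s, x) / x\<bar> powr p)" by (simp add: K_def fun_eq_iff)
  then show ?thesis using nonlinearity_cont[OF c b, of p] par by simp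
qed

lemma K_odd: "K W s (- x) = - K W s x"
  using W_odd[of "max 0 s" x] by (simp add: K_def)

text \<open>On the left is the exponent of A in the source: p times 1 - q from |W/r|^p, and 1 from r
  <= A.\<close>

lemma source_exponent: "1 + (1 - q) * p \<le> - 1 - \<kappa>"
  using par(8) by (simp add: algebra_simps)

lemma K_le:
  assumes "0 \<le> s" "0 \<le> x"
  shows "\<bar>K W s x\<bar> \<le> M powr p * wt (- 1 - \<kappa>) (s + x) * wt (- (\<kappa> * q * p)) (s - x)"
proof (cases "x = 0")
  case False
  then have x: "0 < x" using assms by simp
  have "\<bar>W (max 0 s, x) / x\<bar> powr p \<le> (M * wt (1 - q) (s + x) * wt (- (\<kappa> * q)) (s - x)) powr p"
    using par W_div_le[OF assms(1) x] by (intro powr_mono2) auto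
  also have "\<dots> = M powr p * wt ((1 - q) * p) (s + x) * wt (- (\<kappa> * q * p)) (s - x)"
    using pos by (simp add: powr_mult wt_powr)
  finally have "x * \<bar>W (max 0 s, x) / x\<bar> powr p \<le> wt 1 (s + x) * (M powr p * wt ((1 - q) * p) (s + x) * wt (- (\<kappa> * q * p)) (s - x))"
    using assms by (intro mult_mono) (auto simp: wt_def)
  also have "\<dots> = M powr p * wt (1 + (1 - q) * p) (s + x) * wt (- (\<kappa> * q * p)) (s - x)"
    by (simp add: wt_add)
  also have "\<dots> \<le> M powr p * wt (- 1 - \<kappa>) (s + x) * wt (- (\<kappa> * q * p)) (s - x)"
    by (intro mult_right_mono mult_left_mono wt_exp_mono source_exponent) auto
  finally show ?thesis using x by (simp add: K_def abs_mult)
qed (simp add: K_def)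

lemma Vr_cont: "cont2 (Vr W)"
  using duhamel_r_cont[OF K_cont] w2(1) unfolding Vr_def free_wave_def case_prod_beta by (intro continuous_intros) auto

lemma V_deriv_r: "(V W t has_real_derivative Vr W t r) (at r)"
  using duhamel_deriv_r[OF K_cont] w2(1) unfolding V_def[abs_def] Vr_def free_wave_def
  by (intro DERIV_add DERIV_cmult) auto

lemma V_odd: "V W t (- r) = - V W t r"
  using w2(2) duhamel_odd(1)[of "K W", OF K_odd] by (simp add: V_def)

lemma V_0: "V W t 0 = 0" using V_odd[of t 0] by simp

lemma V_eq_quo: "V W t r = r * quo (Vr W) t r"
  using sint_eq[OF V_deriv_r, of t r] V_0 by (simp add: sint_quo)

lemma quo_even: "quo (Vr W) t (- r) = quo (Vr W) t r"
proof (cases "r = 0")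
  case False
  have "r * quo (Vr W) t (- r) = r * quo (Vr W) t r"
    using V_odd[of t r] by (simp add: V_eq_quo)
  then show ?thesis using False by simp
qed simp

lemma V_char: "((\<lambda>s. V W s (c + s)) has_real_derivative P W s (c + s)) (at s)"
proof -
  have e: "c + s + s - s' = c + 2 * s - s'" for s' by simp
  show ?thesis
    unfolding V_def P_def e by (rule DERIV_add[OF DERIV_cmult[OF w2(3)] duhamel_deriv_char[OF K_cont]])
qed

lemma P_le0:
  assumes "0 \<le> t" "0 \<le> r"
  shows "\<bar>P W t r\<bar> \<le> (\<epsilon> * C + M powr p / (\<kappa> * q * p - 1)) * wt (- 1 - \<kappa>) (t + r)"
proof -
  have "\<bar>sint (\<lambda>s. K W s (r + t - s)) t\<bar> \<le> M powr p / (\<kappa> * q * p - 1) * wt (- 1 - \<kappa>) (t + r)"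
    by (rule incoming_ray_bound[OF K_cont par(7) assms K_le]) auto
  moreover have "\<bar>\<epsilon> * P2 t r\<bar> \<le> \<epsilon> * (C * wt (- 1 - \<kappa>) (t + r))"
    unfolding abs_mult using w2_le(1)[OF assms] pos by (simp add: mult_left_mono)
  ultimately show ?thesis
    unfolding P_def distrib_right mult.assoc by (rule order.trans[OF abs_triangle_ineq add_mono, rotated])
qed

text \<open>The constant is enlarged to \<open>N\<close> so that in \<open>H_diff\<close> this
  derivative and V/r obey the same bound.\<close>

lemma P_le:
  assumes "0 \<le> t" "0 \<le> r"
  shows "\<bar>P W t r\<bar> \<le> N * wt (- 1 - \<kappa>) (t + r)"
proof -
  have "0 \<le> M powr p / (\<kappa> * q * p - 1)" using par by simp
  then have "0 \<le> \<epsilon> * C + M powr p / (\<kappa> * q * p - 1)" using pos by (intro add_nonneg_nonneg) auto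
  then have "(\<epsilon> * C + M powr p / (\<kappa> * q * p - 1)) * 1 \<le> N"
    unfolding N_def using par by (intro mult_left_mono) auto
  then show ?thesis by (intro order.trans[OF P_le0[OF assms] mult_right_mono]) auto
qed

lemma V_le:
  assumes "0 \<le> t" "0 \<le> r"
  shows "\<bar>V W t r\<bar> \<le> N * (r * wt (- 1) (t + r) * wt (- \<kappa>) (t - r))"
  unfolding N_def
proof (rule characteristic_bound[OF V_char P_le0 V_0 _ par(4,5) _ assms])
  have n: "0 \<le> M powr p / (\<kappa> * q * p - 1)" using par by simp
  then show "0 \<le> \<epsilon> * C + M powr p / (\<kappa> * q * p - 1)" using pos by (intro add_nonneg_nonneg) auto
  fix r :: real assume r: "0 \<le> r"
  have "\<bar>V W 0 r\<bar> = \<epsilon> * \<bar>D2 0 r\<bar>" using pos by (simp add: V_def abs_mult duhamel_0[OF K_cont])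
  also have "\<dots> \<le> \<epsilon> * (C * r * wt (- 1 - \<kappa>) r)" using w2_le(2)[OF r] pos by (intro mult_left_mono) auto
  also have "\<dots> = (\<epsilon> * C) * (r * wt (- 1 - \<kappa>) r)" by simp
  also have "\<dots> \<le> (\<epsilon> * C + M powr p / (\<kappa> * q * p - 1)) * (r * wt (- 1 - \<kappa>) r)"
    using n r by (intro mult_right_mono) auto
  finally show "\<bar>V W 0 r\<bar> \<le> (\<epsilon> * C + M powr p / (\<kappa> * q * p - 1)) * r * wt (- 1 - \<kappa>) r" by (simp add: mult.assoc)
qed auto

lemma quo_le:
  assumes "0 \<le> s" "0 < x"
  shows "\<bar>quo (Vr W) s x\<bar> \<le> N * wt (- 1) (s + x) * wt (- \<kappa>) (s - x)"
proof -
  have "x * \<bar>quo (Vr W) s x\<bar> \<le> x * (N * wt (- 1) (s + x) * wt (- \<kappa>) (s - x))"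
    using V_le[of s x] assms by (simp add: V_eq_quo abs_mult mult_ac)
  then show ?thesis using assms by simp
qed

lemma H_cont: "cont2 (H W)"
proof -
  have "continuous_on UNIV (\<lambda>z. \<bar>quo (Vr W) (fst z) (snd z)\<bar> powr q)"
    using continuous_on_abs_powr(1)[OF quo_cont[OF Vr_cont], of q] par(1) by (simp add: case_prod_beta)
  then show ?thesis
    unfolding H_def case_prod_beta by (rule continuous_on_mult[OF continuous_on_snd[OF continuous_on_id]])
qed

lemma H_odd: "H W s (- x) = - H W s x"
  by (simp add: H_def quo_even)

text \<open>The 3 is slack: the Duhamel bounds take one constant for the size of \<open>H\<close>
  and for its outgoing increments, and \<open>H_diff\<close> calls for 3.\<close>

lemma H_le:
  assumes "0 \<le> s" "0 \<le> x"
  shows "\<bar>H W s x\<bar> \<le> 3 * N powr q * (x * wt (- q) (s + x) * wt (- (\<kappa> * q)) (s - x))"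
proof (cases "x = 0")
  case False
  then have x: "0 < x" using assms by simp
  have "\<bar>quo (Vr W) s x\<bar> powr q \<le> (N * wt (- 1) (s + x) * wt (- \<kappa>) (s - x)) powr q"
    using par quo_le[OF assms(1) x] by (intro powr_mono2) auto
  also have "\<dots> = N powr q * wt (- q) (s + x) * wt (- (\<kappa> * q)) (s - x)"
    using N_pos by (simp add: powr_mult wt_powr)
  finally have "x * \<bar>quo (Vr W) s x\<bar> powr q \<le> x * (N powr q * wt (- q) (s + x) * wt (- (\<kappa> * q)) (s - x))"
    using assms by (intro mult_left_mono)
  also have "\<dots> \<le> 3 * (x * (N powr q * wt (- q) (s + x) * wt (- (\<kappa> * q)) (s - x)))"
    using assms by simp
  finally show ?thesis using x by (simp add: H_def abs_mult mult_ac)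
qed (simp add: H_def)

text \<open>Put \<nu> = V/r on the outgoing ray, so that H = r |\<nu>|^q. The derivative of \<nu> is
  (P - \<nu>)/r, and the factor r cancels its singularity: the derivative of H is (1 - q) |\<nu>|^q
  + q |\<nu>|^(q-1) sgn(\<nu>) P. Both |\<nu>| and |P| are at most \<open>b\<close>, and (q - 1) + q
  <= 3.\<close>

lemma H_diff:
  assumes "0 \<le> s" "0 \<le> x" "0 \<le> d"
  shows "\<bar>H W (s + d) (x + d) - H W s x\<bar> \<le> 3 * N powr q * d * (wt (- q) (s + x) * wt (- (\<kappa> * q)) (s - x))"
proof (cases "d = 0")
  case False
  then have d: "0 < d" using assms by simp
  define b where "b = N * wt (- 1) (s + x) * wt (- \<kappa>) (s - x)"
  have b: "0 < b" using N_pos by (simp add: b_def)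
  define \<nu> where "\<nu> \<rho> = V W (s + \<rho>) (x + \<rho>) / (x + \<rho>)" for \<rho>
  define h where "h \<rho> = H W (s + \<rho>) (x + \<rho>)" for \<rho>
  have h\<nu>: "h \<rho> = (x + \<rho>) * \<bar>\<nu> \<rho>\<bar> powr q" if "0 < x + \<rho>" for \<rho>
    using that by (simp add: h_def \<nu>_def H_def V_eq_quo)
  define \<nu>' where "\<nu>' \<rho> = (P W (s + \<rho>) (x + \<rho>) - \<nu> \<rho>) / (x + \<rho>)" for \<rho>
  define h' where "h' \<rho> = \<bar>\<nu> \<rho>\<bar> powr q + (x + \<rho>) * (q * (\<bar>\<nu> \<rho>\<bar> powr (q - 1) * sgn (\<nu> \<rho>)) * \<nu>' \<rho>)" for \<rho>
  have dh: "(h has_real_derivative h' \<rho>) (at \<rho>)" and h'_le: "\<bar>h' \<rho>\<bar> \<le> 3 * b powr q" if \<rho>: "0 < \<rho>" for \<rho>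
  proof -
    have x0: "0 < x + \<rho>" using \<rho> assms by simp
    have "((\<lambda>\<sigma>. V W \<sigma> ((x - s) + \<sigma>)) has_real_derivative P W (s + \<rho>) ((x - s) + (s + \<rho>))) (at (\<rho> + s))"
      using V_char[of "x - s" "s + \<rho>"] by (simp add: add.commute)
    then have dV: "((\<lambda>\<rho>. V W (s + \<rho>) (x + \<rho>)) has_real_derivative P W (s + \<rho>) (x + \<rho>)) (at \<rho>)"
      using DERIV_shift[of "\<lambda>\<sigma>. V W \<sigma> ((x - s) + \<sigma>)" "P W (s + \<rho>) (x + \<rho>)" \<rho> s] by (simp add: algebra_simps)
    have dx: "((\<lambda>\<rho>. x + \<rho>) has_real_derivative 1) (at \<rho>)" by (auto intro!: derivative_eq_intros)
    have d\<nu>: "(\<nu> has_real_derivative \<nu>' \<rho>) (at \<rho>)"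
      unfolding \<nu>_def[abs_def]
      by (rule DERIV_cong[OF DERIV_divide[OF dV dx]]) (use x0 in \<open>simp_all add: \<nu>'_def \<nu>_def field_simps\<close>)
    have dh0: "((\<lambda>\<rho>. (x + \<rho>) * \<bar>\<nu> \<rho>\<bar> powr q) has_real_derivative h' \<rho>) (at \<rho>)"
      by (rule DERIV_cong[OF DERIV_mult[OF dx DERIV_chain2[where f = "\<lambda>y. \<bar>y\<bar> powr q" and g = \<nu>, OF abs_powr_deriv[OF par(1)] d\<nu>]]])
        (simp add: h'_def)
    have "\<forall>\<^sub>F \<rho> in nhds \<rho>. \<rho> \<in> {0<..}" using \<rho> by (intro eventually_nhds_in_open) auto
    then have ev: "\<forall>\<^sub>F \<rho> in nhds \<rho>. h \<rho> = (x + \<rho>) * \<bar>\<nu> \<rho>\<bar> powr q"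
      by eventually_elim (use h\<nu> assms in auto)
    show "(h has_real_derivative h' \<rho>) (at \<rho>)" by (rule iffD2[OF DERIV_cong_ev[OF refl ev refl] dh0])
    have e: "s + \<rho> + (x + \<rho>) = s + x + 2 * \<rho>" "s + \<rho> - (x + \<rho>) = s - x" by auto
    have wm: "wt (- 1) (s + x + 2 * \<rho>) \<le> wt (- 1) (s + x)" using assms \<rho> by (intro wt_anti) auto
    have \<nu>b: "\<bar>\<nu> \<rho>\<bar> \<le> b"
    proof -
      have "\<bar>\<nu> \<rho>\<bar> \<le> N * wt (- 1) (s + x + 2 * \<rho>) * wt (- \<kappa>) (s - x)"
        using quo_le[of "s + \<rho>" "x + \<rho>"] x0 assms \<rho> unfolding e by (simp add: \<nu>_def V_eq_quo)
      also have "\<dots> \<le> b" unfolding b_def using N_pos wm by (intro mult_right_mono mult_left_mono) auto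
      finally show ?thesis .
    qed
    \<comment> \<open>The decay of \<open>P\<close> beyond A^(-1) is traded, by B <= A, for
      B^(-\<kappa>), which is constant along the ray.\<close>
    have Pb: "\<bar>P W (s + \<rho>) (x + \<rho>)\<bar> \<le> b"
    proof -
      have "\<bar>P W (s + \<rho>) (x + \<rho>)\<bar> \<le> N * wt (- 1 - \<kappa>) (s + x + 2 * \<rho>)"
        using P_le[of "s + \<rho>" "x + \<rho>"] x0 assms \<rho> unfolding e by simp
      also have "\<dots> = N * (wt (- 1) (s + x + 2 * \<rho>) * wt (- \<kappa>) (s + x + 2 * \<rho>))"
        using wt_add[of "-1" "- \<kappa>"] by simp
      also have "\<dots> \<le> N * (wt (- 1) (s + x) * wt (- \<kappa>) (s - x))"
        using N_pos wm assms \<rho> par by (intro mult_left_mono mult_mono wt_anti) auto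
      finally show ?thesis by (simp add: b_def mult.assoc)
    qed
    have "h' \<rho> = (1 - q) * \<bar>\<nu> \<rho>\<bar> powr q + q * (\<bar>\<nu> \<rho>\<bar> powr (q - 1) * sgn (\<nu> \<rho>)) * P W (s + \<rho>) (x + \<rho>)"
    proof -
      have "(x + \<rho>) * \<nu>' \<rho> = P W (s + \<rho>) (x + \<rho>) - \<nu> \<rho>" using x0 by (simp add: \<nu>'_def)
      moreover have "\<bar>\<nu> \<rho>\<bar> powr (q - 1) * sgn (\<nu> \<rho>) * \<nu> \<rho> = \<bar>\<nu> \<rho>\<bar> powr q"
        by (cases "\<nu> \<rho> = 0") (simp_all add: powr_diff sgn_if abs_if)
      ultimately show ?thesis unfolding h'_def by algebra
    qed
    moreover have "\<bar>(1 - q) * \<bar>\<nu> \<rho>\<bar> powr q\<bar> \<le> (q - 1) * b powr q"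
      using par \<nu>b by (auto simp: abs_mult intro!: mult_left_mono powr_mono2)
    moreover have "\<bar>q * (\<bar>\<nu> \<rho>\<bar> powr (q - 1) * sgn (\<nu> \<rho>)) * P W (s + \<rho>) (x + \<rho>)\<bar> \<le> q * b powr q"
    proof -
      have "\<bar>\<nu> \<rho>\<bar> powr (q - 1) * \<bar>sgn (\<nu> \<rho>)\<bar> * \<bar>P W (s + \<rho>) (x + \<rho>)\<bar> \<le> b powr (q - 1) * 1 * b"
        using par \<nu>b Pb by (intro mult_mono powr_mono2) (auto simp: sgn_if)
      also have "\<dots> = b powr q" using b by (simp add: powr_diff)
      finally show ?thesis using par by (simp add: abs_mult mult.assoc)
    qed
    ultimately have "\<bar>h' \<rho>\<bar> \<le> (q - 1) * b powr q + q * b powr q" by linarith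
    also have "\<dots> = (2 * q - 1) * b powr q" by (simp add: algebra_simps)
    also have "\<dots> \<le> 3 * b powr q" using par by (intro mult_right_mono) auto
    finally show "\<bar>h' \<rho>\<bar> \<le> 3 * b powr q" .
  qed
  \<comment> \<open>As \<open>x\<close> may be 0, the derivative is known in the interior only;
    continuity covers the end on the axis.\<close>
  have "continuous_on {0..d} h" unfolding h_def
    by (intro cont2_comp[OF H_cont] continuous_intros)
  then obtain \<xi> where \<xi>: "0 < \<xi>" "\<xi> < d" "h d - h 0 = h' \<xi> * (d - 0)"
    using mvt[OF d, of h "\<lambda>\<xi>. (*) (h' \<xi>)"] dh by (auto simp: has_field_derivative_def)
  have "\<bar>h d - h 0\<bar> \<le> 3 * b powr q * d" using \<xi> h'_le[OF \<xi>(1)] d by (simp add: abs_mult)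
  also have "b powr q = N powr q * (wt (- q) (s + x) * wt (- (\<kappa> * q)) (s - x))"
    unfolding b_def using N_pos by (simp add: powr_mult wt_powr mult.assoc)
  finally show ?thesis by (simp add: h_def mult_ac)
qed simp

lemma picard_good:
  assumes small: "\<epsilon> * C + 3 * N powr q * (3 * weak_const + 4) \<le> M"
  shows "picard W \<in> good"
proof -
  have c: "continuous_on UNIV (picard W)"
    using duhamel_t_cont[OF H_cont] w1(1) unfolding picard_def[abs_def] free_wave_def case_prod_beta
    by (intro continuous_intros) auto
  have o: "picard W (t, - r) = - picard W (t, r)" for t r
    using w1(6) duhamel_odd(2)[of "H W", OF H_odd] by (simp add: picard_def)
  have b: "\<bar>picard W (t, r)\<bar> \<le> M * (r * wt (1 - q) (t + r) * wt (- (\<kappa> * q)) (t - r))" if tr: "0 \<le> t" "0 \<le> r" for t r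
  proof -
    define Q where "Q = r * wt (1 - q) (t + r) * wt (- (\<kappa> * q)) (t - r)"
    have Q: "0 \<le> Q" using tr by (simp add: Q_def)
    have "\<bar>duhamel_t (H W) t r\<bar> \<le> 3 * N powr q * (3 * (1 / (1 - \<kappa> * q) + 1 / (2 - q)) + 4) * (r * wt (1 - q) (t + r) * wt (- (\<kappa> * q)) (t - r))"
      by (rule duhamel_t_strong_bound[OF H_cont par(1,2) a01 par(6) _ H_odd H_le tr H_diff]) auto
    then have 1: "\<bar>duhamel_t (H W) t r\<bar> \<le> 3 * N powr q * (3 * weak_const + 4) * Q" by (simp only: weak_const_def Q_def)
    have 2: "\<bar>\<epsilon> * Dt1 t r\<bar> \<le> \<epsilon> * (C * Q)"
      unfolding abs_mult using w1_le[OF tr] pos by (simp add: mult_left_mono Q_def)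
    have "\<bar>picard W (t, r)\<bar> \<le> \<epsilon> * (C * Q) + 3 * N powr q * (3 * weak_const + 4) * Q"
      using order.trans[OF abs_triangle_ineq add_mono[OF 2 1]] by (simp add: picard_def)
    also have "\<dots> = (\<epsilon> * C + 3 * N powr q * (3 * weak_const + 4)) * Q" by (simp add: algebra_simps)
    also have "\<dots> \<le> M * Q" by (intro mult_right_mono small Q)
    finally show ?thesis by (simp add: Q_def)
  qed
  show ?thesis using o b continuous_on_subset[OF c, of "{0..} \<times> UNIV"] by (simp add: good_def)
qed

end

end

section \<open>Contraction in the weaker norm\<close>

context coupled
begin

text \<open>The weight of the weaker norm, in which the solution map contracts.\<close>

definition \<Phi> :: "real \<times> real \<Rightarrow> real" where
  "\<Phi> z = wt (2 - q) (fst z + \<bar>snd z\<bar>) * wt (- (\<kappa> * q)) (fst z - \<bar>snd z\<bar>)"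

lemma \<Phi>_pos: "0 < \<Phi> z" by (simp add: \<Phi>_def)

lemma \<Phi>_cont: "continuous_on S \<Phi>"
  unfolding \<Phi>_def[abs_def] by (intro continuous_intros wt_cont)

lemma strong_le_\<Phi>:
  assumes "0 \<le> t" "0 \<le> r"
  shows "r * wt (1 - q) (t + r) * wt (- (\<kappa> * q)) (t - r) \<le> \<Phi> (t, r)"
proof -
  have "r * wt (1 - q) (t + r) \<le> wt 1 (t + r) * wt (1 - q) (t + r)"
    using assms by (intro mult_right_mono) (auto simp: wt_def)
  also have "\<dots> = wt (2 - q) (t + r)" using wt_add[of 1 "1 - q"] by simp
  finally show ?thesis using assms by (simp add: \<Phi>_def mult_right_mono)
qed

text \<open>The Lipschitz factors of the successive steps: p M^(p-1) for the source
  \<open>K\<close>, the two ray integrations leading to \<open>V\<close>, q N^(q-1) for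
  \<open>H\<close>, and \<open>weak_const\<close> for the last integration.\<close>

definition contraction_const :: real where
  "contraction_const = q * N powr (q - 1) * (p * M powr (p - 1) / (\<kappa> * q * p - 1) * (1 / \<kappa> + 2)) * weak_const"

text \<open>The factor \<open>x\<close> of the source cancels the division of W1 - W2 by
  \<open>x\<close>, so a weight that does not vanish on the axis suffices. The exponent (1 - q)(p -
  1) + (2 - q) equals 1 + (1 - q)p, the one in \<open>K_le\<close>.\<close>

lemma K_diff_le:
  assumes W: "W1 \<in> good" "W2 \<in> good" and d: "0 \<le> d"
    and le: "\<And>t r. 0 \<le> t \<Longrightarrow> \<bar>W1 (t, r) - W2 (t, r)\<bar> \<le> d * \<Phi> (t, r)"
    and sx: "0 \<le> s" "0 \<le> x"
  shows "\<bar>K W1 s x - K W2 s x\<bar> \<le> p * M powr (p - 1) * d * wt (- 1 - \<kappa>) (s + x) * wt (- (\<kappa> * q * p)) (s - x)"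
proof (cases "x = 0")
  case True
  then show ?thesis using par pos d by (simp add: K_def)
next
  case False
  then have x: "0 < x" using sx by simp
  define b where "b = M * wt (1 - q) (s + x) * wt (- (\<kappa> * q)) (s - x)"
  have "\<bar>\<bar>W1 (s, x) / x\<bar> powr p - \<bar>W2 (s, x) / x\<bar> powr p\<bar> \<le> p * b powr (p - 1) * \<bar>W1 (s, x) / x - W2 (s, x) / x\<bar>"
    using W_div_le[OF W(1) sx(1) x] W_div_le[OF W(2) sx(1) x] par sx
    by (intro abs_powr_diff) (auto simp: b_def max_def)
  then have "x * \<bar>\<bar>W1 (s, x) / x\<bar> powr p - \<bar>W2 (s, x) / x\<bar> powr p\<bar> \<le> x * (p * b powr (p - 1) * \<bar>W1 (s, x) / x - W2 (s, x) / x\<bar>)"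
    using sx by (intro mult_left_mono)
  also have "\<dots> = p * b powr (p - 1) * \<bar>W1 (s, x) - W2 (s, x)\<bar>"
    using x by (simp add: diff_divide_distrib[symmetric] abs_divide)
  also have "\<dots> \<le> p * b powr (p - 1) * (d * \<Phi> (s, x))"
    using le[OF sx(1)] par by (intro mult_left_mono) auto
  also have "\<dots> = p * M powr (p - 1) * d * (wt ((1 - q) * (p - 1) + (2 - q)) (s + x) * wt (- (\<kappa> * q) * (p - 1) - \<kappa> * q) (s - x))"
    unfolding b_def \<Phi>_def using pos sx wt_add[of "- (\<kappa> * q) * (p - 1)" "- (\<kappa> * q)" "s - x"] 
    by (simp add: powr_mult wt_powr wt_add mult_ac)
  also have "\<dots> \<le> p * M powr (p - 1) * d * (wt (- 1 - \<kappa>) (s + x) * wt (- (\<kappa> * q * p)) (s - x))"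
  proof (intro mult_left_mono mult_mono wt_exp_mono)
    show "(1 - q) * (p - 1) + (2 - q) \<le> - 1 - \<kappa>" using par(8) by (simp add: algebra_simps)
    show "- (\<kappa> * q) * (p - 1) - \<kappa> * q \<le> - (\<kappa> * q * p)" by (simp add: algebra_simps)
  qed (use par d in auto)
  also have "x * \<bar>\<bar>W1 (s, x) / x\<bar> powr p - \<bar>W2 (s, x) / x\<bar> powr p\<bar> = \<bar>K W1 s x - K W2 s x\<bar>"
    using sx by (simp add: K_def max_def abs_mult right_diff_distrib[symmetric])
  finally show ?thesis by (simp add: mult.assoc)
qed

text \<open>In the difference of the two functions \<open>V\<close> the free parts cancel, so its
  initial values are zero. \<open>characteristic_bound\<close> then recovers the factor
  \<open>x\<close> that the weight \<Phi> lacks.\<close>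

lemma H_diff_le:
  assumes W: "W1 \<in> good" "W2 \<in> good" and d: "0 \<le> d"
    and le: "\<And>t r. 0 \<le> t \<Longrightarrow> \<bar>W1 (t, r) - W2 (t, r)\<bar> \<le> d * \<Phi> (t, r)"
    and sx: "0 \<le> s" "0 \<le> x"
  shows "\<bar>H W1 s x - H W2 s x\<bar> \<le> q * N powr (q - 1) * (p * M powr (p - 1) * d / (\<kappa> * q * p - 1) * (1 / \<kappa> + 2)) *
    (x * wt (- q) (s + x) * wt (- (\<kappa> * q)) (s - x))"
proof (cases "x = 0")
  case True
  then show ?thesis by (simp add: H_def)
next
  case False
  then have x: "0 < x" using sx by simp
  define c where "c = p * M powr (p - 1) * d / (\<kappa> * q * p - 1)"
  have c: "0 \<le> c" using par d by (simp add: c_def)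
  define N' where "N' = c * (1 / \<kappa> + 2)"
  have N': "0 \<le> N'" using c par by (simp add: N'_def)
  have "\<bar>V W1 s x - V W2 s x\<bar> \<le> c * (1 / \<kappa> + 2) * (x * wt (- 1) (s + x) * wt (- \<kappa>) (s - x))"
  proof (rule characteristic_bound[where V = "\<lambda>t r. V W1 t r - V W2 t r" and P = "\<lambda>t r. P W1 t r - P W2 t r"])
    show "((\<lambda>s. V W1 s (c + s) - V W2 s (c + s)) has_real_derivative P W1 s (c + s) - P W2 s (c + s)) (at s)" for c s
      by (intro DERIV_diff V_char W)
    show "V W1 t 0 - V W2 t 0 = 0" for t by (simp add: V_0 W)
    show "\<bar>V W1 0 r - V W2 0 r\<bar> \<le> c * r * wt (- 1 - \<kappa>) r" if "0 \<le> r" for r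
      using that c by (simp add: V_def duhamel_0[OF K_cont[OF W(1)]] duhamel_0[OF K_cont[OF W(2)]])
    fix t r :: real assume tr: "0 \<le> t" "0 \<le> r"
    have cK: "continuous_on UNIV (\<lambda>s. K W s (r + t - s))" if "W \<in> good" for W
      by (intro cont2_comp[OF K_cont[OF that]] continuous_intros)
    have "P W1 t r - P W2 t r = sint (\<lambda>s. (\<lambda>s x. K W1 s x - K W2 s x) s (r + t - s)) t"
      by (simp add: P_def sint_diff[OF cK[OF W(1)] cK[OF W(2)]])
    also have "\<bar>\<dots>\<bar> \<le> c * wt (- 1 - \<kappa>) (t + r)"
      unfolding c_def
      by (rule incoming_ray_bound[OF _ par(7) tr K_diff_le[OF W d le]])
        (use K_cont[OF W(1)] K_cont[OF W(2)] par d in \<open>auto simp: case_prod_beta intro!: continuous_on_diff\<close>)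
    finally show "\<bar>P W1 t r - P W2 t r\<bar> \<le> c * wt (- 1 - \<kappa>) (t + r)" .
  qed (use par c sx in auto)
  then have vd: "x * \<bar>quo (Vr W1) s x - quo (Vr W2) s x\<bar> \<le> N' * (x * wt (- 1) (s + x) * wt (- \<kappa>) (s - x))"
    using sx by (simp add: V_eq_quo[OF W(1)] V_eq_quo[OF W(2)] N'_def right_diff_distrib[symmetric] abs_mult)
  define b where "b = N * wt (- 1) (s + x) * wt (- \<kappa>) (s - x)"
  have "\<bar>\<bar>quo (Vr W1) s x\<bar> powr q - \<bar>quo (Vr W2) s x\<bar> powr q\<bar> \<le> q * b powr (q - 1) * \<bar>quo (Vr W1) s x - quo (Vr W2) s x\<bar>"
    using quo_le[OF W(1) sx(1) x] quo_le[OF W(2) sx(1) x] par by (intro abs_powr_diff) (auto simp: b_def)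
  then have "x * \<bar>\<bar>quo (Vr W1) s x\<bar> powr q - \<bar>quo (Vr W2) s x\<bar> powr q\<bar> \<le> x * (q * b powr (q - 1) * \<bar>quo (Vr W1) s x - quo (Vr W2) s x\<bar>)"
    using sx by (intro mult_left_mono)
  also have "\<dots> = q * b powr (q - 1) * (x * \<bar>quo (Vr W1) s x - quo (Vr W2) s x\<bar>)" by simp
  also have "\<dots> \<le> q * b powr (q - 1) * (N' * (x * wt (- 1) (s + x) * wt (- \<kappa>) (s - x)))"
    using par by (intro mult_left_mono vd) auto
  also have "\<dots> = q * N powr (q - 1) * N' * (x * wt (- q) (s + x) * wt (- (\<kappa> * q)) (s - x))"
  proof -
    have "b powr (q - 1) = N powr (q - 1) * (wt (1 - q) (s + x) * wt (- (\<kappa> * (q - 1))) (s - x))"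
      unfolding b_def using N_pos by (simp add: powr_mult wt_powr mult.assoc)
    moreover have "wt (1 - q) (s + x) * wt (- 1) (s + x) = wt (- q) (s + x)"
      using wt_add[of "1 - q" "-1" "s + x"] by simp
    moreover have "wt (- (\<kappa> * (q - 1))) (s - x) * wt (- \<kappa>) (s - x) = wt (- (\<kappa> * q)) (s - x)"
      using wt_add[of "- (\<kappa> * (q - 1))" "-\<kappa>" "s - x"] by (simp add: algebra_simps)
    ultimately show ?thesis by algebra
  qed
  also have "x * \<bar>\<bar>quo (Vr W1) s x\<bar> powr q - \<bar>quo (Vr W2) s x\<bar> powr q\<bar> = \<bar>H W1 s x - H W2 s x\<bar>"
    using sx by (simp add: H_def abs_mult right_diff_distrib[symmetric])
  finally show ?thesis by (simp add: N'_def c_def)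
qed

text \<open>For the difference of the sources only its size is known, hence
  \<open>duhamel_t_weak_bound\<close>, which returns precisely the weight \<Phi>.\<close>

lemma picard_contr:
  assumes W: "W1 \<in> good" "W2 \<in> good" and d: "0 \<le> d"
    and le: "\<And>t r. 0 \<le> t \<Longrightarrow> \<bar>W1 (t, r) - W2 (t, r)\<bar> \<le> d * \<Phi> (t, r)"
    and t: "0 \<le> t"
  shows "\<bar>picard W1 (t, r) - picard W2 (t, r)\<bar> \<le> contraction_const * d * \<Phi> (t, r)"
proof -
  define H' where "H' s x = H W1 s x - H W2 s x" for s x
  have cH: "cont2 H'"
    using H_cont[OF W(1)] H_cont[OF W(2)] unfolding H'_def case_prod_beta by (intro continuous_on_diff)
  have oH: "H' s (- x) = - H' s x" for s x by (simp add: H'_def H_odd[OF W(1)] H_odd[OF W(2)])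
  define c where "c = q * N powr (q - 1) * (p * M powr (p - 1) * d / (\<kappa> * q * p - 1) * (1 / \<kappa> + 2))"
  have c: "0 \<le> c" using par d by (simp add: c_def)
  have H'_le: "\<bar>H' s x\<bar> \<le> c * (x * wt (- q) (s + x) * wt (- (\<kappa> * q)) (s - x))" if "0 \<le> s" "0 \<le> x" for s x
    unfolding H'_def c_def by (rule H_diff_le[OF W d le that])
  have *: "\<bar>duhamel_t H' t r\<bar> \<le> c * weak_const * \<Phi> (t, r)" if r: "0 \<le> r" for r
    using duhamel_t_weak_bound[OF cH par(1,2) a01 par(6) c oH H'_le t r] r by (simp add: weak_const_def \<Phi>_def)
  have "\<bar>duhamel_t H' t r\<bar> \<le> c * weak_const * \<Phi> (t, r)"
  proof (cases "0 \<le> r")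
    case False
    then show ?thesis using *[of "- r"] duhamel_odd(2)[of H', OF oH, of t r] by (simp add: \<Phi>_def)
  qed (rule *)
  moreover have "picard W1 (t, r) - picard W2 (t, r) = duhamel_t H' t r"
  proof -
    have cr: "continuous_on UNIV (\<lambda>s. H W s (r + t - s) + H W s (r - t + s))" if "W \<in> good" for W
      by (intro continuous_intros cont2_comp[OF H_cont[OF that]])
    show ?thesis
      using sint_diff[OF cr[OF W(1)] cr[OF W(2)], of t]
      by (simp add: picard_def duhamel_t_def H'_def diff_divide_distrib algebra_simps)
  qed
  moreover have "c * weak_const = contraction_const * d" by (simp add: c_def contraction_const_def)
  ultimately show ?thesis by simp
qed

lemma fixpoint:
  assumes small: "\<epsilon> * C + 3 * N powr q * (3 * weak_const + 4) \<le> M" "contraction_const \<le> 1 / 2"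
  obtains W where "W \<in> good" "\<And>t r. 0 \<le> t \<Longrightarrow> picard W (t, r) = W (t, r)"
proof -
  have "\<exists>W\<in>good. \<forall>z\<in>{0..} \<times> UNIV. picard W z = W z"
  \<comment> \<open>By \<open>strong_le_\<Phi>\<close> every element of the ball is at most M
    \<Phi>, so two of them differ by at most 2M \<Phi>.\<close>
  proof (rule contraction_fixpoint[where ?f0.0 = "\<lambda>_. 0" and \<Phi> = \<Phi> and b = "2 * M"])
    show "(\<lambda>_. 0) \<in> good" using pos by (simp add: good_def)
    show "picard W \<in> good" if "W \<in> good" for W by (rule picard_good[OF that small(1)])
    show "0 \<le> \<Phi> z" for z using \<Phi>_pos[of z] by simp
    show "0 \<le> 2 * M" using pos by simp
    show "\<forall>z\<in>{0..} \<times> UNIV. \<bar>f z - g z\<bar> \<le> 2 * M * \<Phi> z" if fg: "f \<in> good" "g \<in> good" for f g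
    proof
      fix z :: "real \<times> real" assume "z \<in> {0..} \<times> UNIV"
      then obtain t r where z: "z = (t, r)" and t: "0 \<le> t" by auto
      have *: "\<bar>W (t, r)\<bar> \<le> M * \<Phi> (t, r)" if W: "W \<in> good" for W
      proof -
        have "\<bar>W (t, r)\<bar> = \<bar>W (t, \<bar>r\<bar>)\<bar>" using W_odd[OF W t, of r] by (cases "0 \<le> r") auto
        also have "\<dots> \<le> M * \<Phi> (t, \<bar>r\<bar>)"
          using W_le[OF W t, of "\<bar>r\<bar>"] strong_le_\<Phi>[OF t, of "\<bar>r\<bar>"] pos
          by (meson abs_ge_zero less_imp_le mult_left_mono order.trans)
        finally show ?thesis by (simp add: \<Phi>_def)
      qed
      show "\<bar>f z - g z\<bar> \<le> 2 * M * \<Phi> z" using *[OF fg(1)] *[OF fg(2)] unfolding z by linarith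
    qed
    show "\<forall>z\<in>{0..} \<times> UNIV. \<bar>picard f z - picard g z\<bar> \<le> d / 2 * \<Phi> z"
      if fg: "f \<in> good" "g \<in> good" and d: "0 \<le> d" and le: "\<forall>z\<in>{0..} \<times> UNIV. \<bar>f z - g z\<bar> \<le> d * \<Phi> z" for f g d
    proof
      fix z :: "real \<times> real" assume "z \<in> {0..} \<times> UNIV"
      then obtain t r where z: "z = (t, r)" and t: "0 \<le> t" by auto
      have "\<bar>picard f (t, r) - picard g (t, r)\<bar> \<le> contraction_const * d * \<Phi> (t, r)"
        by (rule picard_contr[OF fg d _ t]) (use le in auto)
      also have "\<dots> \<le> 1 / 2 * d * \<Phi> (t, r)"
        using small(2) d \<Phi>_pos[of "(t, r)"] by (intro mult_right_mono) auto
      finally show "\<bar>picard f z - picard g z\<bar> \<le> d / 2 * \<Phi> z" by (simp add: z)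
    qed
  next
    fix F f assume F: "\<And>n. F n \<in> good" and le: "\<And>n. \<forall>z\<in>{0..} \<times> UNIV. \<bar>F n z - f z\<bar> \<le> 2 * M / 2 ^ n * \<Phi> z"
    have to0: "(\<lambda>n. 2 * M / 2 ^ n * c) \<longlonglongrightarrow> 0" for c
    proof -
      have "(\<lambda>n. 2 * M * c * (1 / 2) ^ n) \<longlonglongrightarrow> 2 * M * c * 0" by (intro tendsto_mult tendsto_const LIMSEQ_power_zero) auto
      then show ?thesis by (simp add: power_divide mult_ac)
    qed
    have lim: "(\<lambda>n. F n (t, r)) \<longlonglongrightarrow> f (t, r)" if "0 \<le> t" for t r
    proof (rule Lim_transform2)
      show "(\<lambda>n. f (t, r)) \<longlonglongrightarrow> f (t, r)" by simp
      have "\<forall>\<^sub>F n in sequentially. norm (f (t, r) - F n (t, r)) \<le> 2 * M / 2 ^ n * \<Phi> (t, r)"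
        using le that by (intro always_eventually allI) (force simp: abs_minus_commute)
      from Lim_null_comparison[OF this to0] show "(\<lambda>n. f (t, r) - F n (t, r)) \<longlonglongrightarrow> 0" .
    qed
    \<comment> \<open>Division by \<Phi>, which is positive and continuous, turns the weighted rate
      into a uniform one, so continuity survives; oddness and the stronger bound pass to the limit
      pointwise.\<close>
    have "uniform_limit ({0..} \<times> UNIV) (\<lambda>n z. F n z / \<Phi> z) (\<lambda>z. f z / \<Phi> z) sequentially"
    proof (rule uniform_limitI)
      fix e :: real assume "0 < e"
      with order_tendstoD(2)[OF to0[of 1]] have "\<forall>\<^sub>F n in sequentially. 2 * M / 2 ^ n * 1 < e" by blast
      then show "\<forall>\<^sub>F n in sequentially. \<forall>z\<in>{0..} \<times> UNIV. dist (F n z / \<Phi> z) (f z / \<Phi> z) < e"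
      proof eventually_elim
        case (elim n)
        show ?case
        proof
          fix z :: "real \<times> real" assume z: "z \<in> {0..} \<times> UNIV"
          have "dist (F n z / \<Phi> z) (f z / \<Phi> z) = \<bar>F n z - f z\<bar> / \<Phi> z"
            using \<Phi>_pos[of z] by (simp add: dist_real_def diff_divide_distrib[symmetric] abs_divide)
          also have "\<dots> \<le> 2 * M / 2 ^ n" using bspec[OF le[of n] z] \<Phi>_pos[of z] by (simp add: pos_divide_le_eq)
          also have "\<dots> < e" using elim by simp
          finally show "dist (F n z / \<Phi> z) (f z / \<Phi> z) < e" .
        qed
      qed
    qed
    then have "continuous_on ({0..} \<times> UNIV) (\<lambda>z. f z / \<Phi> z)"
    proof (rule uniform_limit_theorem[rotated])
      show "\<forall>\<^sub>F n in sequentially. continuous_on ({0..} \<times> UNIV) (\<lambda>z. F n z / \<Phi> z)"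
        using F \<Phi>_pos by (intro always_eventually allI continuous_on_divide \<Phi>_cont) (auto simp: good_def less_imp_neq[THEN not_sym])
    qed simp
    then have "continuous_on ({0..} \<times> UNIV) (\<lambda>z. f z / \<Phi> z * \<Phi> z)"
      by (intro continuous_on_mult \<Phi>_cont)
    moreover have "f z / \<Phi> z * \<Phi> z = f z" for z using \<Phi>_pos[of z] by simp
    ultimately have "continuous_on ({0..} \<times> UNIV) f" by simp
    moreover have "f (t, - r) = - f (t, r)" if "0 \<le> t" for t r
    proof (rule LIMSEQ_unique[OF lim[OF that]])
      show "(\<lambda>n. F n (t, - r)) \<longlonglongrightarrow> - f (t, r)"
        using tendsto_minus[OF lim[OF that, of r]] W_odd[OF F that] by simp
    qed
    moreover have "\<bar>f (t, r)\<bar> \<le> M * (r * wt (1 - q) (t + r) * wt (- (\<kappa> * q)) (t - r))" if "0 \<le> t" "0 \<le> r" for t r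
      by (rule LIMSEQ_le_const2[OF tendsto_rabs[OF lim[OF that(1)]]]) (use W_le[OF F that] in auto)
    ultimately show "f \<in> good" by (simp add: good_def)
  qed
  then show ?thesis using that by auto
qed

end

section \<open>Regularity on the axis and the global solution\<close>

lemma free_wave_scale:
  "free_wave D Dt Dr Dtt \<Longrightarrow> free_wave (\<lambda>t r. c * D t r) (\<lambda>t r. c * Dt t r) (\<lambda>t r. c * Dr t r) (\<lambda>t r. c * Dtt t r)"
  unfolding free_wave_def case_prod_beta by (auto intro!: continuous_on_mult_left DERIV_cmult)

context coupled
begin

text \<open>The radial derivative of r |v|^q with r v_r written as V_r - v. No quotient by r is
  left, so it is continuous across the axis.\<close>

definition Hx :: "(real \<times> real \<Rightarrow> real) \<Rightarrow> real \<Rightarrow> real \<Rightarrow> real" where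
  "Hx W s x = (1 - q) * \<bar>quo (Vr W) s x\<bar> powr q + q * (\<bar>quo (Vr W) s x\<bar> powr (q - 1) * sgn (quo (Vr W) s x)) * Vr W s x"

context
  fixes W assumes W: "W \<in> good"
begin

lemma Hx_cont: "cont2 (Hx W)"
proof -
  have c: "continuous_on UNIV (\<lambda>z. quo (Vr W) (fst z) (snd z))" "continuous_on UNIV (\<lambda>z. Vr W (fst z) (snd z))"
    using quo_cont[OF Vr_cont[OF W]] Vr_cont[OF W] by (simp_all add: case_prod_beta)
  have q: "0 < q" "0 < q - 1" using par by auto
  show ?thesis unfolding Hx_def case_prod_beta
    by (intro continuous_on_add continuous_on_mult continuous_on_const continuous_on_abs_powr(1)[OF c(1) q(1)]
      continuous_on_abs_powr(2)[OF c(1) q(2)] c(2))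
qed

text \<open>On the axis the difference quotient is |v|^q itself; off the axis the cancellation is
  that of \<open>H_diff\<close>, now in the radial direction.\<close>

lemma H_deriv: "(H W s has_real_derivative Hx W s x) (at x)"
proof (cases "x = 0")
  case True
  have "continuous_on UNIV (\<lambda>h. \<bar>quo (Vr W) s h\<bar> powr q)"
    using par by (intro continuous_on_abs_powr(1) cont2_flat[OF quo_cont[OF Vr_cont[OF W]]]) auto
  then have "isCont (\<lambda>h. \<bar>quo (Vr W) s h\<bar> powr q) 0" by (simp add: continuous_on_eq_continuous_within)
  then have lim: "((\<lambda>h. \<bar>quo (Vr W) s h\<bar> powr q) \<longlongrightarrow> \<bar>quo (Vr W) s 0\<bar> powr q) (at 0)"
    by (simp add: isCont_def)
  have "\<forall>\<^sub>F h in at 0. \<bar>quo (Vr W) s h\<bar> powr q = (H W s (0 + h) - H W s 0) / h"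
    by (auto simp: eventually_at_filter H_def)
  from Lim_transform_eventually[OF lim this]
  have "(H W s has_real_derivative \<bar>quo (Vr W) s 0\<bar> powr q) (at 0)" by (simp add: DERIV_def)
  moreover have "Hx W s 0 = \<bar>quo (Vr W) s 0\<bar> powr q"
  proof -
    have v: "\<bar>y\<bar> powr (q - 1) * sgn y * y = \<bar>y\<bar> powr q" for y :: real
      by (cases "y = 0") (simp_all add: powr_diff sgn_if abs_if)
    show ?thesis unfolding Hx_def using v[of "Vr W s 0"] by (simp add: quo_0 algebra_simps)
  qed
  ultimately show ?thesis using True by simp
next
  case False
  define \<nu> where "\<nu> y = V W s y / y" for y
  have \<nu>: "quo (Vr W) s y = \<nu> y" if "y \<noteq> 0" for y using that by (simp add: \<nu>_def V_eq_quo[OF W])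
  have dx: "((\<lambda>y. y) has_real_derivative 1) (at x)" by (auto intro!: derivative_eq_intros)
  have d\<nu>: "(\<nu> has_real_derivative (Vr W s x - \<nu> x) / x) (at x)"
    unfolding \<nu>_def[abs_def]
    by (rule DERIV_cong[OF DERIV_divide[OF V_deriv_r[OF W] dx False]]) (use False in \<open>simp_all add: \<nu>_def field_simps\<close>)
  have "((\<lambda>y. y * \<bar>\<nu> y\<bar> powr q) has_real_derivative
      1 * \<bar>\<nu> x\<bar> powr q + q * (\<bar>\<nu> x\<bar> powr (q - 1) * sgn (\<nu> x)) * ((Vr W s x - \<nu> x) / x) * x) (at x)"
    by (rule DERIV_mult[OF dx DERIV_chain2[where f = "\<lambda>y. \<bar>y\<bar> powr q" and g = \<nu>, OF abs_powr_deriv[OF par(1)] d\<nu>]])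
  moreover have "1 * \<bar>\<nu> x\<bar> powr q + q * (\<bar>\<nu> x\<bar> powr (q - 1) * sgn (\<nu> x)) * ((Vr W s x - \<nu> x) / x) * x = Hx W s x"
  proof -
    have "\<bar>\<nu> x\<bar> powr (q - 1) * sgn (\<nu> x) * \<nu> x = \<bar>\<nu> x\<bar> powr q"
      by (cases "\<nu> x = 0") (simp_all add: powr_diff sgn_if abs_if)
    moreover have "(Vr W s x - \<nu> x) / x * x = Vr W s x - \<nu> x" using False by simp
    moreover have "1 * A + q * \<sigma> * d * x = (1 - q) * A + q * \<sigma> * R" if "\<sigma> * n = A" "d * x = R - n" for A \<sigma> d R n
      by (simp only: that(1)[symmetric] mult.assoc that(2)) (simp add: algebra_simps)
    ultimately show ?thesis unfolding Hx_def \<nu>[OF False] by blast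
  qed
  ultimately have dh0: "((\<lambda>y. y * \<bar>\<nu> y\<bar> powr q) has_real_derivative Hx W s x) (at x)" by simp
  have "\<forall>\<^sub>F y in nhds x. y \<in> - {0}" using False by (intro eventually_nhds_in_open) (auto simp: open_Compl)
  then have ev: "\<forall>\<^sub>F y in nhds x. H W s y = y * \<bar>\<nu> y\<bar> powr q" by eventually_elim (simp add: H_def \<nu>)
  show ?thesis by (rule iffD2[OF DERIV_cong_ev[OF refl ev refl] dh0])
qed

end

text \<open>With U = r u, the functions u, v and u_t are the averages \<open>quo\<close> of U_r, V_r
  and W_r. As the time derivative of U_r is W_r, u_t is the time derivative of u at every point, the
  axis included.\<close>

lemma global_solution:
  fixes f g f2 g2 :: "E \<Rightarrow> real"
  assumes small: "\<epsilon> * C + 3 * N powr q * (3 * weak_const + 4) \<le> M" "contraction_const \<le> 1 / 2"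
    and cont: "continuous_on UNIV f" "continuous_on UNIV g" "continuous_on UNIV f2" "continuous_on UNIV g2"
    and f: "\<And>x. x \<noteq> 0 \<Longrightarrow> f x = D1 0 (norm x) / norm x" and g: "\<And>x. x \<noteq> 0 \<Longrightarrow> g x = Dt1 0 (norm x) / norm x"
    and f2: "\<And>x. x \<noteq> 0 \<Longrightarrow> f2 x = D2 0 (norm x) / norm x" and g2: "\<And>x. x \<noteq> 0 \<Longrightarrow> g2 x = Dt2 0 (norm x) / norm x"
  shows "\<exists>(u :: real \<Rightarrow> E \<Rightarrow> real) (v :: real \<Rightarrow> E \<Rightarrow> real) (ut :: real \<Rightarrow> E \<Rightarrow> real).
    continuous_on ({0..} \<times> UNIV) (\<lambda>(t,x). u t x) \<and>
    continuous_on ({0..} \<times> UNIV) (\<lambda>(t,x). v t x) \<and>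
    continuous_on ({0..} \<times> UNIV) (\<lambda>(t,x). ut t x) \<and>
    (\<forall>t\<ge>0. \<forall>x. ((\<lambda>s. u s x) has_real_derivative ut t x) (at t within {0..})) \<and>
    weak_wave_sol u (\<lambda>t x. \<bar>v t x\<bar> powr q) (\<lambda>x. \<epsilon> * f x) (\<lambda>x. \<epsilon> * g x) \<and>
    weak_wave_sol v (\<lambda>t x. \<bar>ut t x\<bar> powr p) (\<lambda>x. \<epsilon> * f2 x) (\<lambda>x. \<epsilon> * g2 x)"
proof -
  obtain W where W: "W \<in> good" and fp: "\<And>t r. 0 \<le> t \<Longrightarrow> picard W (t, r) = W (t, r)"
    using fixpoint[OF small] by blast
  note w1' = w1(1)[unfolded free_wave_def]
  define Ur where "Ur t r = \<epsilon> * Dr1 t r + duhamel_r (H W) t r" for t r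
  define Wr where "Wr t r = \<epsilon> * Dtr1 t r + duhamel_t (Hx W) t r" for t r
  have cUr: "cont2 Ur" and cWr: "cont2 Wr"
    using w1' w1(2) duhamel_r_cont[OF H_cont[OF W]] duhamel_t_cont[OF Hx_cont[OF W]]
    unfolding Ur_def Wr_def case_prod_beta by (auto intro!: continuous_on_add continuous_on_mult_left)
  have dUr: "((\<lambda>t. Ur t r) has_real_derivative Wr t r) (at t)" for t r
    unfolding Ur_def Wr_def
    by (intro DERIV_add DERIV_cmult w1(4) duhamel_r_deriv_t[OF H_cont[OF W] Hx_cont[OF W] H_deriv[OF W]])
  have qU: "quo Ur t r = (\<epsilon> * D1 t r + duhamel (H W) t r) / r" if "r \<noteq> 0" for t r
  proof (rule quo_eq[OF _ _ that])
    show "((\<lambda>r. \<epsilon> * D1 t r + duhamel (H W) t r) has_real_derivative Ur t r) (at r)" for r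
      unfolding Ur_def using w1' by (intro DERIV_add DERIV_cmult duhamel_deriv_r[OF H_cont[OF W]]) auto
    show "\<epsilon> * D1 t 0 + duhamel (H W) t 0 = 0"
      using w1(5)[of t 0] duhamel_odd(1)[of "H W" t 0, OF H_odd[OF W]] by simp
  qed
  \<comment> \<open>\<open>picard W\<close> takes the place of \<open>W\<close> because it is
    differentiable on the whole plane; the two agree for t >= 0.\<close>
  have qW: "quo Wr t r = picard W (t, r) / r" if "r \<noteq> 0" for t r
  proof (rule quo_eq[where F = "\<lambda>r. picard W (t, r)", OF _ _ that])
    show "((\<lambda>r. picard W (t, r)) has_real_derivative Wr t r) (at r)" for r
      unfolding picard_def Wr_def fst_conv snd_conv
      by (intro DERIV_add DERIV_cmult w1(3) duhamel_t_deriv_r[OF H_cont[OF W] Hx_cont[OF W] H_deriv[OF W]])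
    show "picard W (t, 0) = 0"
      using w1(6)[of t 0] duhamel_odd(2)[of "H W" t 0, OF H_odd[OF W]] by (simp add: picard_def)
  qed
  have qV: "quo (Vr W) t r = (\<epsilon> * D2 t r + duhamel (K W) t r) / r" if "r \<noteq> 0" for t r
    using that V_eq_quo[OF W, of t r] by (simp add: V_def field_simps)
  have HF: "\<bar>quo (Vr W) t (norm x)\<bar> powr q = H W t (norm x) / norm x" if "x \<noteq> 0" for t and x :: E
    using that by (simp add: H_def)
  \<comment> \<open>The fixed point equation closes the system here: the source built from
    \<open>W\<close> is |u_t|^p.\<close>
  have KF: "\<bar>quo Wr t (norm x)\<bar> powr p = K W t (norm x) / norm x" if "x \<noteq> 0" "0 \<le> t" for t and x :: E
    using that fp[of t "norm x"] by (simp add: K_def qW max_def)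
  have cq: "continuous_on A (\<lambda>(t, x). quo G t (norm (x :: E)))" if "cont2 G" for G A
    unfolding case_prod_beta by (intro cont2_comp[OF quo_cont[OF that]] continuous_intros)
  have cqp: "continuous_on A (\<lambda>(t, x). \<bar>quo G t (norm (x :: E))\<bar> powr e)" if "cont2 G" "0 < e" for G A e
    using continuous_on_abs_powr(1)[OF cq[OF that(1)] that(2)] by (simp add: case_prod_beta)
  show ?thesis
  proof (intro exI conjI allI impI)
    show "continuous_on ({0..} \<times> UNIV) (\<lambda>(t, x :: E). quo Ur t (norm x))" by (rule cq[OF cUr])
    show "continuous_on ({0..} \<times> UNIV) (\<lambda>(t, x :: E). quo (Vr W) t (norm x))" by (rule cq[OF Vr_cont[OF W]])
    show "continuous_on ({0..} \<times> UNIV) (\<lambda>(t, x :: E). quo Wr t (norm x))" by (rule cq[OF cWr])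
    show "((\<lambda>s. quo Ur s (norm x)) has_real_derivative quo Wr t (norm x)) (at t within {0..})" for t and x :: E
      by (rule has_field_derivative_at_within[OF quo_deriv[OF cUr cWr dUr]])
    show "weak_wave_sol (\<lambda>t x. quo Ur t (norm x)) (\<lambda>t x. \<bar>quo (Vr W) t (norm x)\<bar> powr q) (\<lambda>x. \<epsilon> * f x) (\<lambda>x. \<epsilon> * g x)"
      by (rule weak_wave_solI[OF free_wave_scale[OF w1(1), of \<epsilon>] H_cont[OF W] cq[OF cUr] cqp[OF Vr_cont[OF W]]])
        (use par cont qU f g in \<open>auto intro!: continuous_on_mult_left simp: HF\<close>)
    show "weak_wave_sol (\<lambda>t x. quo (Vr W) t (norm x)) (\<lambda>t x. \<bar>quo Wr t (norm x)\<bar> powr p) (\<lambda>x. \<epsilon> * f2 x) (\<lambda>x. \<epsilon> * g2 x)"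
      by (rule weak_wave_solI[OF free_wave_scale[OF w2(1), of \<epsilon>] K_cont[OF W] cq[OF Vr_cont[OF W]] cqp[OF cWr]])
        (use par cont qV f2 g2 in \<open>auto intro!: continuous_on_mult_left simp: KF\<close>)
  qed
qed

end

section \<open>Choice of the parameters\<close>

lemma powr_smallness:
  fixes e \<eta> :: real
  assumes "0 < e" "0 < \<eta>" "\<eta> \<le> 1" "0 \<le> m" "m \<le> \<eta> powr (1 / e)"
  shows "m powr e \<le> \<eta>" "m \<le> 1"
proof -
  have "m powr e \<le> (\<eta> powr (1 / e)) powr e" using assms by (intro powr_mono2) auto
  also have "\<dots> = \<eta>" using assms by (simp add: powr_powr)
  finally show "m powr e \<le> \<eta>" .
  have "\<eta> powr (1 / e) \<le> 1 powr (1 / e)" using assms by (intro powr_mono2) auto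
  then show "m \<le> 1" using assms by simp
qed

theorem theorem1p3:
  fixes p q :: real
    and f g f2 g2 :: "real^3 \<Rightarrow> real"
  assumes "p * (q - 1) > 2 + 1 / (p * q)"
    and "1 < q" "q < 2" "2 < p" "p < 3"
    and "C2_fun f" "C2_fun f2" "C1_fun g" "C1_fun g2"
    and "radial f" "radial g" "radial f2" "radial g2"
    and "supp_in_unit_ball f" "supp_in_unit_ball g"
    and "supp_in_unit_ball f2" "supp_in_unit_ball g2"
  shows "\<exists>\<epsilon>0>0. \<forall>\<epsilon>. 0 < \<epsilon> \<and> \<epsilon> < \<epsilon>0 \<longrightarrow>
           (\<exists>(u :: real \<Rightarrow> real^3 \<Rightarrow> real) (v :: real \<Rightarrow> real^3 \<Rightarrow> real)
              (ut :: real \<Rightarrow> real^3 \<Rightarrow> real).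
              continuous_on ({0..} \<times> UNIV) (\<lambda>(t,x). u t x) \<and>
              continuous_on ({0..} \<times> UNIV) (\<lambda>(t,x). v t x) \<and>
              continuous_on ({0..} \<times> UNIV) (\<lambda>(t,x). ut t x) \<and>
              (\<forall>t\<ge>0. \<forall>x. ((\<lambda>s. u s x) has_real_derivative ut t x) (at t within {0..})) \<and>
              weak_wave_sol u (\<lambda>t x. \<bar>v t x\<bar> powr q)
                 (\<lambda>x. \<epsilon> * f x) (\<lambda>x. \<epsilon> * g x) \<and>
              weak_wave_sol v (\<lambda>t x. \<bar>ut t x\<bar> powr p)
                 (\<lambda>x. \<epsilon> * f2 x) (\<lambda>x. \<epsilon> * g2 x))"
proof -
  \<comment> \<open>The midpoint of the admissible interval.\<close>
  define \<kappa> where "\<kappa> = (1 / (p * q) + min (p * (q - 1) - 2) (1 / q)) / 2"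
  have pq: "0 < p" "0 < q" using assms by auto
  have "1 / (p * q) < 1 / q" using assms by (simp add: field_simps)
  then have "1 / (p * q) < min (p * (q - 1) - 2) (1 / q)" using assms(1) by simp
  then have \<kappa>: "1 / (p * q) < \<kappa>" "\<kappa> < min (p * (q - 1) - 2) (1 / q)" by (auto simp: \<kappa>_def)
  have "0 < 1 / (p * q)" using pq by simp
  then have k1: "0 < \<kappa>" using \<kappa> by linarith
  have k2: "\<kappa> * q < 1" using \<kappa>(2) pq by (simp add: field_simps)
  have k3: "1 < \<kappa> * q * p" using \<kappa>(1) pq by (simp add: field_simps)
  have k4: "\<kappa> \<le> p * (q - 1) - 2" using \<kappa>(2) by simp
  have "\<kappa> * 1 \<le> \<kappa> * q" using k1 assms by (intro mult_left_mono) auto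
  then have k5: "\<kappa> \<le> 1" using k2 by simp
  have a0: "0 < \<kappa> * q" using k1 pq by simp
  obtain D1 Dt1 Dr1 Dtt1 Dtr1 P1 C1 where d1: "free_wave D1 Dt1 Dr1 Dtt1" "cont2 Dtr1"
    "\<And>t r. (Dt1 t has_real_derivative Dtr1 t r) (at r)" "\<And>t r. ((\<lambda>t. Dr1 t r) has_real_derivative Dtr1 t r) (at t)"
    "\<And>t r. D1 t (- r) = - D1 t r" "\<And>t r. Dt1 t (- r) = - Dt1 t r"
    and i1: "\<And>x. x \<noteq> 0 \<Longrightarrow> f x = D1 0 (norm x) / norm x" "\<And>x. x \<noteq> 0 \<Longrightarrow> g x = Dt1 0 (norm x) / norm x"
    and C1: "0 < C1" and b1: "\<And>t r. \<lbrakk>0 \<le> t; 0 \<le> r\<rbrakk> \<Longrightarrow> \<bar>Dt1 t r\<bar> \<le> C1 * (r * wt (1 - q) (t + r) * wt (- (\<kappa> * q)) (t - r))"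
    by (rule free_solution[OF \<open>C2_fun f\<close> \<open>radial f\<close> \<open>supp_in_unit_ball f\<close> \<open>C1_fun g\<close> \<open>radial g\<close> \<open>supp_in_unit_ball g\<close>
      k1 k5 assms(2,3) a0 k2]) blast
  obtain D2 Dt2 Dr2 Dtt2 Dtr2 P2 C2 where d2: "free_wave D2 Dt2 Dr2 Dtt2" "\<And>t r. D2 t (- r) = - D2 t r"
    "\<And>c s. ((\<lambda>s. D2 s (c + s)) has_real_derivative P2 s (c + s)) (at s)"
    and i2: "\<And>x. x \<noteq> 0 \<Longrightarrow> f2 x = D2 0 (norm x) / norm x" "\<And>x. x \<noteq> 0 \<Longrightarrow> g2 x = Dt2 0 (norm x) / norm x"
    and C2: "0 < C2" and b2: "\<And>t r. \<lbrakk>0 \<le> t; 0 \<le> r\<rbrakk> \<Longrightarrow> \<bar>P2 t r\<bar> \<le> C2 * wt (- 1 - \<kappa>) (t + r)"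
    "\<And>r. 0 \<le> r \<Longrightarrow> \<bar>D2 0 r\<bar> \<le> C2 * r * wt (- 1 - \<kappa>) r"
    by (rule free_solution[OF \<open>C2_fun f2\<close> \<open>radial f2\<close> \<open>supp_in_unit_ball f2\<close> \<open>C1_fun g2\<close> \<open>radial g2\<close> \<open>supp_in_unit_ball g2\<close>
      k1 k5 assms(2,3) a0 k2]) blast
  define C where "C = max C1 C2"
  have C: "0 < C" "C1 \<le> C" "C2 \<le> C" using C1 C2 by (auto simp: C_def)
  define c4 where "c4 = 1 / (1 - \<kappa> * q) + 1 / (2 - q)"
  \<comment> \<open>Chosen so that N <= L M as soon as \<epsilon> C = M/2 and M^p <= M.\<close>
  define L where "L = (1 / 2 + 1 / (\<kappa> * q * p - 1)) * (1 / \<kappa> + 2)"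
  have c4: "0 < c4" using k2 assms by (auto simp: c4_def intro!: add_pos_pos)
  have L: "0 < L" using k1 k3 by (auto simp: L_def intro!: mult_pos_pos add_pos_pos)
  \<comment> \<open>\<open>G1\<close> and \<open>G2\<close> multiply M^(q-1) in the two smallness
    conditions, the first one after division by \<open>M\<close>; \<eta> is the bound on M^(q-1)
    that makes each product at most 1/2.\<close>
  define G1 where "G1 = 3 * L powr q * (3 * c4 + 4)"
  define G2 where "G2 = q * L powr (q - 1) * (p / (\<kappa> * q * p - 1) * (1 / \<kappa> + 2)) * c4"
  have G: "0 \<le> G1" "0 \<le> G2" using c4 k1 k3 pq by (auto simp: G1_def G2_def intro!: mult_nonneg_nonneg add_nonneg_nonneg)
  define \<eta> where "\<eta> = 1 / (2 * (G1 + G2 + 1))"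
  have \<eta>: "0 < \<eta>" "\<eta> \<le> 1" "G1 * \<eta> \<le> 1 / 2" "G2 * \<eta> \<le> 1 / 2" using G by (auto simp: \<eta>_def field_simps)
  define \<epsilon>0 where "\<epsilon>0 = \<eta> powr (1 / (q - 1)) / (2 * C)"
  have \<epsilon>0: "0 < \<epsilon>0" using \<eta> C by (simp add: \<epsilon>0_def)
  show ?thesis
  proof (intro exI[of _ \<epsilon>0] conjI allI impI, goal_cases)
    case 1
    show ?case by fact
  next
    case \<epsilon>: (2 \<epsilon>)
    \<comment> \<open>The data take one half of the ball, \<epsilon> C = M/2, and leave the other
      half to the nonlinear part.\<close>
    define M where "M = 2 * C * \<epsilon>"
    have M: "0 < M" using \<epsilon> C by (simp add: M_def)
    have "M \<le> \<eta> powr (1 / (q - 1))" using \<epsilon> C by (simp add: M_def \<epsilon>0_def field_simps)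
    then have Me: "M powr (q - 1) \<le> \<eta>" "M \<le> 1"
      using powr_smallness[of "q - 1" \<eta> M] \<eta> M assms by auto
    interpret coupled p q \<kappa> C \<epsilon> M D1 Dt1 Dr1 Dtt1 Dtr1 D2 Dt2 Dr2 Dtt2 P2
    proof
      fix t r :: real assume tr: "0 \<le> t" "0 \<le> r"
      have "C1 * (r * wt (1 - q) (t + r) * wt (- (\<kappa> * q)) (t - r)) \<le> C * (r * wt (1 - q) (t + r) * wt (- (\<kappa> * q)) (t - r))"
        using C tr by (intro mult_right_mono) auto
      then show "\<bar>Dt1 t r\<bar> \<le> C * (r * wt (1 - q) (t + r) * wt (- (\<kappa> * q)) (t - r))" using b1[OF tr] by linarith
      have "C2 * wt (- 1 - \<kappa>) (t + r) \<le> C * wt (- 1 - \<kappa>) (t + r)" using C by (intro mult_right_mono) auto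
      then show "\<bar>P2 t r\<bar> \<le> C * wt (- 1 - \<kappa>) (t + r)" using b2(1)[OF tr] by linarith
    next
      fix r :: real assume r: "0 \<le> r"
      have "C2 * r * wt (- 1 - \<kappa>) r \<le> C * r * wt (- 1 - \<kappa>) r" using C r by (intro mult_right_mono) auto
      then show "\<bar>D2 0 r\<bar> \<le> C * r * wt (- 1 - \<kappa>) r" using b2(2)[OF r] by linarith
    qed (use assms k1 k2 k3 k4 k5 \<epsilon> M C d1 d2 in auto)
    have weak_const: "weak_const = c4" by (simp add: weak_const_def c4_def)
    have Mp: "M powr p \<le> M"
      using powr_mono'[of 1 p M] M Me assms by simp
    have "N \<le> (M / 2 + M / (\<kappa> * q * p - 1)) * (1 / \<kappa> + 2)"
      unfolding N_def using Mp k1 k3 by (intro mult_right_mono add_mono divide_right_mono) (auto simp: M_def)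
    also have "\<dots> = L * M" by (simp add: L_def field_simps)
    finally have NL: "N \<le> L * M" .
    have s1: "\<epsilon> * C + 3 * N powr q * (3 * weak_const + 4) \<le> M"
    proof -
      have "N powr q \<le> (L * M) powr q" using NL N_pos pq by (intro powr_mono2) auto
      also have "\<dots> = L powr q * M powr (q - 1) * M"
        using L M by (simp add: powr_mult powr_diff)
      also have "\<dots> \<le> L powr q * \<eta> * M" using Me M by (intro mult_right_mono mult_left_mono) auto
      finally have "3 * N powr q * (3 * c4 + 4) \<le> 3 * (L powr q * \<eta> * M) * (3 * c4 + 4)"
        using c4 by (intro mult_right_mono mult_left_mono) auto
      also have "\<dots> = (G1 * \<eta>) * M" by (simp add: G1_def)
      also have "\<dots> \<le> 1 / 2 * M" using \<eta> M by (intro mult_right_mono) auto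
      finally show ?thesis by (simp add: weak_const M_def)
    qed
    have s2: "contraction_const \<le> 1 / 2"
    proof -
      have "N powr (q - 1) \<le> (L * M) powr (q - 1)" using NL N_pos assms by (intro powr_mono2) auto
      also have "\<dots> = L powr (q - 1) * M powr (q - 1)" using L M by (simp add: powr_mult)
      also have "\<dots> \<le> L powr (q - 1) * \<eta>" using Me by (intro mult_left_mono) auto
      finally have n: "N powr (q - 1) \<le> L powr (q - 1) * \<eta>" .
      have m: "M powr (p - 1) \<le> 1" using M Me assms powr_mono2[of "p - 1" M 1] by simp
      have "contraction_const \<le> q * (L powr (q - 1) * \<eta>) * (p * 1 / (\<kappa> * q * p - 1) * (1 / \<kappa> + 2)) * c4"
        unfolding contraction_const_def weak_const
        using n m pq k1 k3 c4 \<eta> by (intro mult_right_mono mult_mono mult_left_mono divide_right_mono) (auto intro!: mult_nonneg_nonneg add_nonneg_nonneg)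
      also have "\<dots> = G2 * \<eta>" by (simp add: G2_def)
      finally show ?thesis using \<eta> by linarith
    qed
    have cf: "continuous_on UNIV f" "continuous_on UNIV g" "continuous_on UNIV f2" "continuous_on UNIV g2"
      using C1_fun_dd(2) C2_fun_C1(1) assms by blast+
    show ?case
      by (rule global_solution[OF s1 s2 cf i1 i2])
  qed
qed

end
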